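(* Let $\mathbf{F}\in\{\mathbf{R},\mathbf{C}\}$, let $x_*\in\mathbf{F}^d$, and let $A_1,\dots,A_n\in\mathbf{H}_d$ be positive semidefinite. Suppose the measurements are exact: $y_i=\langle A_i, x_*x_*^*\rangle$ for $i=1,\dots,n$ (i.e. $y=\mathcal{A}(x_*x_*^* )$). Consider the problem $$\min_{x\in\mathbf{F}^d} f(x),\qquad f(x)=\|y-\mathcal{A}(xx^* )\|^2=\sum_{i=1}^n\big(y_i-\langle A_i,xx^*\rangle\big)^2 .$$ 1. Suppose that for some $m,\delta_L,\delta_U>0$, $$\tfrac1n\|\mathcal{A}^*\mathcal{A}(x_*x_*^* )\|_{\mathrm{op}}\le (1+m+\delta_U)\|x_*\|^2,$$ and for all $x\in\mathbf{F}^d$, $$\tfrac1n\|\mathcal{A}(xx^*-x_*x_*^* )\|^2\ge(1-\delta_L)\big[m\|xx^*-x_*x_*^*\|_F^2+(\|x\|^2-\|x_*\|^2)^2\big],$$ and suppose $m^2+2m-2>3(m^2+2m)\delta_L+2(m+1)\delta_U$. Then every second-order critical point $x$ of this problem satisfies $xx^*=x_*x_*^*$, i.e. $x=x_*s$ for some $s\in\mathbf{F}$ with $|s|=1$. 2. For fixed $x_*$, suppose $A_i=a_ia_i^*$ (or $A_i=\operatorname{Re}(a_ia_i^* )$ if $\mathbf{F}=\mathbf{R}$ and the $a_i$ are complex), where $a_1,\dots,a_n$ are i.i.d. real or complex standard Gaussian vectors. Let $m_4=\mathbb{E}|z|^4-1$ where $z$ is a standard normal random variable of the same type (so $m_4=2$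 in the real case and $m_4=1$ in the complex case). Then there are universal constants $c_1,c_2>0$ such that, if $n\ge c_1 d\log d$, with probability at least $1-c_2n^{-2}$ the conditions of part 1 hold with $m=m_4$ (for some $\delta_L,\delta_U>0$ satisfying the inequality of part 1).
   Context: $\mathbf{H}_d$ denotes the set of $d\times d$ Hermitian matrices over $\mathbf{F}$, with Frobenius inner product $\langle A,B\rangle=\operatorname{Re}\operatorname{tr}(A^*B)$ (real for Hermitian matrices). The linear operator $\mathcal{A}:\mathbf{H}_d\to\mathbf{R}^n$ is $\mathcal{A}(S)=(\langle A_1,S\rangle,\dots,\langle A_n,S\rangle)$ and its adjoint is $\mathcal{A}^*(z)=\sum_i z_iA_i$. $\|\cdot\|_{\mathrm{op}}$ is the operator norm, $\|\cdot\|_F$ the Frobenius norm. A second-order critical point is a point where the gradient of the objective is zero and the Hessian quadratic form is positive semidefinite; in the complex case the objective is regarded as a function of the real and imaginary parts of the variable.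
   Formalization: In part 2 the case F = C with real Gaussian a_i is excluded: there the claim fails, since x_* and its complex conjugate give the same measurements (e.g. x_* = (1, i)); also d ≥ 1 and n ≥ 1 are assumed so that log d and n^{-2} make sense. *)

theory Defs
  imports "HOL-Probability.Probability"
begin

text \<open>Scalars: complex numbers; the flag re selects F = R (all entries real).
  Vectors of F^d: functions nat to complex supported on {..<d}.
  Matrices: nat to nat to complex, only the entries with indices < d matter.\<close>

definition fvecs :: "bool \<Rightarrow> nat \<Rightarrow> (nat \<Rightarrow> complex) set" where
  "fvecs re d = {x. (\<forall>j\<ge>d. x j = 0) \<and> (re \<longrightarrow> (\<forall>j. Im (x j) = 0))}"

definition hmat :: "bool \<Rightarrow> nat \<Rightarrow> (nat \<Rightarrow> nat \<Rightarrow> complex) \<Rightarrow> bool" where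
  "hmat re d A \<longleftrightarrow> (\<forall>j<d. \<forall>k<d. A k j = cnj (A j k))
      \<and> (re \<longrightarrow> (\<forall>j<d. \<forall>k<d. Im (A j k) = 0))"

definition psd :: "bool \<Rightarrow> nat \<Rightarrow> (nat \<Rightarrow> nat \<Rightarrow> complex) \<Rightarrow> bool" where
  "psd re d A \<longleftrightarrow> (\<forall>v\<in>fvecs re d. 0 \<le> Re (\<Sum>j<d. \<Sum>k<d. cnj (v j) * A j k * v k))"

definition hs_inner :: "nat \<Rightarrow> (nat \<Rightarrow> nat \<Rightarrow> complex) \<Rightarrow> (nat \<Rightarrow> nat \<Rightarrow> complex) \<Rightarrow> real" where
  "hs_inner d A B = Re (\<Sum>j<d. \<Sum>k<d. cnj (A j k) * B j k)"

definition outer :: "(nat \<Rightarrow> complex) \<Rightarrow> nat \<Rightarrow> nat \<Rightarrow> complex" where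
  "outer x = (\<lambda>j k. x j * cnj (x k))"

definition vnorm :: "nat \<Rightarrow> (nat \<Rightarrow> complex) \<Rightarrow> real" where
  "vnorm d x = sqrt (\<Sum>j<d. (cmod (x j))\<^sup>2)"

definition frob :: "nat \<Rightarrow> (nat \<Rightarrow> nat \<Rightarrow> complex) \<Rightarrow> real" where
  "frob d M = sqrt (hs_inner d M M)"

definition mat_vec :: "nat \<Rightarrow> (nat \<Rightarrow> nat \<Rightarrow> complex) \<Rightarrow> (nat \<Rightarrow> complex) \<Rightarrow> nat \<Rightarrow> complex" where
  "mat_vec d M v = (\<lambda>j. if j < d then \<Sum>k<d. M j k * v k else 0)"

definition op_norm :: "bool \<Rightarrow> nat \<Rightarrow> (nat \<Rightarrow> nat \<Rightarrow> complex) \<Rightarrow> real" where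
  "op_norm re d M = Sup {vnorm d (mat_vec d M v) | v. v \<in> fvecs re d \<and> vnorm d v = 1}"

definition meas :: "nat \<Rightarrow> (nat \<Rightarrow> nat \<Rightarrow> nat \<Rightarrow> complex) \<Rightarrow> (nat \<Rightarrow> nat \<Rightarrow> complex) \<Rightarrow> nat \<Rightarrow> real" where
  "meas d A X = (\<lambda>i. hs_inner d (A i) X)"

definition adj :: "nat \<Rightarrow> nat \<Rightarrow> (nat \<Rightarrow> nat \<Rightarrow> nat \<Rightarrow> complex) \<Rightarrow> (nat \<Rightarrow> real) \<Rightarrow> nat \<Rightarrow> nat \<Rightarrow> complex" where
  "adj d n A z = (\<lambda>j k. \<Sum>i<n. complex_of_real (z i) * A i j k)"

definition loss :: "nat \<Rightarrow> nat \<Rightarrow> (nat \<Rightarrow> nat \<Rightarrow> nat \<Rightarrow> complex) \<Rightarrow> (nat \<Rightarrow> real) \<Rightarrow> (nat \<Rightarrow> complex) \<Rightarrow> real" where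
  "loss d n A y x = (\<Sum>i<n. (y i - hs_inner d (A i) (outer x))\<^sup>2)"

text \<open>Second-order critical point of f over F^d, viewed as a real vector space
  (real and imaginary parts in the complex case): the gradient vanishes, i.e. every
  directional derivative is 0, and the Hessian quadratic form, i.e. the second
  derivative of t |-> f(x + t h) at 0, is nonnegative in every direction h.\<close>
definition sosp :: "bool \<Rightarrow> nat \<Rightarrow> ((nat \<Rightarrow> complex) \<Rightarrow> real) \<Rightarrow> (nat \<Rightarrow> complex) \<Rightarrow> bool" where
  "sosp re d f x \<longleftrightarrow> x \<in> fvecs re d \<and>
     (\<forall>h\<in>fvecs re d.
        deriv (\<lambda>t. f (\<lambda>j. x j + complex_of_real t * h j)) 0 = 0 \<and>
        0 \<le> deriv (deriv (\<lambda>t. f (\<lambda>j. x j + complex_of_real t * h j))) 0)"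

definition part1_conditions :: "bool \<Rightarrow> nat \<Rightarrow> nat \<Rightarrow> (nat \<Rightarrow> nat \<Rightarrow> nat \<Rightarrow> complex)
    \<Rightarrow> (nat \<Rightarrow> complex) \<Rightarrow> real \<Rightarrow> real \<Rightarrow> real \<Rightarrow> bool" where
  "part1_conditions re d n A xs m dL dU \<longleftrightarrow>
     m > 0 \<and> dL > 0 \<and> dU > 0 \<and>
     (1 / real n) * op_norm re d (adj d n A (meas d A (outer xs))) \<le> (1 + m + dU) * (vnorm d xs)\<^sup>2 \<and>
     (\<forall>x\<in>fvecs re d.
        (1 / real n) * (\<Sum>i<n. (hs_inner d (A i) (\<lambda>j k. outer x j k - outer xs j k))\<^sup>2)
        \<ge> (1 - dL) * (m * (frob d (\<lambda>j k. outer x j k - outer xs j k))\<^sup>2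
                       + ((vnorm d x)\<^sup>2 - (vnorm d xs)\<^sup>2)\<^sup>2)) \<and>
     m\<^sup>2 + 2 * m - 2 > 3 * (m\<^sup>2 + 2 * m) * dL + 2 * (m + 1) * dU"

text \<open>Gaussian model. Sample space: independent real N(0,sigma^2) variables w(i,j,b),
  i < n, j < d, b :: bool. Real Gaussian (gre): sigma = 1, a_i j = w(i,j,False).
  Complex standard Gaussian: sigma^2 = 1/2, a_i j = w(i,j,False) + i w(i,j,True),
  so that E|a_i j|^2 = 1.\<close>
definition gsigma :: "bool \<Rightarrow> real" where
  "gsigma gre = (if gre then 1 else sqrt (1/2))"

definition gauss_space :: "bool \<Rightarrow> nat \<Rightarrow> nat \<Rightarrow> (nat \<times> nat \<times> bool \<Rightarrow> real) measure" where
  "gauss_space gre d n =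
     PiM ({..<n} \<times> {..<d} \<times> UNIV)
         (\<lambda>_. density lborel (\<lambda>x. ennreal (normal_density 0 (gsigma gre) x)))"

definition gvec :: "bool \<Rightarrow> (nat \<times> nat \<times> bool \<Rightarrow> real) \<Rightarrow> nat \<Rightarrow> nat \<Rightarrow> complex" where
  "gvec gre w i j = (if gre then complex_of_real (w (i, j, False))
                     else Complex (w (i, j, False)) (w (i, j, True)))"

definition gmeas :: "bool \<Rightarrow> bool \<Rightarrow> (nat \<times> nat \<times> bool \<Rightarrow> real) \<Rightarrow> nat \<Rightarrow> nat \<Rightarrow> nat \<Rightarrow> complex" where
  "gmeas re gre w i = (\<lambda>j k. if re then complex_of_real (Re (gvec gre w i j * cnj (gvec gre w i k)))
                              else gvec gre w i j * cnj (gvec gre w i k))"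

text \<open>m_4 = E|z|^4 - 1: 2 for real, 1 for complex standard normal z.\<close>
definition m4 :: "bool \<Rightarrow> real" where
  "m4 gre = (if gre then 2 else 1)"

end

theory Submission
  imports Defs
begin

text \<open>
  Part 1. Write \<open>B\<^sub>i\<close> for the symmetric real bilinear form of \<open>A\<^sub>i\<close> and \<open>r\<^sub>i = B\<^sub>i(x,x) - B\<^sub>i(x\<^sub>*,x\<^sub>*)\<close>.
  Test the Hessian with the component \<open>h\<close> of \<open>x\<^sub>*\<close> orthogonal to \<open>x\<close>. The first-order condition gives
  \<open>\<Sum> r\<^sub>i B\<^sub>i(h,h) = - \<Sum> r\<^sub>i\<^sup>2\<close>, and Cauchy--Schwarz \<open>B\<^sub>i(x,h)\<^sup>2 \<le> B\<^sub>i(x,x) B\<^sub>i(h,h)\<close> turns the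
  second-order condition into \<open>3 \<Sum> r\<^sub>i\<^sup>2 \<le> 2 \<Sum> B\<^sub>i(x\<^sub>*,x\<^sub>*) B\<^sub>i(h,h)\<close>, whose right-hand side is
  controlled by the operator norm. Minimising the assumed lower bound on \<open>\<Sum> r\<^sub>i\<^sup>2\<close> over \<open>\<parallel>x\<parallel>\<close> yields a
  contradiction unless \<open>h = 0\<close> or \<open>x\<^sub>* = 0\<close>, and then \<open>r = 0\<close>.

  Part 2. After a phase alignment, \<open>xx\<^sup>* - x\<^sub>*x\<^sub>*\<^sup>*\<close> is the symmetrisation of \<open>(x - x\<^sub>*)(x + x\<^sub>*)\<^sup>*\<close>, so the
  lower isometry is a uniform lower bound on the mean of \<open>(Re (a\<^sub>i\<^sup>*u \<cdot> cnj (a\<^sub>i\<^sup>*v)))\<^sup>2\<close> over unit vectors;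
  the lower tail of nonnegative summands is sub-Gaussian, and a grid of polynomially small mesh costs only
  \<open>exp (C d ln n)\<close>. For the operator norm, the weights \<open>\<bar>a\<^sub>i\<^sup>*x\<^sub>*\<bar>\<^sup>2\<close> are truncated at \<open>32 ln n\<close>, which makes
  the summands subexponential with tail \<open>exp (- c n / ln n)\<close>; this beats the \<open>exp (C d)\<close> points of a net of
  constant mesh. Both union bounds work because \<open>n \<ge> c\<^sub>1 d ln d\<close> forces \<open>n \<ge> C d ln n\<close> once \<open>n\<close> is large.
\<close>

text \<open>The two random conditions need different nets. The lower isometry is not a norm-type
  bound, so an estimate on a net cannot be bootstrapped to the ball; it is transferred by a crude
  Lipschitz bound in max |a_i|^2, hence the polynomially small mesh. The weighted operator norm
  comes from a squared seminorm in v, for which a constant net distance suffices. There the obstacle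
  is the tail: |a^* x_*|^2 |a^* v|^2 is of degree four in Gaussians and has no exponential moment.
  Truncation restores one at the price of the exponent n / ln n, and n >= C d ln n makes this only a
  multiple of d. A net of size exp (C d ln d) would be too large, so lattice points in the ball have
  to be counted more carefully than by the enclosing box. The hypothesis on m is exactly what the
  deterministic argument needs, because 3 (m^2 + 2m) - 2 (m+1)^2 = m^2 + 2m - 2. In the Gaussian
  model this margin is smallest for m = 1, which leaves room for the constants 1/20 and 1/10. All
  numerical constants are generous powers of two; small n are absorbed into c2.\<close>

section \<open>Measurement forms and norms\<close>

text \<open>For Hermitian \<open>A\<close> this is the real part of h^* A x. It is bilinear over
  real scalars only; a complex scalar changes slots with a conjugation
  (\<open>bform_move_scalar\<close>).\<close>

definition bform :: "nat \<Rightarrow> (nat \<Rightarrow> nat \<Rightarrow> complex) \<Rightarrow> (nat \<Rightarrow> complex) \<Rightarrow> (nat \<Rightarrow> complex) \<Rightarrow> real" where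
  "bform d A x h = hs_inner d A (\<lambda>j k. x j * cnj (h k))"

lemma hs_inner_outer: "hs_inner d A (outer x) = bform d A x x"
  by (simp add: bform_def outer_def)

lemma hs_inner_diff_right:
  "hs_inner d A (\<lambda>j k. M j k - N j k) = hs_inner d A M - hs_inner d A N"
  by (simp add: hs_inner_def algebra_simps sum_subtractf)

lemma bform_add_left: "bform d A (\<lambda>j. x j + y j) h = bform d A x h + bform d A y h"
  by (simp add: bform_def hs_inner_def algebra_simps sum.distrib)

lemma bform_add_right: "bform d A x (\<lambda>j. g j + h j) = bform d A x g + bform d A x h"
  by (simp add: bform_def hs_inner_def algebra_simps sum.distrib)

lemma bform_scale_left: "bform d A (\<lambda>j. complex_of_real t * x j) h = t * bform d A x h"
proof -
  have "(\<Sum>j<d. \<Sum>k<d. cnj (A j k) * (complex_of_real t * x j * cnj (h k)))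
      = complex_of_real t * (\<Sum>j<d. \<Sum>k<d. cnj (A j k) * (x j * cnj (h k)))"
    by (simp add: sum_distrib_left algebra_simps)
  then show ?thesis by (simp add: bform_def hs_inner_def)
qed

lemma bform_scale_right: "bform d A x (\<lambda>j. complex_of_real t * h j) = t * bform d A x h"
proof -
  have "(\<Sum>j<d. \<Sum>k<d. cnj (A j k) * (x j * cnj (complex_of_real t * h k)))
      = complex_of_real t * (\<Sum>j<d. \<Sum>k<d. cnj (A j k) * (x j * cnj (h k)))"
    by (simp add: sum_distrib_left algebra_simps)
  then show ?thesis by (simp add: bform_def hs_inner_def)
qed

lemma bform_move_scalar:
  "bform d A (\<lambda>j. c * x j) h = bform d A x (\<lambda>j. cnj c * h j)"
  by (simp add: bform_def hs_inner_def algebra_simps)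

lemma bform_sym:
  assumes "hmat re d A"
  shows "bform d A x h = bform d A h x"
proof -
  have c: "cnj (A j k) = A k j" if "j < d" "k < d" for j k
    using assms that unfolding hmat_def by metis
  have "(\<Sum>j<d. \<Sum>k<d. cnj (A j k) * (x j * cnj (h k)))
      = (\<Sum>j<d. \<Sum>k<d. A k j * (x j * cnj (h k)))"
    by (intro sum.cong refl) (simp only: c lessThan_iff)
  also have "\<dots> = (\<Sum>k<d. \<Sum>j<d. A k j * (x j * cnj (h k)))"
    by (rule sum.swap)
  also have "\<dots> = cnj (\<Sum>k<d. \<Sum>j<d. cnj (A k j) * (h k * cnj (x j)))"
    by (simp add: algebra_simps)
  finally show ?thesis by (simp only: bform_def hs_inner_def cnj.sel)
qed

lemma bform_nonneg:
  assumes "psd re d A" "v \<in> fvecs re d"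
  shows "0 \<le> bform d A v v"
proof -
  have eq: "(\<Sum>j<d. \<Sum>k<d. cnj (A j k) * (v j * cnj (v k)))
      = cnj (\<Sum>j<d. \<Sum>k<d. cnj (v j) * A j k * v k)"
    by (simp add: algebra_simps)
  show ?thesis
    using assms unfolding bform_def hs_inner_def psd_def eq by (simp only: cnj.sel)
qed

section \<open>Cauchy-Schwarz for semidefinite forms, and the loss along real lines\<close>

lemma fvecs_add: "x \<in> fvecs re d \<Longrightarrow> y \<in> fvecs re d \<Longrightarrow> (\<lambda>j. x j + y j) \<in> fvecs re d"
  by (auto simp: fvecs_def)

lemma fvecs_diff: "x \<in> fvecs re d \<Longrightarrow> y \<in> fvecs re d \<Longrightarrow> (\<lambda>j. x j - y j) \<in> fvecs re d"
  by (auto simp: fvecs_def)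

lemma fvecs_scale: "x \<in> fvecs re d \<Longrightarrow> (re \<Longrightarrow> Im c = 0) \<Longrightarrow> (\<lambda>j. c * x j) \<in> fvecs re d"
  by (auto simp: fvecs_def)

text \<open>Evaluate at the vertex \<open>- b / c\<close>. The other leading coefficients need their
  own witnesses: \<open>c = 0\<close> forces \<open>b = 0\<close>, and \<open>c < 0\<close> makes
  the parabola negative far out.\<close>

lemma quadratic_nonneg_discriminant:
  fixes a b c :: real
  assumes nonneg: "\<And>t. 0 \<le> a + 2 * t * b + t\<^sup>2 * c"
  shows "b\<^sup>2 \<le> a * c"
proof (cases "c = 0")
  case True
  have "b = 0"
  proof (rule ccontr)
    assume "b \<noteq> 0"
    with nonneg[of "- (a + 1) / (2 * b)"] True show False by (simp add: field_simps)
  qed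
  with True show ?thesis by simp
next
  case False
  have "0 \<le> a" using nonneg[of 0] by simp
  have "0 < c"
  proof (rule ccontr)
    assume "\<not> 0 < c"
    with False have c: "c < 0" by simp
    \<comment> \<open>With this \<open>t\<close>, the product \<open>t * c\<close> outweighs
      \<open>2 * b\<close> by at least \<open>a + 1\<close>; the final \<open>+ 1\<close> ensures
      \<open>t \<ge> 1\<close>, so the deficit still exceeds \<open>a\<close> after multiplication
      by \<open>t\<close>.\<close>
    define t where "t = (2 * \<bar>b\<bar> + a + 1) / (- c) + 1"
    have t1: "t \<ge> 1" using c \<open>0 \<le> a\<close> by (simp add: t_def divide_nonneg_neg divide_nonneg_pos del: divide_minus_right)
    have tc: "t * c \<le> - (2 * \<bar>b\<bar> + a + 1)"
      using c by (simp add: t_def field_simps)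
    have "a + 2 * t * b + t\<^sup>2 * c = a + t * (2 * b + t * c)" by (simp add: power2_eq_square algebra_simps)
    also have "t * (2 * b + t * c) \<le> t * (- (a + 1))"
      using t1 tc by (intro mult_left_mono) auto
    also have "a + t * (- (a + 1)) < 0"
      using mult_right_mono[OF t1, of "a + 1"] \<open>0 \<le> a\<close> by (simp add: algebra_simps)
    finally show False using nonneg[of t] by simp
  qed
  with nonneg[of "- b / c"] show ?thesis
    by (simp add: field_simps power2_eq_square)
qed

lemma bform_Cauchy_Schwarz:
  assumes "hmat re d A" "psd re d A" "x \<in> fvecs re d" "h \<in> fvecs re d"
  shows "(bform d A x h)\<^sup>2 \<le> bform d A x x * bform d A h h"
proof (rule quadratic_nonneg_discriminant)
  fix t :: real
  have "0 \<le> bform d A (\<lambda>j. x j + complex_of_real t * h j) (\<lambda>j. x j + complex_of_real t * h j)"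
    using assms by (intro bform_nonneg[where re = re] fvecs_add fvecs_scale) auto
  then show "0 \<le> bform d A x x + 2 * t * bform d A x h + t\<^sup>2 * bform d A h h"
    by (simp add: bform_add_left bform_add_right bform_scale_left bform_scale_right
        bform_sym[OF assms(1), of h x] power2_eq_square algebra_simps)
qed

lemma loss_line:
  assumes "\<And>i. i < n \<Longrightarrow> hmat re d (A i)"
  shows "loss d n A y (\<lambda>j. x j + complex_of_real t * h j)
    = (\<Sum>i<n. (bform d (A i) x x - y i + 2 * t * bform d (A i) x h + t\<^sup>2 * bform d (A i) h h)\<^sup>2)"
  unfolding loss_def hs_inner_outer
proof (intro sum.cong refl)
  fix i assume "i \<in> {..<n}"
  then have s: "bform d (A i) h x = bform d (A i) x h" using bform_sym assms by blast
  have "bform d (A i) (\<lambda>j. x j + complex_of_real t * h j) (\<lambda>j. x j + complex_of_real t * h j)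
     = bform d (A i) x x + 2 * t * bform d (A i) x h + t\<^sup>2 * bform d (A i) h h"
    by (simp add: bform_add_left bform_add_right bform_scale_left bform_scale_right
        s power2_eq_square algebra_simps)
  then show "(y i - bform d (A i) (\<lambda>j. x j + complex_of_real t * h j) (\<lambda>j. x j + complex_of_real t * h j))\<^sup>2
     = (bform d (A i) x x - y i + 2 * t * bform d (A i) x h + t\<^sup>2 * bform d (A i) h h)\<^sup>2"
    by (simp add: power2_eq_square algebra_simps)
qed

text \<open>Along a line the loss is an explicit quartic in t by \<open>loss_line\<close>; its first
  and second derivatives at 0 are four times the two sums.\<close>

lemma sosp_imp_first_second_order:
  assumes hm: "\<And>i. i < n \<Longrightarrow> hmat re d (A i)"
    and sosp: "sosp re d (loss d n A y) x" and h: "h \<in> fvecs re d"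
  defines "r \<equiv> \<lambda>i. bform d (A i) x x - y i"
  shows "(\<Sum>i<n. r i * bform d (A i) x h) = 0"
    and "0 \<le> (\<Sum>i<n. r i * bform d (A i) h h + 2 * (bform d (A i) x h)\<^sup>2)"
proof -
  define b c where "b = (\<lambda>i. bform d (A i) x h)" and "c = (\<lambda>i. bform d (A i) h h)"
  define f where "f = (\<lambda>t. \<Sum>i<n. (r i + 2 * t * b i + t\<^sup>2 * c i)\<^sup>2)"
  define f' where "f' = (\<lambda>t. \<Sum>i<n. 2 * (r i + 2 * t * b i + t\<^sup>2 * c i) * (2 * b i + 2 * t * c i))"
  have f_eq: "(\<lambda>t. loss d n A y (\<lambda>j. x j + complex_of_real t * h j)) = f"
    by (simp add: loss_line[OF hm] f_def r_def b_def c_def)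
  have d1: "(f has_field_derivative f' t) (at t)" for t
    unfolding f_def f'_def
    by (rule DERIV_sum) (auto intro!: derivative_eq_intros simp: algebra_simps)
  \<comment> \<open>The iterated \<open>deriv\<close> in \<open>sosp\<close> requires the first
    derivative as a function of t, not only its value at 0.\<close>
  then have df: "deriv f = f'" by (auto intro!: ext DERIV_imp_deriv)
  have d2: "(f' has_field_derivative (\<Sum>i<n. 2 * (2 * b i) * (2 * b i) + 2 * r i * (2 * c i))) (at 0)"
    unfolding f'_def
    by (rule DERIV_sum) (auto intro!: derivative_eq_intros simp: algebra_simps)
  have "f' 0 = 0" and "0 \<le> (\<Sum>i<n. 2 * (2 * b i) * (2 * b i) + 2 * r i * (2 * c i))"
    using bspec[OF conjunct2[OF sosp[unfolded sosp_def]] h] unfolding f_eq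
    by (simp_all add: df DERIV_imp_deriv[OF d2])
  moreover have "f' 0 = 4 * (\<Sum>i<n. r i * b i)"
    by (simp add: f'_def sum_distrib_left algebra_simps)
  moreover have "(\<Sum>i<n. 2 * (2 * b i) * (2 * b i) + 2 * r i * (2 * c i))
     = 4 * (\<Sum>i<n. r i * c i + 2 * (b i)\<^sup>2)"
    by (simp add: sum_distrib_left algebra_simps power2_eq_square)
  ultimately show "(\<Sum>i<n. r i * bform d (A i) x h) = 0"
    and "0 \<le> (\<Sum>i<n. r i * bform d (A i) h h + 2 * (bform d (A i) x h)\<^sup>2)"
    by (auto simp: b_def c_def)
qed

section \<open>Vector norms, the operator norm and the adjoint\<close>

lemma vnorm_L2: "vnorm d x = L2_set (\<lambda>j. cmod (x j)) {..<d}"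
  by (simp add: vnorm_def L2_set_def)

lemma vnorm_nonneg [simp]: "0 \<le> vnorm d x"
  by (simp add: vnorm_def sum_nonneg)

lemma vnorm_sq: "(vnorm d x)\<^sup>2 = (\<Sum>j<d. (cmod (x j))\<^sup>2)"
  by (simp add: vnorm_def sum_nonneg)

lemma vnorm_scale: "vnorm d (\<lambda>j. c * x j) = cmod c * vnorm d x"
  by (simp add: vnorm_L2 norm_mult L2_set_right_distrib)

lemma vnorm_eq_0_iff: "vnorm d x = 0 \<longleftrightarrow> (\<forall>j<d. x j = 0)"
  by (auto simp: vnorm_L2 L2_set_eq_0_iff)

definition cinner :: "nat \<Rightarrow> (nat \<Rightarrow> complex) \<Rightarrow> (nat \<Rightarrow> complex) \<Rightarrow> complex" where
  "cinner d x y = (\<Sum>j<d. cnj (x j) * y j)"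

lemma cmod_cinner_le: "cmod (cinner d x y) \<le> vnorm d x * vnorm d y"
proof -
  have "cmod (cinner d x y) \<le> (\<Sum>j<d. \<bar>cmod (x j)\<bar> * \<bar>cmod (y j)\<bar>)"
    unfolding cinner_def by (rule order_trans[OF norm_sum]) (simp add: norm_mult)
  also have "\<dots> \<le> vnorm d x * vnorm d y"
    unfolding vnorm_L2 by (rule L2_set_mult_ineq)
  finally show ?thesis .
qed

lemma cinner_self: "cinner d x x = complex_of_real ((vnorm d x)\<^sup>2)"
  by (simp add: cinner_def vnorm_sq complex_norm_square mult.commute del: of_real_power)

text \<open>\<open>op_norm\<close> is a supremum of reals, so members can be compared with it only
  once the set is known to be bounded. Unit vectors have entries of modulus at most 1, and the sum
  of all entries of \<open>M\<close> in modulus is a crude bound.\<close>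

lemma op_norm_bdd:
  "bdd_above {vnorm d (mat_vec d M v) | v. v \<in> fvecs re d \<and> vnorm d v = 1}"
proof (rule bdd_aboveI)
  fix z assume "z \<in> {vnorm d (mat_vec d M v) | v. v \<in> fvecs re d \<and> vnorm d v = 1}"
  then obtain v where v: "z = vnorm d (mat_vec d M v)" "vnorm d v = 1" by auto
  have vk: "cmod (v k) \<le> 1" if "k < d" for k
    using member_le_L2_set[of "{..<d}" k "\<lambda>j. cmod (v j)"] that v(2) by (simp add: vnorm_L2)
  have "z \<le> (\<Sum>j<d. cmod (mat_vec d M v j))"
    unfolding v(1) vnorm_L2 by (rule L2_set_le_sum) simp
  also have "\<dots> \<le> (\<Sum>j<d. \<Sum>k<d. cmod (M j k))"
  proof (rule sum_mono)
    fix j assume "j \<in> {..<d}"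
    then have "cmod (mat_vec d M v j) \<le> (\<Sum>k<d. cmod (M j k * v k))"
      by (auto simp: mat_vec_def intro: norm_sum)
    also have "\<dots> \<le> (\<Sum>k<d. cmod (M j k))"
      by (intro sum_mono) (use vk in \<open>auto simp: norm_mult intro: mult_left_le\<close>)
    finally show "cmod (mat_vec d M v j) \<le> (\<Sum>k<d. cmod (M j k))" .
  qed
  finally show "z \<le> (\<Sum>j<d. \<Sum>k<d. cmod (M j k))" .
qed

lemma vnorm_mat_vec_le:
  assumes v: "v \<in> fvecs re d"
  shows "vnorm d (mat_vec d M v) \<le> op_norm re d M * vnorm d v"
proof (cases "vnorm d v = 0")
  case True
  then have "\<forall>j<d. v j = 0" by (simp add: vnorm_eq_0_iff)
  then have "vnorm d (mat_vec d M v) = 0" by (simp add: vnorm_eq_0_iff mat_vec_def)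
  with True show ?thesis by simp
next
  case False
  then have pos: "vnorm d v > 0" using vnorm_nonneg[of d v] by linarith
  define c where "c = complex_of_real (1 / vnorm d v)"
  have "vnorm d (mat_vec d M (\<lambda>j. c * v j)) \<le> op_norm re d M"
    unfolding op_norm_def
  proof (rule cSup_upper[OF _ op_norm_bdd], intro CollectI exI conjI)
    show "(\<lambda>j. c * v j) \<in> fvecs re d" using v by (rule fvecs_scale) (simp add: c_def)
    show "vnorm d (\<lambda>j. c * v j) = 1" using pos unfolding vnorm_scale c_def norm_of_real by simp
  qed simp
  moreover have "mat_vec d M (\<lambda>j. c * v j) = (\<lambda>j. c * mat_vec d M v j)"
    by (auto simp: mat_vec_def sum_distrib_left algebra_simps)
  ultimately show ?thesis
    using pos unfolding c_def by (simp only: vnorm_scale norm_of_real) (simp add: field_simps)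
qed

text \<open>Real parts are invariant under conjugation. Conjugating each form turns
  \<open>cnj (A i j k)\<close> into the entry that occurs in \<open>adj\<close>, after which only
  sums are interchanged.\<close>

lemma sum_bform_adj:
  "(\<Sum>i<n. z i * bform d (A i) h g) = Re (cinner d h (mat_vec d (adj d n A z) g))"
proof -
  have "(\<Sum>i<n. z i * bform d (A i) h g)
      = Re (\<Sum>i<n. complex_of_real (z i) * cnj (\<Sum>j<d. \<Sum>k<d. cnj (A i j k) * (h j * cnj (g k))))"
    unfolding bform_def hs_inner_def Re_sum[of _ "{..<n}"]
    by (intro sum.cong refl)
      (simp only: Re_complex_of_real Im_complex_of_real times_complex.sel cnj.sel
        mult_zero_left diff_zero)
  also have "(\<Sum>i<n. complex_of_real (z i) * cnj (\<Sum>j<d. \<Sum>k<d. cnj (A i j k) * (h j * cnj (g k))))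
      = (\<Sum>i<n. \<Sum>j<d. \<Sum>k<d. complex_of_real (z i) * A i j k * cnj (h j) * g k)"
    by (simp add: sum_distrib_left algebra_simps)
  also have "\<dots> = (\<Sum>j<d. \<Sum>i<n. \<Sum>k<d. complex_of_real (z i) * A i j k * cnj (h j) * g k)"
    by (rule sum.swap)
  also have "\<dots> = (\<Sum>j<d. \<Sum>k<d. \<Sum>i<n. complex_of_real (z i) * A i j k * cnj (h j) * g k)"
    by (rule sum.cong[OF refl], rule sum.swap)
  also have "\<dots> = cinner d h (mat_vec d (adj d n A z) g)"
    by (simp add: cinner_def mat_vec_def adj_def sum_distrib_left sum_distrib_right algebra_simps)
  finally show ?thesis .
qed

lemma sum_bform_le_op_norm:
  assumes "h \<in> fvecs re d"
  shows "(\<Sum>i<n. z i * bform d (A i) h h) \<le> op_norm re d (adj d n A z) * (vnorm d h)\<^sup>2"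
proof -
  have "(\<Sum>i<n. z i * bform d (A i) h h) \<le> vnorm d h * vnorm d (mat_vec d (adj d n A z) h)"
    unfolding sum_bform_adj
    using complex_Re_le_cmod cmod_cinner_le order_trans by blast
  also have "\<dots> \<le> vnorm d h * (op_norm re d (adj d n A z) * vnorm d h)"
    by (intro mult_left_mono vnorm_mat_vec_le assms) simp
  finally show ?thesis by (simp add: power2_eq_square algebra_simps)
qed


section \<open>Rank-one matrices: Frobenius distance and recovery up to phase\<close>

lemma hs_inner_rank_one:
  "hs_inner d (\<lambda>j k. x j * cnj (g k)) (\<lambda>j k. y j * cnj (h k)) = Re (cinner d x y * cinner d h g)"
proof -
  have "(\<Sum>j<d. \<Sum>k<d. cnj (x j * cnj (g k)) * (y j * cnj (h k))) = cinner d x y * cinner d h g"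
    unfolding cinner_def sum_product by (intro sum.cong refl) (simp add: algebra_simps)
  then show ?thesis by (simp only: hs_inner_def)
qed

lemma hs_inner_self: "hs_inner d M M = (\<Sum>j<d. \<Sum>k<d. (cmod (M j k))\<^sup>2)"
  unfolding hs_inner_def cmod_power2 by (simp add: power2_eq_square)

lemma frob_sq: "(frob d M)\<^sup>2 = hs_inner d M M"
  by (simp add: frob_def hs_inner_self sum_nonneg)

lemma cnj_cinner: "cnj (cinner d x y) = cinner d y x"
  by (simp add: cinner_def mult.commute)

lemma hs_inner_diff_left:
  "hs_inner d (\<lambda>j k. M j k - N j k) A = hs_inner d M A - hs_inner d N A"
  by (simp add: hs_inner_def algebra_simps sum_subtractf)

text \<open>Expand the square: the inner product of two rank-one projectors is the squared modulus
  of the inner product of the vectors, since exchanging the vectors conjugates it.\<close>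

lemma frob_diff_outer_sq:
  "(frob d (\<lambda>j k. outer x j k - outer y j k))\<^sup>2
     = ((vnorm d x)\<^sup>2)\<^sup>2 + ((vnorm d y)\<^sup>2)\<^sup>2 - 2 * (cmod (cinner d x y))\<^sup>2"
proof -
  have "Re (cinner d x y * cinner d y x) = (cmod (cinner d x y))\<^sup>2" for x y
  proof -
    have "cinner d y x = cnj (cinner d x y)" by (simp add: cnj_cinner)
    then show ?thesis by (simp only: complex_norm_square[symmetric] Re_complex_of_real)
  qed
  note this[of x y] this[of y x]
  moreover have "cmod (cinner d y x) = cmod (cinner d x y)"
    by (metis cnj_cinner complex_mod_cnj)
  ultimately show ?thesis
    unfolding frob_sq hs_inner_diff_left hs_inner_diff_right outer_def hs_inner_rank_one
    by (simp add: cinner_self power2_eq_square)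
qed

lemma vnorm_add_sq:
  "(vnorm d (\<lambda>j. x j + y j))\<^sup>2 = (vnorm d x)\<^sup>2 + 2 * Re (cinner d x y) + (vnorm d y)\<^sup>2"
  unfolding vnorm_sq cinner_def cmod_power2 Re_sum sum_distrib_left sum.distrib[symmetric]
  by (intro sum.cong refl) (simp add: power2_eq_square algebra_simps)

lemma cinner_scale_right: "cinner d x (\<lambda>j. c * y j) = c * cinner d x y"
  by (simp add: cinner_def sum_distrib_left algebra_simps)

lemma cinner_scale_left: "cinner d (\<lambda>j. c * x j) y = cnj c * cinner d x y"
  by (simp add: cinner_def sum_distrib_left algebra_simps)

lemma Im_cinner_real: "x \<in> fvecs True d \<Longrightarrow> y \<in> fvecs True d \<Longrightarrow> Im (cinner d x y) = 0"
  by (simp add: cinner_def fvecs_def)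

text \<open>One column of the matrix at a nonzero coordinate \<open>k\<close> of \<open>y\<close>
  already determines the phase, \<open>cnj (y k) / cnj (x k)\<close>; the diagonal entry gives it
  modulus 1. If \<open>y\<close> vanishes, the diagonal forces \<open>x\<close> to vanish and any
  phase works.\<close>

lemma outer_eq_imp_phase:
  assumes eq: "\<And>j k. j < d \<Longrightarrow> k < d \<Longrightarrow> outer x j k = outer y j k"
    and x: "x \<in> fvecs re d" and y: "y \<in> fvecs re d"
  shows "\<exists>s. (re \<longrightarrow> Im s = 0) \<and> cmod s = 1 \<and> (\<forall>j<d. x j = s * y j)"
proof (cases "\<exists>k<d. y k \<noteq> 0")
  case True
  then obtain k where k: "k < d" "y k \<noteq> 0" by blast
  have "complex_of_real ((cmod (x k))\<^sup>2) = complex_of_real ((cmod (y k))\<^sup>2)"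
    using eq[OF k(1) k(1)] by (simp only: outer_def complex_norm_square)
  then have ck: "cmod (x k) = cmod (y k)"
    by (metis of_real_eq_iff norm_ge_zero power2_eq_iff_nonneg)
  then have xk: "x k \<noteq> 0" using k by auto
  define s where "s = cnj (y k) / cnj (x k)"
  have "re \<longrightarrow> Im s = 0"
    using x y by (auto simp: s_def fvecs_def Im_divide)
  moreover have "cmod s = 1" using ck xk k by (simp add: s_def norm_divide)
  moreover have "x j = s * y j" if "j < d" for j
    using eq[OF that k(1)] xk by (simp add: outer_def s_def field_simps)
  ultimately show ?thesis by blast
next
  case False
  have "x j = 0" if "j < d" for j
    using eq[OF that that] False that by (auto simp: outer_def)
  with False show ?thesis by (intro exI[of _ 1]) auto
qed

section \<open>Second-order critical points\<close>

lemma second_order_critical_imp_exact: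
  assumes A: "\<And>i. i < n \<Longrightarrow> hmat re d (A i)" "\<And>i. i < n \<Longrightarrow> psd re d (A i)"
    and xs: "xs \<in> fvecs re d"
    and cond: "part1_conditions re d n A xs m dL dU"
    and sosp: "sosp re d (loss d n A (meas d A (outer xs))) x"
    and j: "j < d" and k: "k < d"
  shows "outer x j k = outer xs j k"
proof -
  have x: "x \<in> fvecs re d" using sosp by (simp add: sosp_def)
  define X where "X i = bform d (A i) x x" for i
  define Y where "Y i = bform d (A i) xs xs" for i
  define r where "r i = X i - Y i" for i
  define R where "R = (\<Sum>i<n. (r i)\<^sup>2)"
  define a e p where "a = (vnorm d x)\<^sup>2" and "e = (vnorm d xs)\<^sup>2" and "p = cinner d x xs"
  \<comment> \<open>if \<open>x = 0\<close> then \<open>a = 0\<close>, so \<open>c = 0\<close> and \<open>h = xs\<close>\<close>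
  define c where "c = - p / complex_of_real a"
  define h where "h = (\<lambda>j. xs j + c * x j)"
  define q where "q = (vnorm d h)\<^sup>2"
  have y: "meas d A (outer xs) = Y" by (auto simp: meas_def hs_inner_outer Y_def)
  have m: "m > 0" "dL > 0" "dU > 0"
    and big: "m\<^sup>2 + 2 * m - 2 > 3 * (m\<^sup>2 + 2 * m) * dL + 2 * (m + 1) * dU"
    and op: "(1 / real n) * op_norm re d (adj d n A Y) \<le> (1 + m + dU) * e"
    using cond by (auto simp: part1_conditions_def y e_def)
  have imc: "Im c = 0" if re
    using that x xs Im_cinner_real[of x d xs] by (simp add: c_def p_def)
  have h: "h \<in> fvecs re d" unfolding h_def using x xs imc by (intro fvecs_add fvecs_scale)
  have first: "(\<Sum>i<n. r i * bform d (A i) x g) = 0" if "g \<in> fvecs re d" for g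
    using sosp_imp_first_second_order(1)[OF A(1) sosp that] by (simp add: r_def X_def y)
  have second: "0 \<le> (\<Sum>i<n. r i * bform d (A i) h h + 2 * (bform d (A i) x h)\<^sup>2)"
    using sosp_imp_first_second_order(2)[OF A(1) sosp h] by (simp add: r_def X_def y)
  have sX: "(\<Sum>i<n. r i * X i) = 0" using first[OF x] by (simp add: X_def)
  \<comment> \<open>One factor of each square is split as \<open>X i - Y i\<close>; the
    \<open>X\<close> part vanishes by stationarity in direction \<open>x\<close>.\<close>
  have "R = (\<Sum>i<n. r i * X i) - (\<Sum>i<n. r i * Y i)"
    unfolding R_def sum_subtractf[symmetric]
    by (intro sum.cong refl) (simp add: r_def power2_eq_square algebra_simps)
  then have sY: "(\<Sum>i<n. r i * Y i) = - R" using sX by simp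
  \<comment> \<open>As \<open>h\<close> differs from \<open>xs\<close> by a multiple of
    \<open>x\<close>, its form is \<open>Y i\<close> plus a term with \<open>x\<close> in one slot,
    which the first-order condition annihilates. The scalar is moved to the other slot so that this
    slot is exactly \<open>x\<close>.\<close>
  have s1: "(\<Sum>i<n. r i * bform d (A i) h h) = - R"
  proof -
    have hx: "(\<lambda>j. cnj c * (2 * xs j + c * x j)) \<in> fvecs re d"
      using x xs imc by (auto simp: fvecs_def)
    have "bform d (A i) h h = Y i + bform d (A i) x (\<lambda>j. cnj c * (2 * xs j + c * x j))"
      if "i < n" for i
    proof -
      have "bform d (A i) h h = Y i + bform d (A i) xs (\<lambda>j. c * x j)
         + (bform d (A i) (\<lambda>j. c * x j) xs + bform d (A i) (\<lambda>j. c * x j) (\<lambda>j. c * x j))"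
        by (simp add: h_def bform_add_left bform_add_right Y_def)
      also have "bform d (A i) xs (\<lambda>j. c * x j) = bform d (A i) (\<lambda>j. c * x j) xs"
        by (rule bform_sym[OF A(1)[OF that]])
      also have "Y i + bform d (A i) (\<lambda>j. c * x j) xs
         + (bform d (A i) (\<lambda>j. c * x j) xs + bform d (A i) (\<lambda>j. c * x j) (\<lambda>j. c * x j))
         = Y i + bform d (A i) (\<lambda>j. c * x j) (\<lambda>j. (xs j + xs j) + c * x j)"
        by (simp only: bform_add_right)
      finally show ?thesis unfolding bform_move_scalar[of d "A i" c x] by (simp only: mult_2)
    qed
    then have "(\<Sum>i<n. r i * bform d (A i) h h) = (\<Sum>i<n. r i * Y i)
       + (\<Sum>i<n. r i * bform d (A i) x (\<lambda>j. cnj c * (2 * xs j + c * x j)))"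
      by (simp add: algebra_simps sum.distrib)
    with first[OF hx] sY show ?thesis by simp
  qed
  define S where "S = (\<Sum>i<n. Y i * bform d (A i) h h)"
  have "(\<Sum>i<n. (bform d (A i) x h)\<^sup>2) \<le> (\<Sum>i<n. X i * bform d (A i) h h)"
    unfolding X_def by (intro sum_mono bform_Cauchy_Schwarz[where re = re]) (use A x h in auto)
  \<comment> \<open>\<open>X i\<close> is replaced by \<open>Y i + r i\<close>. The
    \<open>r i\<close> part contributes another \<open>- R\<close> by \<open>s1\<close>; together
    with the one inside the Hessian this produces the factor 3 in \<open>R3\<close>.\<close>
  also have "\<dots> = S + (\<Sum>i<n. r i * bform d (A i) h h)"
    unfolding S_def sum.distrib[symmetric] by (intro sum.cong refl) (simp add: r_def algebra_simps)
  finally have "(\<Sum>i<n. (bform d (A i) x h)\<^sup>2) \<le> S - R" using s1 by simp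
  then have R3: "3 * R \<le> 2 * S"
    using second s1 by (simp add: sum.distrib sum_distrib_left[symmetric])
  have S_le: "S \<le> op_norm re d (adj d n A Y) * q"
    unfolding S_def q_def by (rule sum_bform_le_op_norm[OF h])
  define G where "G = m * (frob d (\<lambda>j k. outer x j k - outer xs j k))\<^sup>2 + (a - e)\<^sup>2"
  have lower: "(1 / real n) * R \<ge> (1 - dL) * G"
    using cond x unfolding part1_conditions_def
    by (simp add: G_def a_def e_def R_def r_def X_def Y_def hs_inner_diff_right hs_inner_outer)
  have M: "0 < m\<^sup>2 + 2 * m" "0 < 2 * (m + 1) * dU" using m by (auto intro: add_pos_pos)
  \<comment> \<open>Dropping \<open>- 2\<close> and the positive \<open>dU\<close> term from
    \<open>big\<close> already gives \<open>3 * dL < 1\<close>, so the isometry factor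
    \<open>1 - dL\<close> is positive.\<close>
  have "3 * (m\<^sup>2 + 2 * m) * dL < m\<^sup>2 + 2 * m"
    by (rule order.strict_trans1[OF _ order.strict_trans[OF big]]) (use M(2) in simp_all)
  then have "(m\<^sup>2 + 2 * m) * (3 * dL) < (m\<^sup>2 + 2 * m) * 1"
    by (simp add: algebra_simps)
  then have "3 * dL < 1" using M(1) by (simp only: mult_less_cancel_left_pos)
  then have dL: "dL < 1" by simp
  have e0: "0 \<le> e" and a0: "0 \<le> a" and q0: "0 \<le> q" by (simp_all add: e_def a_def q_def)
  \<comment> \<open>Pythagoras for the projection. It also covers \<open>a = 0\<close>, where
    \<open>c\<close> and the quotient are both 0 by division by zero.\<close>
  have qe: "q = e - (cmod p)\<^sup>2 / a"
  proof -
    have "q = e + 2 * Re (c * cnj p) + (cmod c)\<^sup>2 * a"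
      unfolding q_def h_def vnorm_add_sq cinner_scale_right vnorm_scale e_def a_def p_def
      by (simp add: cnj_cinner power_mult_distrib)
    also have "c * cnj p = complex_of_real (- (cmod p)\<^sup>2 / a)"
      using complex_norm_square[of p] by (simp add: c_def)
    also have "(cmod c)\<^sup>2 * a = (cmod p)\<^sup>2 / a"
      using a0 by (simp add: c_def norm_divide power_divide power2_eq_square)
    finally show ?thesis by (simp only: Re_complex_of_real)
  qed
  have b: "(cmod p)\<^sup>2 = a * (e - q)"
  proof (cases "a = 0")
    case True
    then have "p = 0" using cmod_cinner_le[of d x xs] by (simp add: p_def a_def)
    with True show ?thesis by simp
  qed (simp add: qe)
  have "q \<le> e" using qe a0 by simp
  have G_eq: "G = m * (a\<^sup>2 + e\<^sup>2 - 2 * (a * (e - q))) + (a - e)\<^sup>2"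
    unfolding G_def frob_diff_outer_sq p_def[symmetric] b by (simp add: a_def e_def)
  \<comment> \<open>Completion of the square in \<open>a\<close> for fixed \<open>e\<close> and
    \<open>q\<close>: the vertex is a = e - m q / (m+1). In the remainder, \<open>q \<le> e\<close>
    gives 2(m+1)e - mq >= (m+2)e.\<close>
  have "(m + 1) * G = ((m + 1) * a - ((m + 1) * e - m * q))\<^sup>2 + m * q * (2 * (m + 1) * e - m * q)"
    unfolding G_eq by (simp add: power2_eq_square algebra_simps)
  moreover have "m * q * ((m + 2) * e) \<le> m * q * (2 * (m + 1) * e - m * q)"
    using m q0 mult_left_mono[OF \<open>q \<le> e\<close>, of m] by (intro mult_left_mono) (auto simp: algebra_simps)
  moreover have "(m\<^sup>2 + 2 * m) * (q * e) = m * q * ((m + 2) * e)"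
    by (simp add: power2_eq_square algebra_simps)
  ultimately have Glow: "(m\<^sup>2 + 2 * m) * (q * e) \<le> (m + 1) * G"
    using zero_le_power2[of "(m + 1) * a - ((m + 1) * e - m * q)"] by linarith
  have "R \<le> 0"
  \<comment> \<open>For \<open>n = 0\<close> the factor \<open>1 / real n\<close> is 0 and the
    operator-norm condition carries no information, but then \<open>R\<close> is an empty
    sum.\<close>
  proof (cases "n = 0")
    case True then show ?thesis by (simp add: R_def)
  next
    case n: False
    have "op_norm re d (adj d n A Y) \<le> real n * ((1 + m + dU) * e)"
      using op n by (simp add: field_simps)
    then have "S \<le> real n * ((1 + m + dU) * e) * q"
      using S_le q0 by (meson mult_right_mono order_trans)
    then have R3': "3 * R \<le> real n * (2 * (1 + m + dU) * (q * e))"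
      using R3 by (simp add: algebra_simps)
    have "q * e = 0"
    proof (rule ccontr)
      assume "q * e \<noteq> 0"
      then have pos: "q * e > 0" using q0 e0 by (simp add: order_less_le)
      have "real n * ((1 - dL) * G) \<le> R" using lower n by (simp add: field_simps)
      with R3' have "real n * (3 * ((1 - dL) * G)) \<le> real n * (2 * (1 + m + dU) * (q * e))"
        by (simp add: algebra_simps)
      then have "3 * ((1 - dL) * G) \<le> 2 * (1 + m + dU) * (q * e)"
        using n by (simp only: mult_le_cancel_left_pos of_nat_0_less_iff)
      then have "(m + 1) * (3 * ((1 - dL) * G)) \<le> (m + 1) * (2 * (1 + m + dU) * (q * e))"
        using m by (intro mult_left_mono) auto
      moreover have "3 * (1 - dL) * ((m\<^sup>2 + 2 * m) * (q * e)) \<le> 3 * (1 - dL) * ((m + 1) * G)"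
        using Glow dL by (intro mult_left_mono) auto
      ultimately have "(3 * (1 - dL) * (m\<^sup>2 + 2 * m)) * (q * e) \<le> ((m + 1) * (2 * (1 + m + dU))) * (q * e)"
        by (simp add: algebra_simps)
      then have "3 * (1 - dL) * (m\<^sup>2 + 2 * m) \<le> (m + 1) * (2 * (1 + m + dU))"
        using pos by (simp only: mult_le_cancel_right_pos)
      \<comment> \<open>By 3 (m^2 + 2m) - 2 (m+1)^2 = m^2 + 2m - 2, the inequality just derived is
        the negation of \<open>big\<close>.\<close>
      with big show False by (simp add: power2_eq_square algebra_simps)
    qed
    with R3' show ?thesis by simp
  qed
  \<comment> \<open>With no residual left, the lower isometry forces \<open>G\<close>, and hence the
    Frobenius distance of the two matrices, to vanish.\<close>
  then have "(1 - dL) * G \<le> 0"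
    using lower by (meson divide_nonneg_nonneg mult_nonneg_nonpos of_nat_0_le_iff order_trans zero_le_one)
  then have "G \<le> 0" using dL by (simp add: mult_le_0_iff)
  then have "m * (frob d (\<lambda>j k. outer x j k - outer xs j k))\<^sup>2 \<le> 0"
    unfolding G_def using zero_le_power2[of "a - e"] by linarith
  then have "hs_inner d (\<lambda>j k. outer x j k - outer xs j k) (\<lambda>j k. outer x j k - outer xs j k) \<le> 0"
    using m by (simp add: frob_sq mult_le_0_iff)
  then have z: "(\<Sum>j<d. \<Sum>k<d. (cmod (outer x j k - outer xs j k))\<^sup>2) = 0"
    unfolding hs_inner_self by (intro antisym sum_nonneg) auto
  then have "(\<Sum>k<d. (cmod (outer x j k - outer xs j k))\<^sup>2) = 0"
    using j by (subst (asm) sum_nonneg_eq_0_iff) (auto intro: sum_nonneg)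
  then show ?thesis
    using k by (subst (asm) sum_nonneg_eq_0_iff) auto
qed

section \<open>Gaussian linear forms\<close>

abbreviation normal_measure :: "real \<Rightarrow> real measure" where
  "normal_measure \<sigma> \<equiv> density lborel (\<lambda>x. ennreal (normal_density 0 \<sigma> x))"

lemma prob_space_PiM_normal: "0 < \<sigma> \<Longrightarrow> prob_space (PiM I (\<lambda>_. normal_measure \<sigma>))"
  by (intro prob_space_PiM prob_space_normal_density)

lemma measurable_PiM_normal_component:
  "k \<in> I \<Longrightarrow> (\<lambda>w. w k) \<in> borel_measurable (PiM I (\<lambda>_. normal_measure \<sigma>))"
  using measurable_component_singleton[of k I "\<lambda>_. normal_measure \<sigma>"]
  by (simp add: measurable_cong_sets[OF refl, of "normal_measure \<sigma>" borel])

lemma distributed_PiM_normal_component: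
  assumes "0 < \<sigma>" "k \<in> I"
  shows "distributed (PiM I (\<lambda>_. normal_measure \<sigma>)) lborel (\<lambda>w. w k) (normal_density 0 \<sigma>)"
proof -
  interpret product_prob_space "\<lambda>_. normal_measure \<sigma>" I
    using assms by (intro product_prob_spaceI prob_space_normal_density)
  have "distr (PiM I (\<lambda>_. normal_measure \<sigma>)) lborel (\<lambda>w. w k)
      = distr (PiM I (\<lambda>_. normal_measure \<sigma>)) (normal_measure \<sigma>) (\<lambda>w. w k)"
    by (rule distr_cong) auto
  also have "\<dots> = normal_measure \<sigma>" by (rule PiM_component[OF assms(2)])
  finally show ?thesis
    using measurable_PiM_normal_component[OF assms(2), of \<sigma>] by (auto simp: distributed_def)
qed

text \<open>Independence means that the joint law is the product of the marginals. Here the joint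
  map is the identity on the product space, and \<open>normal_measure \<sigma>\<close> has the same
  measurable sets as \<open>borel\<close>.\<close>

lemma indep_vars_PiM_normal:
  assumes "0 < \<sigma>" "I \<noteq> {}"
  shows "prob_space.indep_vars (PiM I (\<lambda>_. normal_measure \<sigma>)) (\<lambda>_. borel) (\<lambda>k w. w k) I"
proof -
  interpret product_prob_space "\<lambda>_. normal_measure \<sigma>" I
    using assms by (intro product_prob_spaceI prob_space_normal_density)
  let ?P = "PiM I (\<lambda>_. normal_measure \<sigma>)"
  have sets: "sets (PiM I (\<lambda>_. borel)) = sets ?P"
    by (intro sets_PiM_cong) auto
  have "distr ?P (PiM I (\<lambda>_. borel)) (\<lambda>w. \<lambda>k\<in>I. w k) = distr ?P ?P (\<lambda>w. w)"
    by (rule distr_cong[OF refl sets]) (auto simp: space_PiM PiE_def extensional_restrict)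
  also have "\<dots> = PiM I (\<lambda>k. distr ?P borel (\<lambda>w. w k))"
  proof (subst distr_id, rule PiM_cong[OF refl])
    fix k assume "k \<in> I"
    have "distr ?P borel (\<lambda>w. w k) = distr ?P (normal_measure \<sigma>) (\<lambda>w. w k)"
      by (rule distr_cong) auto
    also have "\<dots> = normal_measure \<sigma>" by (rule PiM_component[OF \<open>k \<in> I\<close>])
    finally show "normal_measure \<sigma> = distr ?P borel (\<lambda>w. w k)" by simp
  qed
  finally show ?thesis
    by (subst P.indep_vars_iff_distr_eq_PiM') (auto simp: assms measurable_PiM_normal_component)
qed

lemma distributed_normal_linear_form:
  fixes \<alpha> :: "'i \<Rightarrow> real"
  assumes \<sigma>: "0 < \<sigma>" and J: "finite J" "J \<subseteq> I" and nz: "(\<Sum>k\<in>J. (\<alpha> k)\<^sup>2) \<noteq> 0"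
  shows "distributed (PiM I (\<lambda>_. normal_measure \<sigma>)) lborel (\<lambda>w. \<Sum>k\<in>J. \<alpha> k * w k)
           (normal_density 0 (\<sigma> * sqrt (\<Sum>k\<in>J. (\<alpha> k)\<^sup>2)))"
proof -
  let ?P = "PiM I (\<lambda>_. normal_measure \<sigma>)"
  interpret prob_space ?P by (rule prob_space_PiM_normal[OF \<sigma>])
  \<comment> \<open>\<open>sum_indep_normal\<close> needs positive standard deviations and a
    nonempty index set, so zero coefficients are removed first and restored at the end.\<close>
  define J' where "J' = {k\<in>J. \<alpha> k \<noteq> 0}"
  have J': "finite J'" "J' \<subseteq> I" using J by (auto simp: J'_def)
  have ne: "J' \<noteq> {}"
  proof
    assume "J' = {}"
    then have "(\<Sum>k\<in>J. (\<alpha> k)\<^sup>2) = 0" by (intro sum.neutral) (auto simp: J'_def)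
    with nz show False by simp
  qed
  have "indep_vars (\<lambda>_. borel) (\<lambda>k w. w k) J'"
    using indep_vars_PiM_normal[OF \<sigma>, of I] ne J'(2) by (auto intro: indep_vars_subset)
  then have ind: "indep_vars (\<lambda>_. borel) (\<lambda>k w. \<alpha> k * w k) J'"
    by (rule indep_vars_compose2) auto
  have "distributed ?P lborel (\<lambda>w. \<Sum>k\<in>J'. \<alpha> k * w k)
     (normal_density (\<Sum>k\<in>J'. 0) (sqrt (\<Sum>k\<in>J'. (\<bar>\<alpha> k\<bar> * \<sigma>)\<^sup>2)))"
  proof (rule sum_indep_normal[OF J'(1) ne ind])
    fix k assume k: "k \<in> J'"
    then show "0 < \<bar>\<alpha> k\<bar> * \<sigma>" using \<sigma> by (simp add: J'_def)
    have "distributed ?P lborel (\<lambda>w. w k) (normal_density 0 \<sigma>)"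
      using k J' by (intro distributed_PiM_normal_component \<sigma>) auto
    from normal_density_affine[OF this \<sigma>, of "\<alpha> k" 0] k
    show "distributed ?P lborel (\<lambda>w. \<alpha> k * w k) (normal_density 0 (\<bar>\<alpha> k\<bar> * \<sigma>))"
      by (simp add: J'_def)
  qed
  also have "(\<lambda>w. \<Sum>k\<in>J'. \<alpha> k * w k) = (\<lambda>w. \<Sum>k\<in>J. \<alpha> k * w k)"
    by (intro ext sum.mono_neutral_left) (use J in \<open>auto simp: J'_def\<close>)
  also have "(\<Sum>k\<in>J'. (\<bar>\<alpha> k\<bar> * \<sigma>)\<^sup>2) = \<sigma>\<^sup>2 * (\<Sum>k\<in>J'. (\<alpha> k)\<^sup>2)"
    by (simp add: power_mult_distrib sum_distrib_left mult.commute)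
  also have "(\<Sum>k\<in>J'. (\<alpha> k)\<^sup>2) = (\<Sum>k\<in>J. (\<alpha> k)\<^sup>2)"
    by (intro sum.mono_neutral_left) (use J in \<open>auto simp: J'_def\<close>)
  finally show ?thesis using \<sigma> by (simp add: real_sqrt_mult)
qed

text \<open>The integrand is t/s times another centred normal density, with 1/(2t^2) = 1/(2s^2) -
  1/4. So the integral equals t/s, and s <= 1 bounds (t/s)^2 by 2.\<close>

lemma nn_integral_normal_exp_square:
  assumes s: "0 < s" "s \<le> 1"
  shows "(\<integral>\<^sup>+x. ennreal (normal_density 0 s x) * ennreal (exp (x\<^sup>2 / 4)) \<partial>lborel) \<le> 2"
proof -
  define t where "t = s / sqrt (1 - s\<^sup>2 / 2)"
  have s2: "s\<^sup>2 \<le> 1" using s by (simp add: power_le_one)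
  then have pos: "0 < 1 - s\<^sup>2 / 2" by simp
  then have t: "0 < t" using s by (simp add: t_def)
  have t2: "t\<^sup>2 = s\<^sup>2 / (1 - s\<^sup>2 / 2)" using pos by (simp add: t_def power_divide)
  have ts: "t / s \<le> 2"
  proof -
    have "(t / s)\<^sup>2 = 1 / (1 - s\<^sup>2 / 2)" using s by (simp add: power_divide t2)
    also have "\<dots> \<le> 2\<^sup>2" using s2 by (simp add: field_simps)
    finally show ?thesis by (rule power2_le_imp_le) simp
  qed
  have eq: "normal_density 0 s x * exp (x\<^sup>2 / 4) = (t / s) * normal_density 0 t x" for x
  proof -
    have e: "- x\<^sup>2 / (2 * s\<^sup>2) + x\<^sup>2 / 4 = - x\<^sup>2 / (2 * t\<^sup>2)"
      unfolding t2 using s by (simp add: field_simps)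
    have "normal_density 0 s x * exp (x\<^sup>2 / 4) = 1 / sqrt (2 * pi * s\<^sup>2) * exp (- x\<^sup>2 / (2 * t\<^sup>2))"
      unfolding normal_density_def e[symmetric] exp_add by simp
    also have "\<dots> = (t / s) * normal_density 0 t x"
      using s t by (simp add: normal_density_def real_sqrt_mult)
    finally show ?thesis .
  qed
  have "(\<integral>\<^sup>+x. ennreal (normal_density 0 s x) * ennreal (exp (x\<^sup>2 / 4)) \<partial>lborel)
      = (\<integral>\<^sup>+x. ennreal (t / s) * ennreal (normal_density 0 t x) \<partial>lborel)"
    using s t by (intro nn_integral_cong) (simp add: ennreal_mult'[symmetric] eq)
  also have "\<dots> = ennreal (t / s) * (\<integral>\<^sup>+x. ennreal (normal_density 0 t x) \<partial>lborel)"
    by (rule nn_integral_cmult) simp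
  also have "(\<integral>\<^sup>+x. ennreal (normal_density 0 t x) \<partial>lborel) = 1"
    using prob_space.emeasure_space_1[OF prob_space_normal_density[OF t, of 0]]
    by (simp add: emeasure_density)
  also have "ennreal (t / s) * 1 \<le> 2"
    using ts by (metis ennreal_leI ennreal_numeral mult.right_neutral zero_le_numeral)
  finally show ?thesis .
qed

text \<open>The vanishing form has no density and is treated apart, here and in the fourth moment;
  otherwise the claim is a one-dimensional integral.\<close>

lemma nn_integral_exp_normal_linear_form:
  fixes \<alpha> :: "'i \<Rightarrow> real"
  assumes \<sigma>: "0 < \<sigma>" and J: "finite J" "J \<subseteq> I" and le: "\<sigma>\<^sup>2 * (\<Sum>k\<in>J. (\<alpha> k)\<^sup>2) \<le> 1"
  shows "(\<integral>\<^sup>+w. ennreal (exp ((\<Sum>k\<in>J. \<alpha> k * w k)\<^sup>2 / 4)) \<partial>PiM I (\<lambda>_. normal_measure \<sigma>)) \<le> 2"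
proof (cases "(\<Sum>k\<in>J. (\<alpha> k)\<^sup>2) = 0")
  case True
  then have "\<forall>k\<in>J. \<alpha> k = 0" using J by (simp add: sum_nonneg_eq_0_iff)
  then have "(\<Sum>k\<in>J. \<alpha> k * w k) = 0" for w by (intro sum.neutral) auto
  moreover have "emeasure (PiM I (\<lambda>_. normal_measure \<sigma>)) (space (PiM I (\<lambda>_. normal_measure \<sigma>))) = 1"
    by (rule prob_space.emeasure_space_1[OF prob_space_PiM_normal[OF \<sigma>]])
  ultimately show ?thesis by (simp del: sum_eq_0_iff)
next
  case False
  define s where "s = \<sigma> * sqrt (\<Sum>k\<in>J. (\<alpha> k)\<^sup>2)"
  have nn: "0 \<le> (\<Sum>k\<in>J. (\<alpha> k)\<^sup>2)" by (simp add: sum_nonneg)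
  with False have s: "0 < s" using \<sigma> by (simp add: s_def)
  have "s\<^sup>2 \<le> 1" using le nn by (simp add: s_def power_mult_distrib)
  then have s1: "s \<le> 1" using s by (simp add: power2_le_imp_le[of s 1])
  have D: "distributed (PiM I (\<lambda>_. normal_measure \<sigma>)) lborel (\<lambda>w. \<Sum>k\<in>J. \<alpha> k * w k) (normal_density 0 s)"
    unfolding s_def by (rule distributed_normal_linear_form[OF \<sigma> J False])
  have "(\<integral>\<^sup>+w. ennreal (exp ((\<Sum>k\<in>J. \<alpha> k * w k)\<^sup>2 / 4)) \<partial>PiM I (\<lambda>_. normal_measure \<sigma>))
     = (\<integral>\<^sup>+x. ennreal (normal_density 0 s x) * ennreal (exp (x\<^sup>2 / 4)) \<partial>lborel)"
    by (rule distributed_nn_integral[OF D, symmetric]) auto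
  also have "\<dots> \<le> 2" by (rule nn_integral_normal_exp_square[OF s s1])
  finally show ?thesis .
qed

lemma fourth_moment_normal_linear_form:
  fixes \<alpha> :: "'i \<Rightarrow> real"
  assumes \<sigma>: "0 < \<sigma>" and J: "finite J" "J \<subseteq> I"
  shows "has_bochner_integral (PiM I (\<lambda>_. normal_measure \<sigma>)) (\<lambda>w. (\<Sum>k\<in>J. \<alpha> k * w k) ^ 4)
           (3 * \<sigma>^4 * (\<Sum>k\<in>J. (\<alpha> k)\<^sup>2)\<^sup>2)"
proof (cases "(\<Sum>k\<in>J. (\<alpha> k)\<^sup>2) = 0")
  case True
  then have "\<forall>k\<in>J. \<alpha> k = 0" using J by (simp add: sum_nonneg_eq_0_iff)
  then have "(\<Sum>k\<in>J. \<alpha> k * w k) = 0" for w by (intro sum.neutral) auto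
  with True show ?thesis by (simp add: has_bochner_integral_zero del: sum_eq_0_iff)
next
  case False
  define s where "s = \<sigma> * sqrt (\<Sum>k\<in>J. (\<alpha> k)\<^sup>2)"
  have nn: "0 \<le> (\<Sum>k\<in>J. (\<alpha> k)\<^sup>2)" by (simp add: sum_nonneg)
  with False have s: "0 < s" using \<sigma> by (simp add: s_def)
  have D: "distributed (PiM I (\<lambda>_. normal_measure \<sigma>)) lborel (\<lambda>w. \<Sum>k\<in>J. \<alpha> k * w k) (normal_density 0 s)"
    unfolding s_def by (rule distributed_normal_linear_form[OF \<sigma> J False])
  have B: "has_bochner_integral lborel (\<lambda>x. normal_density 0 s x * x ^ 4) (3 * s ^ 4)"
    using normal_moment_even[OF s, of 0 2]
    by (simp add: fact_numeral power_divide power2_eq_square power4_eq_xxxx mult.assoc)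
  have "integrable (PiM I (\<lambda>_. normal_measure \<sigma>)) (\<lambda>w. (\<Sum>k\<in>J. \<alpha> k * w k) ^ 4)"
    by (subst distributed_integrable[OF D, symmetric]) (use B in \<open>auto intro: integrable.intros\<close>)
  moreover have "(\<integral>w. (\<Sum>k\<in>J. \<alpha> k * w k) ^ 4 \<partial>PiM I (\<lambda>_. normal_measure \<sigma>)) = 3 * s ^ 4"
    by (subst distributed_integral[OF D, symmetric]) (use B in \<open>auto intro: has_bochner_integral_integral_eq\<close>)
  moreover have "s ^ 4 = \<sigma>^4 * (\<Sum>k\<in>J. (\<alpha> k)\<^sup>2)\<^sup>2"
  proof -
    have "s ^ 4 = (s\<^sup>2)\<^sup>2" by simp
    also have "s\<^sup>2 = \<sigma>\<^sup>2 * (\<Sum>k\<in>J. (\<alpha> k)\<^sup>2)" using nn by (simp add: s_def power_mult_distrib)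
    finally show ?thesis by (simp add: power_mult_distrib)
  qed
  ultimately show ?thesis by (simp add: has_bochner_integral_iff mult.assoc)
qed

text \<open>Each of the eight sign choices for b, c, e is weighted by the product of its signs. Only
  monomials odd in all three survive, that is abce, with coefficient 8 * 24 = 192.\<close>

lemma polarization_4:
  fixes a b c e :: real
  shows "a * b * c * e = 1 / 192 *
    ((a + b + c + e)^4 - (a + b + c - e)^4 - (a + b - c + e)^4 + (a + b - c - e)^4
     - (a - b + c + e)^4 + (a - b + c - e)^4 + (a - b - c + e)^4 - (a - b - c - e)^4)"
  by (simp add: power4_eq_xxxx algebra_simps)

text \<open>Wick's formula by polarization: every sum or difference of the four forms is again a
  linear form, so the fourth moment of a single form suffices and no joint density is
  needed.\<close>

lemma isserlis_normal_linear_forms: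
  fixes \<alpha> \<beta> \<gamma> \<delta> :: "'i \<Rightarrow> real"
  assumes \<sigma>: "0 < \<sigma>" and J: "finite J" "J \<subseteq> I"
  defines "L \<equiv> \<lambda>\<alpha> w. \<Sum>k\<in>J. \<alpha> k * w k" and "ip \<equiv> \<lambda>\<alpha> \<beta>. \<Sum>k\<in>J. \<alpha> k * \<beta> k"
  shows "has_bochner_integral (PiM I (\<lambda>_. normal_measure \<sigma>)) (\<lambda>w. L \<alpha> w * L \<beta> w * L \<gamma> w * L \<delta> w)
    (\<sigma>^4 * (ip \<alpha> \<beta> * ip \<gamma> \<delta> + ip \<alpha> \<gamma> * ip \<beta> \<delta> + ip \<alpha> \<delta> * ip \<beta> \<gamma>))"
proof -
  let ?P = "PiM I (\<lambda>_. normal_measure \<sigma>)"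
  have Ladd: "L (\<lambda>k. f k + g k) w = L f w + L g w" and Ldiff: "L (\<lambda>k. f k - g k) w = L f w - L g w" for f g w
    by (simp_all add: L_def algebra_simps sum.distrib sum_subtractf)
  have ipadd: "ip (\<lambda>k. f k + g k) h = ip f h + ip g h" "ip (\<lambda>k. f k - g k) h = ip f h - ip g h"
    "ip h (\<lambda>k. f k + g k) = ip h f + ip h g" "ip h (\<lambda>k. f k - g k) = ip h f - ip h g" for f g h
    by (simp_all add: ip_def algebra_simps sum.distrib sum_subtractf)
  have ipsym: "ip f g = ip g f" for f g by (simp add: ip_def mult.commute)
  have H: "has_bochner_integral ?P (\<lambda>w. (L f w)^4) (3 * \<sigma>^4 * (ip f f)\<^sup>2)" for f
    using fourth_moment_normal_linear_form[OF \<sigma> J, of f] by (simp add: L_def ip_def power2_eq_square)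
  note H8 = has_bochner_integral_diff[OF has_bochner_integral_add[OF has_bochner_integral_add[OF
      has_bochner_integral_diff[OF has_bochner_integral_add[OF has_bochner_integral_diff[OF
      has_bochner_integral_diff[OF H H] H] H] H] H] H] H]
  have "has_bochner_integral ?P (\<lambda>w. L \<alpha> w * L \<beta> w * L \<gamma> w * L \<delta> w) (1 / 192 * 
    (3 * \<sigma>^4 * (ip (\<lambda>k. \<alpha> k + \<beta> k + \<gamma> k + \<delta> k) (\<lambda>k. \<alpha> k + \<beta> k + \<gamma> k + \<delta> k))\<^sup>2
   - 3 * \<sigma>^4 * (ip (\<lambda>k. \<alpha> k + \<beta> k + \<gamma> k - \<delta> k) (\<lambda>k. \<alpha> k + \<beta> k + \<gamma> k - \<delta> k))\<^sup>2
   - 3 * \<sigma>^4 * (ip (\<lambda>k. \<alpha> k + \<beta> k - \<gamma> k + \<delta> k) (\<lambda>k. \<alpha> k + \<beta> k - \<gamma> k + \<delta> k))\<^sup>2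
   + 3 * \<sigma>^4 * (ip (\<lambda>k. \<alpha> k + \<beta> k - \<gamma> k - \<delta> k) (\<lambda>k. \<alpha> k + \<beta> k - \<gamma> k - \<delta> k))\<^sup>2
   - 3 * \<sigma>^4 * (ip (\<lambda>k. \<alpha> k - \<beta> k + \<gamma> k + \<delta> k) (\<lambda>k. \<alpha> k - \<beta> k + \<gamma> k + \<delta> k))\<^sup>2
   + 3 * \<sigma>^4 * (ip (\<lambda>k. \<alpha> k - \<beta> k + \<gamma> k - \<delta> k) (\<lambda>k. \<alpha> k - \<beta> k + \<gamma> k - \<delta> k))\<^sup>2
   + 3 * \<sigma>^4 * (ip (\<lambda>k. \<alpha> k - \<beta> k - \<gamma> k + \<delta> k) (\<lambda>k. \<alpha> k - \<beta> k - \<gamma> k + \<delta> k))\<^sup>2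
   - 3 * \<sigma>^4 * (ip (\<lambda>k. \<alpha> k - \<beta> k - \<gamma> k - \<delta> k) (\<lambda>k. \<alpha> k - \<beta> k - \<gamma> k - \<delta> k))\<^sup>2))"
    unfolding polarization_4 Ladd[symmetric] Ldiff[symmetric]
    by (intro has_bochner_integral_mult_right H8)
  also have "(1 / 192 * 
    (3 * \<sigma>^4 * (ip (\<lambda>k. \<alpha> k + \<beta> k + \<gamma> k + \<delta> k) (\<lambda>k. \<alpha> k + \<beta> k + \<gamma> k + \<delta> k))\<^sup>2
   - 3 * \<sigma>^4 * (ip (\<lambda>k. \<alpha> k + \<beta> k + \<gamma> k - \<delta> k) (\<lambda>k. \<alpha> k + \<beta> k + \<gamma> k - \<delta> k))\<^sup>2
   - 3 * \<sigma>^4 * (ip (\<lambda>k. \<alpha> k + \<beta> k - \<gamma> k + \<delta> k) (\<lambda>k. \<alpha> k + \<beta> k - \<gamma> k + \<delta> k))\<^sup>2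
   + 3 * \<sigma>^4 * (ip (\<lambda>k. \<alpha> k + \<beta> k - \<gamma> k - \<delta> k) (\<lambda>k. \<alpha> k + \<beta> k - \<gamma> k - \<delta> k))\<^sup>2
   - 3 * \<sigma>^4 * (ip (\<lambda>k. \<alpha> k - \<beta> k + \<gamma> k + \<delta> k) (\<lambda>k. \<alpha> k - \<beta> k + \<gamma> k + \<delta> k))\<^sup>2
   + 3 * \<sigma>^4 * (ip (\<lambda>k. \<alpha> k - \<beta> k + \<gamma> k - \<delta> k) (\<lambda>k. \<alpha> k - \<beta> k + \<gamma> k - \<delta> k))\<^sup>2
   + 3 * \<sigma>^4 * (ip (\<lambda>k. \<alpha> k - \<beta> k - \<gamma> k + \<delta> k) (\<lambda>k. \<alpha> k - \<beta> k - \<gamma> k + \<delta> k))\<^sup>2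
   - 3 * \<sigma>^4 * (ip (\<lambda>k. \<alpha> k - \<beta> k - \<gamma> k - \<delta> k) (\<lambda>k. \<alpha> k - \<beta> k - \<gamma> k - \<delta> k))\<^sup>2))
   = \<sigma>^4 * (ip \<alpha> \<beta> * ip \<gamma> \<delta> + ip \<alpha> \<gamma> * ip \<beta> \<delta> + ip \<alpha> \<delta> * ip \<beta> \<gamma>)"
    \<comment> \<open>Orienting the inner products leaves a polynomial identity in the ten
      independent values of \<open>ip\<close> and in \<open>\<sigma>\<close>.\<close>
    unfolding ipadd ipsym[of \<beta> \<alpha>] ipsym[of \<gamma> \<alpha>] ipsym[of \<delta> \<alpha>] ipsym[of \<gamma> \<beta>] ipsym[of \<delta> \<beta>] ipsym[of \<delta> \<gamma>]
    by algebra
  finally show ?thesis .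
qed

section \<open>Moments of the Gaussian measurements\<close>

definition row :: "nat \<Rightarrow> nat \<Rightarrow> (nat \<times> nat \<times> bool) set" where
  "row d i = {i} \<times> {..<d} \<times> UNIV"

abbreviation gdot :: "bool \<Rightarrow> nat \<Rightarrow> (nat \<times> nat \<times> bool \<Rightarrow> real) \<Rightarrow> nat \<Rightarrow> (nat \<Rightarrow> complex) \<Rightarrow> complex" where
  "gdot gre d w i u \<equiv> cinner d (gvec gre w i) u"

text \<open>\<open>coef_re\<close> and \<open>coef_im\<close> are the coefficients of Re and Im of
  a_i^* u as real linear forms in the sample. In the real model the coordinates flagged
  \<open>True\<close> get coefficient 0, so both models share one sample space.\<close>

definition coef_re :: "bool \<Rightarrow> (nat \<Rightarrow> complex) \<Rightarrow> nat \<times> nat \<times> bool \<Rightarrow> real" where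
  "coef_re gre u = (\<lambda>(i, j, b). if b then (if gre then 0 else Im (u j)) else Re (u j))"

definition coef_im :: "bool \<Rightarrow> (nat \<Rightarrow> complex) \<Rightarrow> nat \<times> nat \<times> bool \<Rightarrow> real" where
  "coef_im gre u = (\<lambda>(i, j, b). if b then (if gre then 0 else - Re (u j)) else Im (u j))"

lemma finite_row [simp]: "finite (row d i)"
  by (simp add: row_def)

lemma row_subset: "i < n \<Longrightarrow> row d i \<subseteq> {..<n} \<times> {..<d} \<times> UNIV"
  by (auto simp: row_def)

lemma sum_row:
  fixes f :: "nat \<times> nat \<times> bool \<Rightarrow> real"
  shows "(\<Sum>k\<in>row d i. f k) = (\<Sum>j<d. f (i, j, False) + f (i, j, True))"
proof -
  have "(\<Sum>k\<in>row d i. f k) = (\<Sum>p\<in>{..<d} \<times> UNIV. f (i, p))"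
    by (rule sum.reindex_bij_witness[of _ "\<lambda>p. (i, p)" snd]) (auto simp: row_def)
  also have "\<dots> = (\<Sum>j<d. \<Sum>b\<in>UNIV. f (i, j, b))"
    by (simp add: sum.cartesian_product)
  finally have "(\<Sum>k\<in>row d i. f k) = (\<Sum>j<d. \<Sum>b\<in>UNIV. f (i, j, b))" .
  then show ?thesis by (simp add: UNIV_bool add.commute)
qed

lemma Re_gdot: "Re (gdot gre d w i u) = (\<Sum>k\<in>row d i. coef_re gre u k * w k)"
  unfolding sum_row cinner_def Re_sum
  by (intro sum.cong refl) (simp add: gvec_def coef_re_def algebra_simps)

lemma Im_gdot: "Im (gdot gre d w i u) = (\<Sum>k\<in>row d i. coef_im gre u k * w k)"
  unfolding sum_row cinner_def Im_sum
  by (intro sum.cong refl) (simp add: gvec_def coef_im_def algebra_simps)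

context
  fixes gre :: bool and u v :: "nat \<Rightarrow> complex" and d i :: nat
  assumes uv: "gre \<Longrightarrow> u \<in> fvecs True d" "gre \<Longrightarrow> v \<in> fvecs True d"
begin

lemma sum_coef_re_re: "(\<Sum>k\<in>row d i. coef_re gre u k * coef_re gre v k) = Re (cinner d u v)"
  unfolding sum_row cinner_def Re_sum
  by (intro sum.cong refl) (use uv in \<open>auto simp: coef_re_def fvecs_def\<close>)

lemma sum_coef_im_im:
  "(\<Sum>k\<in>row d i. coef_im gre u k * coef_im gre v k) = (if gre then 0 else Re (cinner d u v))"
  unfolding sum_row cinner_def Re_sum
  by (cases gre) (use uv in \<open>auto simp: coef_im_def fvecs_def intro!: sum.neutral sum.cong\<close>)

lemma sum_coef_re_im:
  "(\<Sum>k\<in>row d i. coef_re gre u k * coef_im gre v k) = (if gre then 0 else Im (cinner d u v))"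
  unfolding sum_row cinner_def Im_sum
  by (cases gre) (use uv in \<open>auto simp: coef_im_def coef_re_def fvecs_def intro!: sum.neutral sum.cong\<close>)

lemma sum_coef_im_re:
  "(\<Sum>k\<in>row d i. coef_im gre u k * coef_re gre v k) = (if gre then 0 else - Im (cinner d u v))"
  unfolding sum_row cinner_def Im_sum
  by (cases gre) (use uv in \<open>auto simp: coef_im_def coef_re_def fvecs_def sum_negf[symmetric] intro!: sum.neutral sum.cong\<close>)

end

text \<open>The second moment of Re (a^* u cnj (a^* v)) for a standard Gaussian a, by
  \<open>gdot_second_moment\<close>. On the diagonal it is (1 + m4) |u|^4, and for aligned x - y and
  x + y it is the bracket in the lower isometry condition.\<close>

definition qform :: "bool \<Rightarrow> nat \<Rightarrow> (nat \<Rightarrow> complex) \<Rightarrow> (nat \<Rightarrow> complex) \<Rightarrow> real" where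
  "qform gre d u v = m4 gre / 2 * ((vnorm d u)\<^sup>2 * (vnorm d v)\<^sup>2 + Re ((cinner d u v)\<^sup>2)) + (Re (cinner d u v))\<^sup>2"

lemma gsigma_pos: "0 < gsigma gre"
  by (simp add: gsigma_def)

lemma gauss_space_eq: "gauss_space gre d n = PiM ({..<n} \<times> {..<d} \<times> UNIV) (\<lambda>_. normal_measure (gsigma gre))"
  by (simp add: gauss_space_def)

lemma prob_space_gauss: "prob_space (gauss_space gre d n)"
  unfolding gauss_space_eq by (rule prob_space_PiM_normal[OF gsigma_pos])

lemma gdot_second_moment:
  assumes uv: "gre \<Longrightarrow> u \<in> fvecs True d" "gre \<Longrightarrow> v \<in> fvecs True d" and i: "i < n"
  shows "has_bochner_integral (gauss_space gre d n)
     (\<lambda>w. (Re (gdot gre d w i u * cnj (gdot gre d w i v)))\<^sup>2) (qform gre d u v)"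
proof -
  define L where "L \<alpha> w = (\<Sum>k\<in>row d i. \<alpha> k * w k)" for \<alpha> w :: "nat \<times> nat \<times> bool \<Rightarrow> real"
  define ip where "ip \<alpha> \<beta> = (\<Sum>k\<in>row d i. \<alpha> k * \<beta> k)" for \<alpha> \<beta> :: "nat \<times> nat \<times> bool \<Rightarrow> real"
  let ?a = "coef_re gre u" and ?b = "coef_im gre u" and ?c = "coef_re gre v" and ?e = "coef_im gre v"
  have I: "has_bochner_integral (gauss_space gre d n) (\<lambda>w. L \<alpha> w * L \<beta> w * L \<gamma> w * L \<delta> w)
    (gsigma gre^4 * (ip \<alpha> \<beta> * ip \<gamma> \<delta> + ip \<alpha> \<gamma> * ip \<beta> \<delta> + ip \<alpha> \<delta> * ip \<beta> \<gamma>))" for \<alpha> \<beta> \<gamma> \<delta>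
    unfolding L_def ip_def gauss_space_eq
    by (rule isserlis_normal_linear_forms[OF gsigma_pos finite_row row_subset[OF i]])
  \<comment> \<open>The real part is Re Re + Im Im, so its square consists of three fourfold
    products of linear forms, each evaluated by the Wick formula.\<close>
  have eq: "(Re (gdot gre d w i u * cnj (gdot gre d w i v)))\<^sup>2
     = L ?a w * L ?a w * L ?c w * L ?c w + L ?b w * L ?b w * L ?e w * L ?e w + 2 * (L ?a w * L ?b w * L ?c w * L ?e w)" for w
    by (simp add: Re_gdot Im_gdot L_def power2_eq_square algebra_simps)
  have "has_bochner_integral (gauss_space gre d n)
     (\<lambda>w. (Re (gdot gre d w i u * cnj (gdot gre d w i v)))\<^sup>2)
     (gsigma gre^4 * (ip ?a ?a * ip ?c ?c + ip ?a ?c * ip ?a ?c + ip ?a ?c * ip ?a ?c)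
      + gsigma gre^4 * (ip ?b ?b * ip ?e ?e + ip ?b ?e * ip ?b ?e + ip ?b ?e * ip ?b ?e)
      + 2 * (gsigma gre^4 * (ip ?a ?b * ip ?c ?e + ip ?a ?c * ip ?b ?e + ip ?a ?e * ip ?b ?c)))"
    unfolding eq by (intro has_bochner_integral_add has_bochner_integral_mult_right I)
  also have "(gsigma gre^4 * (ip ?a ?a * ip ?c ?c + ip ?a ?c * ip ?a ?c + ip ?a ?c * ip ?a ?c)
      + gsigma gre^4 * (ip ?b ?b * ip ?e ?e + ip ?b ?e * ip ?b ?e + ip ?b ?e * ip ?b ?e)
      + 2 * (gsigma gre^4 * (ip ?a ?b * ip ?c ?e + ip ?a ?c * ip ?b ?e + ip ?a ?e * ip ?b ?c)))
     = qform gre d u v"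
  proof -
    have s4: "gsigma gre ^ 4 = (if gre then 1 else 1/4)"
    proof -
      have "gsigma gre ^ 4 = ((gsigma gre)\<^sup>2)\<^sup>2" by simp
      then show ?thesis by (simp add: gsigma_def power2_eq_square)
    qed
    have re: "gre \<Longrightarrow> Im (cinner d u v) = 0" using uv by (simp add: Im_cinner_real)
    note c = sum_coef_re_re sum_coef_im_im sum_coef_re_im sum_coef_im_re
    have ips: "ip ?a ?a = (vnorm d u)\<^sup>2" "ip ?c ?c = (vnorm d v)\<^sup>2" "ip ?a ?c = Re (cinner d u v)"
       "ip ?b ?b = (if gre then 0 else (vnorm d u)\<^sup>2)" "ip ?e ?e = (if gre then 0 else (vnorm d v)\<^sup>2)"
       "ip ?b ?e = (if gre then 0 else Re (cinner d u v))"
       "ip ?a ?b = 0" "ip ?c ?e = 0" 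
       "ip ?a ?e = (if gre then 0 else Im (cinner d u v))" "ip ?b ?c = (if gre then 0 else - Im (cinner d u v))"
      unfolding ip_def using uv by (simp_all add: c cinner_self del: of_real_power)
    show ?thesis
      unfolding ips s4 qform_def using re
      by (cases gre) (simp_all add: m4_def power2_eq_square algebra_simps)
  qed
  finally show ?thesis .
qed

text \<open>The index set is general because measurability is needed on the full sample space and,
  for independence, on the space of a single row.\<close>

lemma measurable_gdot:
  assumes "row d i \<subseteq> I"
  shows "(\<lambda>w. gdot gre d w i u) \<in> borel_measurable (PiM I (\<lambda>_. normal_measure \<sigma>))"
proof -
  have "(\<lambda>w. \<Sum>k\<in>row d i. \<alpha> k * w k) \<in> borel_measurable (PiM I (\<lambda>_. normal_measure \<sigma>))" for \<alpha> :: "nat \<times> nat \<times> bool \<Rightarrow> real"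
    using assms by (intro borel_measurable_sum borel_measurable_times borel_measurable_const
        measurable_PiM_normal_component) auto
  then show ?thesis
    by (simp add: borel_measurable_complex_iff Re_gdot Im_gdot)
qed

text \<open>The exponential factorises over real and imaginary part. AM-GM separates the factors
  whatever their joint law, and doubles the exponent from 1/8 to the 1/4 available for one real
  form.\<close>

lemma nn_integral_exp_gdot:
  assumes u: "gre \<Longrightarrow> u \<in> fvecs True d" and i: "i < n" and le: "vnorm d u \<le> 1"
  shows "(\<integral>\<^sup>+w. ennreal (exp ((cmod (gdot gre d w i u))\<^sup>2 / 8)) \<partial>gauss_space gre d n) \<le> 2"
proof -
  let ?M = "gauss_space gre d n"
  let ?R = "\<lambda>w. Re (gdot gre d w i u)" and ?I = "\<lambda>w. Im (gdot gre d w i u)"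
  have [measurable]: "(\<lambda>w. gdot gre d w i u) \<in> borel_measurable ?M"
    unfolding gauss_space_eq by (rule measurable_gdot[OF row_subset[OF i]])
  have v1: "(vnorm d u)\<^sup>2 \<le> 1" using le by (simp add: power_le_one)
  have s1: "(gsigma gre)\<^sup>2 \<le> 1" by (simp add: gsigma_def)
  have "(\<integral>\<^sup>+w. ennreal (exp ((?R w)\<^sup>2 / 4)) \<partial>?M) \<le> 2"
    unfolding Re_gdot gauss_space_eq
  proof (rule nn_integral_exp_normal_linear_form[OF gsigma_pos finite_row row_subset[OF i]])
    have "(\<Sum>k\<in>row d i. (coef_re gre u k)\<^sup>2) = (vnorm d u)\<^sup>2"
      unfolding power2_eq_square[of "coef_re _ _ _"] using u by (simp add: sum_coef_re_re cinner_self del: of_real_power)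
    then show "(gsigma gre)\<^sup>2 * (\<Sum>k\<in>row d i. (coef_re gre u k)\<^sup>2) \<le> 1"
      using v1 s1 by (simp add: mult_le_one)
  qed
  moreover have "(\<integral>\<^sup>+w. ennreal (exp ((?I w)\<^sup>2 / 4)) \<partial>?M) \<le> 2"
    unfolding Im_gdot gauss_space_eq
  proof (rule nn_integral_exp_normal_linear_form[OF gsigma_pos finite_row row_subset[OF i]])
    have "(\<Sum>k\<in>row d i. (coef_im gre u k)\<^sup>2) = (if gre then 0 else (vnorm d u)\<^sup>2)"
      unfolding power2_eq_square[of "coef_im _ _ _"] using u by (simp add: sum_coef_im_im cinner_self del: of_real_power)
    then show "(gsigma gre)\<^sup>2 * (\<Sum>k\<in>row d i. (coef_im gre u k)\<^sup>2) \<le> 1"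
      using v1 s1 by (simp add: mult_le_one)
  qed
  ultimately have S: "(\<integral>\<^sup>+w. ennreal (exp ((?R w)\<^sup>2 / 4)) \<partial>?M) + (\<integral>\<^sup>+w. ennreal (exp ((?I w)\<^sup>2 / 4)) \<partial>?M) \<le> 2 + 2"
    by (rule add_mono)
  have "(\<integral>\<^sup>+w. ennreal (exp ((cmod (gdot gre d w i u))\<^sup>2 / 8)) \<partial>?M)
      \<le> (\<integral>\<^sup>+w. ennreal (1/2) * (ennreal (exp ((?R w)\<^sup>2 / 4)) + ennreal (exp ((?I w)\<^sup>2 / 4))) \<partial>?M)"
  proof (rule nn_integral_mono)
    fix w
    let ?x = "exp ((?R w)\<^sup>2 / 8)" and ?y = "exp ((?I w)\<^sup>2 / 8)"
    have "exp ((cmod (gdot gre d w i u))\<^sup>2 / 8) = ?x * ?y"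
      by (simp add: cmod_power2 add_divide_distrib exp_add)
    also have "\<dots> \<le> 1/2 * (?x\<^sup>2 + ?y\<^sup>2)"
      using sum_squares_bound[of ?x ?y] by simp
    also have "?x\<^sup>2 = exp ((?R w)\<^sup>2 / 4)" by (simp add: exp_double[symmetric])
    also have "?y\<^sup>2 = exp ((?I w)\<^sup>2 / 4)" by (simp add: exp_double[symmetric])
    finally show "ennreal (exp ((cmod (gdot gre d w i u))\<^sup>2 / 8))
      \<le> ennreal (1/2) * (ennreal (exp ((?R w)\<^sup>2 / 4)) + ennreal (exp ((?I w)\<^sup>2 / 4)))"
      by (subst ennreal_plus[symmetric], simp, simp, subst ennreal_mult'[symmetric], simp)
        (rule ennreal_leI)
  qed
  also have "\<dots> = ennreal (1/2) * ((\<integral>\<^sup>+w. ennreal (exp ((?R w)\<^sup>2 / 4)) \<partial>?M) + (\<integral>\<^sup>+w. ennreal (exp ((?I w)\<^sup>2 / 4)) \<partial>?M))"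
    by (subst nn_integral_cmult, simp, subst nn_integral_add) auto
  also have "\<dots> \<le> ennreal (1/2) * (2 + 2)"
    using S by (rule mult_left_mono) simp
  also have "ennreal (1/2) * (2 + 2) = 2"
    using ennreal_mult'[of "1/2" 4] by simp
  finally show ?thesis .
qed

section \<open>Tail bounds\<close>

text \<open>(1 - x + x^2/2)(1 + x + x^2/2) = 1 + x^4/4 >= 1, and the second factor is at most exp
  x.\<close>

lemma exp_minus_le_quadratic:
  fixes x :: real assumes "0 \<le> x" shows "exp (- x) \<le> 1 - x + x\<^sup>2 / 2"
proof -
  have p: "0 < 1 + x + x\<^sup>2 / 2" using assms by (intro add_pos_nonneg) auto
  have "(1 - x + x\<^sup>2 / 2) * (1 + x + x\<^sup>2 / 2) = 1 + x ^ 4 / 4"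
    by (simp add: power2_eq_square power4_eq_xxxx algebra_simps)
  then have "1 \<le> (1 - x + x\<^sup>2 / 2) * (1 + x + x\<^sup>2 / 2)" by simp
  then have "1 / (1 + x + x\<^sup>2 / 2) \<le> 1 - x + x\<^sup>2 / 2" using p by (simp add: divide_le_eq)
  moreover have "exp (- x) \<le> 1 / (1 + x + x\<^sup>2 / 2)"
    using exp_lower_Taylor_quadratic[OF assms] p by (simp add: exp_minus inverse_eq_divide frac_le)
  ultimately show ?thesis by simp
qed

text \<open>Multiply 1 - x <= exp (-x) by (1 + x) exp x and rearrange.\<close>

lemma exp_le_quadratic:
  fixes x :: real assumes "0 \<le> x" shows "exp x \<le> 1 + x + x\<^sup>2 * exp x"
proof -
  have "(1 - x) * (1 + x) \<le> exp (- x) * (1 + x)"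
    using exp_ge_add_one_self[of "- x"] assms by (intro mult_right_mono) auto
  then have "(1 - x) * (1 + x) * exp x \<le> exp (- x) * (1 + x) * exp x"
    by (rule mult_right_mono) simp
  also have "exp (- x) * (1 + x) * exp x = 1 + x"
    by (simp add: exp_minus field_simps)
  finally show ?thesis by (simp add: power2_eq_square algebra_simps)
qed

lemma power4_le_exp:
  fixes t :: real assumes "0 \<le> t" shows "t ^ 4 \<le> 256 * exp t"
proof -
  have "t / 4 \<le> exp (t / 4)" using exp_ge_add_one_self[of "t / 4"] by linarith
  then have "(t / 4) ^ 4 \<le> exp (t / 4) ^ 4" using assms by (intro power_mono) auto
  also have "exp (t / 4) ^ 4 = exp t" by (simp add: exp_of_nat_mult[symmetric])
  finally show ?thesis by (simp add: power_divide)
qed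

text \<open>The Chernoff parameter is absorbed into \<open>Z\<close>: negative multiples give lower
  tails and positive ones upper tails. Nonnegative integrals avoid integrability side
  conditions.\<close>

lemma (in prob_space) chernoff_sum:
  assumes I: "finite I" and ind: "indep_vars (\<lambda>_. borel) Z I"
    and mgf: "\<And>i. i \<in> I \<Longrightarrow> (\<integral>\<^sup>+\<omega>. ennreal (exp (Z i \<omega>)) \<partial>M) \<le> ennreal (exp c)"
  shows "prob {\<omega>\<in>space M. t \<le> (\<Sum>i\<in>I. Z i \<omega>)} \<le> exp (real (card I) * c - t)"
proof -
  have [measurable]: "Z i \<in> borel_measurable M" if "i \<in> I" for i
    using ind that by (auto simp: indep_vars_def)
  have ind': "indep_vars (\<lambda>_. borel) (\<lambda>i \<omega>. ennreal (exp (Z i \<omega>))) I"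
    by (rule indep_vars_compose2[OF ind]) auto
  have "emeasure M {\<omega>\<in>space M. t \<le> (\<Sum>i\<in>I. Z i \<omega>)}
      \<le> ennreal (exp (- 1 * t)) * (\<integral>\<^sup>+\<omega>. ennreal (exp (1 * (\<Sum>i\<in>I. Z i \<omega>))) * indicator (space M) \<omega> \<partial>M)"
    by (rule Chernoff_ineq_nn_integral_ge) auto
  also have "(\<integral>\<^sup>+\<omega>. ennreal (exp (1 * (\<Sum>i\<in>I. Z i \<omega>))) * indicator (space M) \<omega> \<partial>M)
      = (\<integral>\<^sup>+\<omega>. (\<Prod>i\<in>I. ennreal (exp (Z i \<omega>))) \<partial>M)"
    by (intro nn_integral_cong) (simp add: exp_sum I prod_ennreal)
  also have "\<dots> = (\<Prod>i\<in>I. \<integral>\<^sup>+\<omega>. ennreal (exp (Z i \<omega>)) \<partial>M)"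
    by (rule indep_vars_nn_integral[OF I ind']) simp
  also have "\<dots> \<le> (\<Prod>i\<in>I. ennreal (exp c))"
    using I mgf by (induction I rule: finite_induct) (auto intro!: mult_mono)
  also have "\<dots> = ennreal (exp (real (card I) * c))"
    by (simp add: ennreal_power exp_of_nat_mult)
  also have "ennreal (exp (- 1 * t)) * ennreal (exp (real (card I) * c)) = ennreal (exp (real (card I) * c - t))"
    by (simp add: ennreal_mult'[symmetric] exp_add[symmetric])
  finally have "emeasure M {\<omega>\<in>space M. t \<le> (\<Sum>i\<in>I. Z i \<omega>)} \<le> ennreal (exp (real (card I) * c - t))"
    by (simp add: mult_left_mono)
  then show ?thesis by (simp add: emeasure_eq_measure)
qed

text \<open>For nonnegative \<open>Z\<close>, exp (-lZ) is dominated by its second-order Taylor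
  polynomial, so a second moment replaces an exponential one. This is why the lower tail needs no
  truncation.\<close>

lemma (in prob_space) mgf_lower_le:
  assumes Z: "has_bochner_integral M Z \<mu>" "\<And>\<omega>. 0 \<le> Z \<omega>"
    and K: "(\<integral>\<^sup>+\<omega>. ennreal ((Z \<omega>)\<^sup>2) \<partial>M) \<le> ennreal K" "0 \<le> K" and l: "0 \<le> l"
  shows "(\<integral>\<^sup>+\<omega>. ennreal (exp (- l * Z \<omega>)) \<partial>M) \<le> ennreal (exp (- l * \<mu> + l\<^sup>2 * K / 2))"
proof -
  have intZ: "integrable M Z" and muZ: "expectation Z = \<mu>" using Z(1) by (auto simp: has_bochner_integral_iff)
  then have [measurable]: "Z \<in> borel_measurable M" by auto
  have int2: "integrable M (\<lambda>\<omega>. (Z \<omega>)\<^sup>2)"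
    using K(1) by (intro integrableI_nonneg) (auto simp: le_less_trans)
  then have "ennreal (expectation (\<lambda>\<omega>. (Z \<omega>)\<^sup>2)) = (\<integral>\<^sup>+\<omega>. ennreal ((Z \<omega>)\<^sup>2) \<partial>M)"
    by (intro nn_integral_eq_integral[symmetric]) auto
  then have E2: "expectation (\<lambda>\<omega>. (Z \<omega>)\<^sup>2) \<le> K" using K by (metis ennreal_le_iff)
  have intq: "integrable M (\<lambda>\<omega>. 1 - l * Z \<omega> + l\<^sup>2 * (Z \<omega>)\<^sup>2 / 2)"
    using intZ int2 by auto
  have "(\<integral>\<^sup>+\<omega>. ennreal (exp (- l * Z \<omega>)) \<partial>M) \<le> (\<integral>\<^sup>+\<omega>. ennreal (1 - l * Z \<omega> + l\<^sup>2 * (Z \<omega>)\<^sup>2 / 2) \<partial>M)"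
    using exp_minus_le_quadratic[of "l * Z \<omega>" for \<omega>] Z(2) l
    by (intro nn_integral_mono ennreal_leI) (simp add: power_mult_distrib)
  also have "\<dots> = ennreal (expectation (\<lambda>\<omega>. 1 - l * Z \<omega> + l\<^sup>2 * (Z \<omega>)\<^sup>2 / 2))"
  proof (rule nn_integral_eq_integral[OF intq], rule AE_I2)
    fix \<omega>
    have "0 \<le> exp (- (l * Z \<omega>))" by simp
    also have "\<dots> \<le> 1 - l * Z \<omega> + (l * Z \<omega>)\<^sup>2 / 2"
      using Z(2) l by (intro exp_minus_le_quadratic) simp
    finally show "0 \<le> 1 - l * Z \<omega> + l\<^sup>2 * (Z \<omega>)\<^sup>2 / 2" by (simp add: power_mult_distrib)
  qed
  also have "expectation (\<lambda>\<omega>. 1 - l * Z \<omega> + l\<^sup>2 * (Z \<omega>)\<^sup>2 / 2) = 1 - l * \<mu> + l\<^sup>2 * expectation (\<lambda>\<omega>. (Z \<omega>)\<^sup>2) / 2"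
    using intZ int2 muZ by (simp add: prob_space)
  also have "\<dots> \<le> 1 + (- l * \<mu> + l\<^sup>2 * K / 2)"
    using mult_left_mono[OF E2, of "l\<^sup>2"] by simp
  also have "\<dots> \<le> exp (- l * \<mu> + l\<^sup>2 * K / 2)" by (rule exp_ge_add_one_self)
  finally show ?thesis by (simp add: ennreal_leI)
qed

section \<open>Independence across measurements, and tails of products of Gaussian forms\<close>

lemma gdot_restrict_row: "gdot gre d (restrict w (row d i)) i u = gdot gre d w i u"
  by (rule complex_eqI) (auto simp: Re_gdot Im_gdot intro!: sum.cong)

text \<open>The rows are disjoint blocks of independent coordinates, and \<open>restr\<close> says
  that \<open>Z i\<close> sees only its own block. With \<open>1 \<le> d\<close> and n > 0 the index
  set is nonempty, as \<open>indep_vars_PiM_normal\<close> requires.\<close>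

lemma indep_vars_rows:
  fixes Z :: "nat \<Rightarrow> (nat \<times> nat \<times> bool \<Rightarrow> real) \<Rightarrow> real"
  assumes "1 \<le> d"
    and meas: "\<And>i. i < n \<Longrightarrow> Z i \<in> borel_measurable (PiM (row d i) (\<lambda>_. normal_measure (gsigma gre)))"
    and restr: "\<And>i w. Z i (restrict w (row d i)) = Z i w"
  shows "prob_space.indep_vars (gauss_space gre d n) (\<lambda>_. borel) Z {..<n}"
proof (cases "n = 0")
  case True
  interpret prob_space "gauss_space gre d n" by (rule prob_space_gauss)
  show ?thesis unfolding indep_vars_def indep_sets_def using True by simp
next
  case False
  interpret prob_space "gauss_space gre d n" by (rule prob_space_gauss)
  let ?I = "{..<n} \<times> {..<d} \<times> (UNIV :: bool set)"
  have "?I \<noteq> {}" using False assms(1) by (auto simp: lessThan_empty_iff)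
  then have "indep_vars (\<lambda>_. borel) (\<lambda>k w. w k) ?I"
    unfolding gauss_space_eq by (rule indep_vars_PiM_normal[OF gsigma_pos])
  then have "indep_vars (\<lambda>i. PiM (row d i) (\<lambda>_. borel)) (\<lambda>i w. restrict (\<lambda>k. w k) (row d i)) {..<n}"
    by (rule indep_vars_restrict) (auto simp: row_def disjoint_family_on_def)
  then have "indep_vars (\<lambda>_. borel) (\<lambda>i w. Z i (restrict (\<lambda>k. w k) (row d i))) {..<n}"
  proof (rule indep_vars_compose2)
    fix i assume i: "i \<in> {..<n}"
    have "sets (PiM (row d i) (\<lambda>_. borel)) = sets (PiM (row d i) (\<lambda>_. normal_measure (gsigma gre)))"
      by (intro sets_PiM_cong) auto
    from measurable_cong_sets[OF this refl, of borel] meas[of i] i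
    show "Z i \<in> borel_measurable (PiM (row d i) (\<lambda>_. borel))" by simp
  qed
  then show ?thesis by (simp add: restr)
qed

text \<open>With t = x^2/16, \<open>power4_le_exp\<close> gives x^8 <= 2^24 exp t. The total
  exponent becomes x^2/8, whose expectation is at most 2. The extra exponential serves the tilted
  second moment of the upper tail.\<close>

lemma cmod_gdot_power8_le:
  assumes u: "gre \<Longrightarrow> u \<in> fvecs True d" and i: "i < n" and le: "vnorm d u \<le> 1"
  shows "(\<integral>\<^sup>+w. ennreal ((cmod (gdot gre d w i u))^8 * exp ((cmod (gdot gre d w i u))\<^sup>2 / 16)) \<partial>gauss_space gre d n) \<le> ennreal (2^25)"
proof -
  let ?M = "gauss_space gre d n"
  have [measurable]: "(\<lambda>w. gdot gre d w i u) \<in> borel_measurable ?M"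
    unfolding gauss_space_eq by (rule measurable_gdot[OF row_subset[OF i]])
  have "(\<integral>\<^sup>+w. ennreal ((cmod (gdot gre d w i u))^8 * exp ((cmod (gdot gre d w i u))\<^sup>2 / 16)) \<partial>?M)
     \<le> (\<integral>\<^sup>+w. ennreal (2^24) * ennreal (exp ((cmod (gdot gre d w i u))\<^sup>2 / 8)) \<partial>?M)"
  proof (rule nn_integral_mono)
    fix w
    define x where "x = cmod (gdot gre d w i u)"
    have "(x\<^sup>2 / 16) ^ 4 \<le> 256 * exp (x\<^sup>2 / 16)" by (rule power4_le_exp) simp
    then have "x ^ 8 \<le> 2^24 * exp (x\<^sup>2 / 16)" by (simp add: power_divide flip: power_mult)
    then have "x ^ 8 * exp (x\<^sup>2 / 16) \<le> 2^24 * exp (x\<^sup>2 / 16) * exp (x\<^sup>2 / 16)"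
      by (rule mult_right_mono) simp
    also have "\<dots> = 2^24 * exp (x\<^sup>2 / 8)" by (simp add: exp_add[symmetric] mult.assoc)
    finally show "ennreal ((cmod (gdot gre d w i u))^8 * exp ((cmod (gdot gre d w i u))\<^sup>2 / 16))
      \<le> ennreal (2^24) * ennreal (exp ((cmod (gdot gre d w i u))\<^sup>2 / 8))"
      unfolding x_def by (subst ennreal_mult'[symmetric], simp) (rule ennreal_leI)
  qed
  also have "\<dots> = ennreal (2^24) * (\<integral>\<^sup>+w. ennreal (exp ((cmod (gdot gre d w i u))\<^sup>2 / 8)) \<partial>?M)"
    by (rule nn_integral_cmult) simp
  also have "\<dots> \<le> ennreal (2^24) * ennreal 2"
    using nn_integral_exp_gdot[OF u i le] by (intro mult_left_mono) auto
  also have "\<dots> = ennreal (2^25)" by (subst ennreal_mult'[symmetric]) auto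
  finally show ?thesis .
qed

lemma nn_integral_mean_le:
  assumes [measurable]: "f \<in> borel_measurable M" "g \<in> borel_measurable M"
    and le: "\<And>x. h x \<le> (f x + g x) / 2" and nn: "\<And>x. 0 \<le> f x" "\<And>x. 0 \<le> g x"
    and f: "(\<integral>\<^sup>+x. ennreal (f x) \<partial>M) \<le> ennreal K" and g: "(\<integral>\<^sup>+x. ennreal (g x) \<partial>M) \<le> ennreal K" and K: "0 \<le> K"
  shows "(\<integral>\<^sup>+x. ennreal (h x) \<partial>M) \<le> ennreal K"
proof -
  have "(\<integral>\<^sup>+x. ennreal (h x) \<partial>M) \<le> (\<integral>\<^sup>+x. ennreal (1/2) * (ennreal (f x) + ennreal (g x)) \<partial>M)"
  proof (rule nn_integral_mono)
    fix x
    have "ennreal (h x) \<le> ennreal (1/2 * (f x + g x))" using le[of x] by (intro ennreal_leI) simp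
    also have "\<dots> = ennreal (1/2) * (ennreal (f x) + ennreal (g x))"
      using nn by (simp only: ennreal_mult' ennreal_plus zero_le_divide_1_iff zero_le_numeral)
    finally show "ennreal (h x) \<le> ennreal (1/2) * (ennreal (f x) + ennreal (g x))" .
  qed
  also have "\<dots> = ennreal (1/2) * ((\<integral>\<^sup>+x. ennreal (f x) \<partial>M) + (\<integral>\<^sup>+x. ennreal (g x) \<partial>M))"
    by (subst nn_integral_cmult, simp, subst nn_integral_add) auto
  also have "\<dots> \<le> ennreal (1/2) * (ennreal K + ennreal K)"
    using f g by (intro mult_left_mono add_mono) auto
  also have "\<dots> = ennreal (1/2 * (K + K))" using K by (simp only: ennreal_mult' ennreal_plus zero_le_divide_1_iff zero_le_numeral)
  finally show ?thesis by simp
qed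

text \<open>The fourth power of the real part is at most half the sum of the eighth powers of the
  two moduli, so 2^25 bounds the second moment of a summand uniformly in \<open>u\<close> and
  \<open>v\<close>.\<close>

lemma gdot_product_lower_tail:
  assumes uv: "gre \<Longrightarrow> u \<in> fvecs True d" "gre \<Longrightarrow> v \<in> fvecs True d" "vnorm d u \<le> 1" "vnorm d v \<le> 1"
    and d: "1 \<le> d" and \<delta>: "0 < \<delta>"
  shows "measure (gauss_space gre d n) {w\<in>space (gauss_space gre d n).
      (\<Sum>i<n. (Re (gdot gre d w i u * cnj (gdot gre d w i v)))\<^sup>2) \<le> real n * (qform gre d u v - \<delta>)}
    \<le> exp (- real n * \<delta>\<^sup>2 / 2^26)"
proof -
  let ?M = "gauss_space gre d n"
  interpret prob_space ?M by (rule prob_space_gauss)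
  define X where "X = (\<lambda>i w. (Re (gdot gre d w i u * cnj (gdot gre d w i v)))\<^sup>2)"
  \<comment> \<open>The minimiser of - l \<delta> + 2^25 l^2 / 2, which gives the exponent -
    \<delta>^2 / 2^26 per sample.\<close>
  define l where "l = \<delta> / 2^25"
  have l: "0 < l" using \<delta> by (simp add: l_def)
  have mgf: "(\<integral>\<^sup>+w. ennreal (exp (- l * X i w)) \<partial>?M) \<le> ennreal (exp (- l * qform gre d u v + l\<^sup>2 * 2^25 / 2))"
    if i: "i < n" for i
  proof (rule mgf_lower_le)
    show "has_bochner_integral ?M (X i) (qform gre d u v)"
      unfolding X_def using uv i by (intro gdot_second_moment)
    have [measurable]: "(\<lambda>w. gdot gre d w i u) \<in> borel_measurable ?M" "(\<lambda>w. gdot gre d w i v) \<in> borel_measurable ?M"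
      unfolding gauss_space_eq by (rule measurable_gdot[OF row_subset[OF i]])+
    show "(\<integral>\<^sup>+w. ennreal ((X i w)\<^sup>2) \<partial>?M) \<le> ennreal (2^25)"
    proof (rule nn_integral_mean_le)
      show "(\<integral>\<^sup>+w. ennreal ((cmod (gdot gre d w i u))^8 * exp ((cmod (gdot gre d w i u))\<^sup>2 / 16)) \<partial>?M) \<le> ennreal (2^25)"
        using uv i by (intro cmod_gdot_power8_le)
      show "(\<integral>\<^sup>+w. ennreal ((cmod (gdot gre d w i v))^8 * exp ((cmod (gdot gre d w i v))\<^sup>2 / 16)) \<partial>?M) \<le> ennreal (2^25)"
        using uv i by (intro cmod_gdot_power8_le)
      fix w
      define a b where "a = cmod (gdot gre d w i u)" and "b = cmod (gdot gre d w i v)"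
      have "\<bar>Re (gdot gre d w i u * cnj (gdot gre d w i v))\<bar> \<le> a * b"
        using abs_Re_le_cmod[of "gdot gre d w i u * cnj (gdot gre d w i v)"] by (simp add: norm_mult a_def b_def)
      then have "\<bar>Re (gdot gre d w i u * cnj (gdot gre d w i v))\<bar> ^ 4 \<le> (a * b) ^ 4"
        by (rule power_mono) simp
      then have "(X i w)\<^sup>2 \<le> a ^ 4 * b ^ 4"
        by (simp add: X_def power_mult_distrib flip: power_mult)
      also have "\<dots> \<le> (a ^ 8 + b ^ 8) / 2"
        using sum_squares_bound[of "a ^ 4" "b ^ 4"] by (simp flip: power_mult)
      also have "\<dots> \<le> (a ^ 8 * exp (a\<^sup>2 / 16) + b ^ 8 * exp (b\<^sup>2 / 16)) / 2"
        by (intro divide_right_mono add_mono) (auto simp: mult_le_cancel_left1 zero_le_even_power)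
      finally show "(X i w)\<^sup>2 \<le> ((cmod (gdot gre d w i u))^8 * exp ((cmod (gdot gre d w i u))\<^sup>2 / 16)
          + (cmod (gdot gre d w i v))^8 * exp ((cmod (gdot gre d w i v))\<^sup>2 / 16)) / 2"
        by (simp add: a_def b_def)
    qed auto
  qed (use l in \<open>auto simp: X_def\<close>)
  have ind: "indep_vars (\<lambda>_. borel) (\<lambda>i w. - l * X i w) {..<n}"
  proof (rule indep_vars_rows[OF d])
    fix i
    have [measurable]: "(\<lambda>w. gdot gre d w i u) \<in> borel_measurable (PiM (row d i) (\<lambda>_. normal_measure (gsigma gre)))"
      "(\<lambda>w. gdot gre d w i v) \<in> borel_measurable (PiM (row d i) (\<lambda>_. normal_measure (gsigma gre)))"
      by (rule measurable_gdot[OF order_refl])+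
    show "(\<lambda>w. - l * X i w) \<in> borel_measurable (PiM (row d i) (\<lambda>_. normal_measure (gsigma gre)))"
      unfolding X_def times_complex.sel cnj.sel by measurable
  qed (simp add: X_def gdot_restrict_row)
  have "{w\<in>space ?M. (\<Sum>i<n. X i w) \<le> real n * (qform gre d u v - \<delta>)}
      = {w\<in>space ?M. - l * (real n * (qform gre d u v - \<delta>)) \<le> (\<Sum>i<n. - l * X i w)}"
    using l by (simp add: sum_distrib_left[symmetric] sum_negf)
  moreover have "prob \<dots> \<le> exp (real (card {..<n}) * (- l * qform gre d u v + l\<^sup>2 * 2^25 / 2) - - l * (real n * (qform gre d u v - \<delta>)))"
    by (rule chernoff_sum[OF _ ind]) (use mgf in auto)
  moreover have "real (card {..<n}) * (- l * qform gre d u v + l\<^sup>2 * 2^25 / 2) - - l * (real n * (qform gre d u v - \<delta>))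
     = - real n * \<delta>\<^sup>2 / 2^26"
    by (simp add: l_def power2_eq_square field_simps)
  ultimately show ?thesis by (simp add: X_def)
qed

text \<open>Truncating the \<open>u\<close> factor and taking \<open>l * T \<le> 1 / 32\<close>
  makes l Y at most |a^* v|^2 / 32, which has a finite exponential moment. The last condition on
  \<open>l\<close> keeps the quadratic term below half of the gain l \<delta>.\<close>

lemma gdot_product_upper_tail:
  assumes u: "gre \<Longrightarrow> u \<in> fvecs True d" "gre \<Longrightarrow> v \<in> fvecs True d" "vnorm d u \<le> 1" "vnorm d v \<le> 1"
    and d: "1 \<le> d" and l: "0 \<le> l" "l * T \<le> 1 / 32" "l * 2^25 \<le> \<delta> / 2"
  defines "Y \<equiv> \<lambda>i w. if (cmod (gdot gre d w i u))\<^sup>2 \<le> T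
      then (cmod (gdot gre d w i u))\<^sup>2 * (cmod (gdot gre d w i v))\<^sup>2 else 0"
  shows "measure (gauss_space gre d n) {w\<in>space (gauss_space gre d n).
      real n * (1 + m4 gre + \<delta>) < (\<Sum>i<n. Y i w)} \<le> exp (- real n * l * \<delta> / 2)"
proof -
  let ?M = "gauss_space gre d n"
  interpret prob_space ?M by (rule prob_space_gauss)
  have Y0: "0 \<le> Y i w" for i w by (simp add: Y_def)
  have m0: "0 < m4 gre" by (simp add: m4_def)
  have q: "qform gre d x x \<le> 1 + m4 gre" if "vnorm d x \<le> 1" for x
  proof -
    have "qform gre d x x = (1 + m4 gre) * (vnorm d x) ^ 4"
      by (simp add: qform_def cinner_self power2_eq_square power4_eq_xxxx algebra_simps flip: of_real_mult)
    also have "\<dots> \<le> (1 + m4 gre) * 1" using that m0 by (intro mult_left_mono power_le_one) auto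
    finally show ?thesis by simp
  qed
  have mgf: "(\<integral>\<^sup>+w. ennreal (exp (l * Y i w)) \<partial>?M) \<le> ennreal (exp (l * (1 + m4 gre) + l\<^sup>2 * 2^25))"
    if i: "i < n" for i
  proof -
    define p where "p = (\<lambda>w. cmod (gdot gre d w i u))"
    define r where "r = (\<lambda>w. cmod (gdot gre d w i v))"
    have [measurable]: "(\<lambda>w. gdot gre d w i u) \<in> borel_measurable ?M" "(\<lambda>w. gdot gre d w i v) \<in> borel_measurable ?M"
      unfolding gauss_space_eq by (rule measurable_gdot[OF row_subset[OF i]])+
    have [measurable]: "p \<in> borel_measurable ?M" "r \<in> borel_measurable ?M"
      unfolding p_def r_def by measurable
    have Yeq: "Y i w = (if (p w)\<^sup>2 \<le> T then (p w)\<^sup>2 * (r w)\<^sup>2 else 0)" for w by (simp add: Y_def p_def r_def)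
    have [measurable]: "Y i \<in> borel_measurable ?M" unfolding Yeq[abs_def] by measurable
    have Yle: "Y i w \<le> (p w)\<^sup>2 * (r w)\<^sup>2" for w by (simp add: Yeq)
    have fourth: "(\<integral>\<^sup>+w. ennreal (cmod (gdot gre d w i x) ^ 4) \<partial>?M) \<le> ennreal (1 + m4 gre)"
      if x: "gre \<Longrightarrow> x \<in> fvecs True d" "vnorm d x \<le> 1" for x
    proof -
      have e: "(Re (gdot gre d w i x * cnj (gdot gre d w i x)))\<^sup>2 = cmod (gdot gre d w i x) ^ 4" for w
        by (simp only: complex_norm_square[symmetric] Re_complex_of_real flip: power_mult) simp
      have H: "has_bochner_integral ?M (\<lambda>w. cmod (gdot gre d w i x) ^ 4) (qform gre d x x)"
        using gdot_second_moment[of gre x d x i n] x(1) i unfolding e by blast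
      then have "(\<integral>\<^sup>+w. ennreal (cmod (gdot gre d w i x) ^ 4) \<partial>?M) = ennreal (qform gre d x x)"
        by (subst nn_integral_eq_integral) (auto simp: has_bochner_integral_iff)
      with q[OF x(2)] show ?thesis by (simp add: ennreal_leI)
    qed
    \<comment> \<open>Truncation only lowers the summand, so the untruncated fourth moments still
      bound its mean, by AM-GM.\<close>
    have EY: "(\<integral>\<^sup>+w. ennreal (Y i w) \<partial>?M) \<le> ennreal (1 + m4 gre)"
    proof (rule nn_integral_mean_le)
      show "(\<integral>\<^sup>+w. ennreal (p w ^ 4) \<partial>?M) \<le> ennreal (1 + m4 gre)" "(\<integral>\<^sup>+w. ennreal (r w ^ 4) \<partial>?M) \<le> ennreal (1 + m4 gre)"
        unfolding p_def r_def using u by (auto intro: fourth)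
      show "Y i w \<le> (p w ^ 4 + r w ^ 4) / 2" for w
        using Yle[of w] sum_squares_bound[of "(p w)\<^sup>2" "(r w)\<^sup>2"] by (simp flip: power_mult)
    qed (use m0 in auto)
    have EY2: "(\<integral>\<^sup>+w. ennreal ((Y i w)\<^sup>2 * exp (l * Y i w)) \<partial>?M) \<le> ennreal (2^25)"
    proof (rule nn_integral_mean_le)
      show "(\<integral>\<^sup>+w. ennreal ((p w)^8 * exp ((p w)\<^sup>2 / 16)) \<partial>?M) \<le> ennreal (2^25)"
        "(\<integral>\<^sup>+w. ennreal ((r w)^8 * exp ((r w)\<^sup>2 / 16)) \<partial>?M) \<le> ennreal (2^25)"
        unfolding p_def r_def using u i by (intro cmod_gdot_power8_le; simp)+
      fix w
      have lY: "l * Y i w \<le> (r w)\<^sup>2 / 32"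
      proof (cases "(p w)\<^sup>2 \<le> T")
        case True
        have "l * (p w)\<^sup>2 \<le> 1 / 32" using mult_left_mono[OF True l(1)] l(2) by simp
        from mult_right_mono[OF this, of "(r w)\<^sup>2"] True show ?thesis by (simp add: Yeq mult.assoc)
      qed (simp add: Yeq)
      \<comment> \<open>Squaring in the AM-GM step doubles the exponent to 1/16, as allowed by
        \<open>cmod_gdot_power8_le\<close>.\<close>
      let ?e = "exp ((r w)\<^sup>2 / 32)"
      have e2: "?e\<^sup>2 = exp ((r w)\<^sup>2 / 16)" by (simp add: exp_double[symmetric])
      have "(Y i w)\<^sup>2 * exp (l * Y i w) \<le> ((p w)\<^sup>2 * (r w)\<^sup>2)\<^sup>2 * ?e"
        using Yle[of w] Y0[of i w] lY by (intro mult_mono power_mono) auto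
      also have "\<dots> = (p w)^4 * ((r w)^4 * ?e)" by (simp add: power_mult_distrib flip: power_mult)
      also have "\<dots> \<le> (((p w)^4)\<^sup>2 + ((r w)^4 * ?e)\<^sup>2) / 2"
        using sum_squares_bound[of "(p w)^4" "(r w)^4 * ?e"] by simp
      also have "\<dots> = ((p w)^8 + (r w)^8 * exp ((r w)\<^sup>2 / 16)) / 2"
        by (simp add: power_mult_distrib e2 flip: power_mult)
      also have "\<dots> \<le> ((p w)^8 * exp ((p w)\<^sup>2 / 16) + (r w)^8 * exp ((r w)\<^sup>2 / 16)) / 2"
        by (intro divide_right_mono add_mono order_refl) (auto simp: mult_le_cancel_left1 zero_le_even_power)
      finally show "(Y i w)\<^sup>2 * exp (l * Y i w) \<le> ((p w)^8 * exp ((p w)\<^sup>2 / 16) + (r w)^8 * exp ((r w)\<^sup>2 / 16)) / 2" .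
    qed auto
    have "(\<integral>\<^sup>+w. ennreal (exp (l * Y i w)) \<partial>?M)
       \<le> (\<integral>\<^sup>+w. 1 + (ennreal l * ennreal (Y i w) + ennreal (l\<^sup>2) * ennreal ((Y i w)\<^sup>2 * exp (l * Y i w))) \<partial>?M)"
    proof (rule nn_integral_mono)
      fix w
      have "exp (l * Y i w) \<le> 1 + (l * Y i w + l\<^sup>2 * ((Y i w)\<^sup>2 * exp (l * Y i w)))"
        using exp_le_quadratic[of "l * Y i w"] Y0[of i w] l(1) by (simp add: power_mult_distrib)
      then have "ennreal (exp (l * Y i w)) \<le> ennreal (1 + (l * Y i w + l\<^sup>2 * ((Y i w)\<^sup>2 * exp (l * Y i w))))"
        by (rule ennreal_leI)
      also have "\<dots> = 1 + (ennreal l * ennreal (Y i w) + ennreal (l\<^sup>2) * ennreal ((Y i w)\<^sup>2 * exp (l * Y i w)))"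
        using Y0[of i w] l(1) by (simp add: ennreal_plus ennreal_mult' del: ennreal_plus[symmetric])
      finally show "ennreal (exp (l * Y i w)) \<le> 1 + (ennreal l * ennreal (Y i w) + ennreal (l\<^sup>2) * ennreal ((Y i w)\<^sup>2 * exp (l * Y i w)))" .
    qed
    also have "\<dots> = 1 + (ennreal l * (\<integral>\<^sup>+w. ennreal (Y i w) \<partial>?M) + ennreal (l\<^sup>2) * (\<integral>\<^sup>+w. ennreal ((Y i w)\<^sup>2 * exp (l * Y i w)) \<partial>?M))"
      by (simp add: nn_integral_add nn_integral_cmult emeasure_space_1)
    also have "\<dots> \<le> 1 + (ennreal l * ennreal (1 + m4 gre) + ennreal (l\<^sup>2) * ennreal (2^25))"
      using EY EY2 by (intro add_mono mult_left_mono order_refl) auto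
    also have "\<dots> = ennreal (1 + (l * (1 + m4 gre) + l\<^sup>2 * 2^25))"
    proof -
      have "ennreal (1 + (a + b)) = 1 + (ennreal a + ennreal b)" if "0 \<le> a" "0 \<le> b" for a b
        using that by simp
      moreover have "0 \<le> l * (1 + m4 gre)" "0 \<le> l\<^sup>2 * 2^25" using l(1) m0 by simp_all
      moreover have "ennreal (l * (1 + m4 gre)) = ennreal l * ennreal (1 + m4 gre)"
        "ennreal (l\<^sup>2 * 2^25) = ennreal (l\<^sup>2) * ennreal (2^25)"
        using l(1) by (rule ennreal_mult', intro ennreal_mult') simp
      ultimately show ?thesis by (simp only:)
    qed
    also have "\<dots> \<le> ennreal (exp (l * (1 + m4 gre) + l\<^sup>2 * 2^25))"
      by (intro ennreal_leI exp_ge_add_one_self)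
    finally show ?thesis .
  qed
  have ind: "indep_vars (\<lambda>_. borel) (\<lambda>i w. l * Y i w) {..<n}"
  proof (rule indep_vars_rows[OF d])
    fix i
    have [measurable]: "(\<lambda>w. gdot gre d w i u) \<in> borel_measurable (PiM (row d i) (\<lambda>_. normal_measure (gsigma gre)))"
      "(\<lambda>w. gdot gre d w i v) \<in> borel_measurable (PiM (row d i) (\<lambda>_. normal_measure (gsigma gre)))"
      by (rule measurable_gdot[OF order_refl])+
    show "(\<lambda>w. l * Y i w) \<in> borel_measurable (PiM (row d i) (\<lambda>_. normal_measure (gsigma gre)))"
      unfolding Y_def by measurable
  qed (simp add: Y_def gdot_restrict_row)
  let ?t = "l * (real n * (1 + m4 gre + \<delta>))"
  have meas[measurable]: "(\<lambda>w. l * Y i w) \<in> borel_measurable ?M" if "i \<in> {..<n}" for i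
    using ind that by (auto simp: indep_vars_def)
  have "prob {w\<in>space ?M. real n * (1 + m4 gre + \<delta>) < (\<Sum>i<n. Y i w)}
      \<le> prob {w\<in>space ?M. ?t \<le> (\<Sum>i<n. l * Y i w)}"
  proof (rule finite_measure_mono)
    show "{w\<in>space ?M. real n * (1 + m4 gre + \<delta>) < (\<Sum>i<n. Y i w)} \<subseteq> {w\<in>space ?M. ?t \<le> (\<Sum>i<n. l * Y i w)}"
      using l(1) by (auto simp: sum_distrib_left[symmetric] intro!: mult_left_mono)
    show "{w\<in>space ?M. ?t \<le> (\<Sum>i<n. l * Y i w)} \<in> sets ?M"
      by measurable
  qed
  also have "\<dots> \<le> exp (real (card {..<n}) * (l * (1 + m4 gre) + l\<^sup>2 * 2^25) - ?t)"
    by (rule chernoff_sum[OF _ ind]) (use mgf in auto)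
  also have "real (card {..<n}) * (l * (1 + m4 gre) + l\<^sup>2 * 2^25) - ?t = real n * (l * (l * 2^25)) - real n * (l * \<delta>)"
    by (simp add: power2_eq_square algebra_simps)
  also have "exp \<dots> \<le> exp (real n * (l * (\<delta> / 2)) - real n * (l * \<delta>))"
    unfolding exp_le_cancel_iff using l(1,3) by (intro diff_right_mono mult_left_mono) auto
  also have "real n * (l * (\<delta> / 2)) - real n * (l * \<delta>) = - real n * l * \<delta> / 2" by (simp add: field_simps)
  finally show ?thesis .
qed

lemma gdot_tail:
  assumes u: "gre \<Longrightarrow> u \<in> fvecs True d" "vnorm d u \<le> 1" and i: "i < n"
  shows "measure (gauss_space gre d n) {w\<in>space (gauss_space gre d n). T < (cmod (gdot gre d w i u))\<^sup>2} \<le> 2 * exp (- T / 8)"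
proof -
  let ?M = "gauss_space gre d n"
  interpret prob_space ?M by (rule prob_space_gauss)
  have [measurable]: "(\<lambda>w. gdot gre d w i u) \<in> borel_measurable ?M"
    unfolding gauss_space_eq by (rule measurable_gdot[OF row_subset[OF i]])
  have "emeasure ?M {w\<in>space ?M. T < (cmod (gdot gre d w i u))\<^sup>2} \<le> emeasure ?M {w\<in>space ?M. T \<le> (cmod (gdot gre d w i u))\<^sup>2}"
    by (intro emeasure_mono) auto
  also have "\<dots> \<le> ennreal (exp (- (1/8) * T)) * (\<integral>\<^sup>+w. ennreal (exp ((1/8) * (cmod (gdot gre d w i u))\<^sup>2)) * indicator (space ?M) w \<partial>?M)"
    by (rule Chernoff_ineq_nn_integral_ge) auto
  also have "(\<integral>\<^sup>+w. ennreal (exp ((1/8) * (cmod (gdot gre d w i u))\<^sup>2)) * indicator (space ?M) w \<partial>?M) = (\<integral>\<^sup>+w. ennreal (exp ((cmod (gdot gre d w i u))\<^sup>2 / 8)) \<partial>?M)"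
    by (intro nn_integral_cong) simp
  also have "ennreal (exp (- (1/8) * T)) * \<dots> \<le> ennreal (exp (- (1/8) * T)) * ennreal 2"
    using nn_integral_exp_gdot[OF u(1) i u(2)] by (intro mult_left_mono) auto
  also have "\<dots> = ennreal (2 * exp (- T / 8))" by (subst ennreal_mult'[symmetric]) (auto simp: mult.commute)
  finally show ?thesis by (simp add: emeasure_eq_measure)
qed

section \<open>Grids in the unit ball\<close>

text \<open>An explicit lattice net, chosen so that its cardinality can be read off from integer
  vectors.\<close>

definition grid :: "bool \<Rightarrow> nat \<Rightarrow> real \<Rightarrow> (nat \<Rightarrow> complex) set" where
  "grid re d \<eta> = {v \<in> fvecs re d. vnorm d v \<le> 1 \<and>
     (\<forall>j. \<exists>k l :: int. v j = Complex (\<eta> * real_of_int k) (\<eta> * real_of_int l))}"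

text \<open>Rounding towards zero rather than to the nearest multiple: no coordinate grows, so a
  rounded vector stays in the unit ball.\<close>

lemma truncate_to_multiple:
  fixes \<eta> x :: real assumes "0 < \<eta>"
  shows "\<exists>k::int. \<bar>\<eta> * real_of_int k\<bar> \<le> \<bar>x\<bar> \<and> \<bar>x - \<eta> * real_of_int k\<bar> \<le> \<eta>"
proof -
  have pos: "\<exists>k::int. \<bar>\<eta> * real_of_int k\<bar> \<le> \<bar>x\<bar> \<and> \<bar>x - \<eta> * real_of_int k\<bar> \<le> \<eta>" if "0 \<le> x" for x
  proof (intro exI conjI)
    let ?k = "\<lfloor>x / \<eta>\<rfloor>"
    have k0: "0 \<le> ?k" using that assms by simp
    have "real_of_int ?k \<le> x / \<eta>" "x / \<eta> \<le> real_of_int ?k + 1" by linarith+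
    then have "\<eta> * real_of_int ?k \<le> \<eta> * (x / \<eta>)" "\<eta> * (x / \<eta>) \<le> \<eta> * (real_of_int ?k + 1)"
      using assms by (simp_all only: mult_le_cancel_left_pos)
    then have *: "\<eta> * real_of_int ?k \<le> x" "x \<le> \<eta> * real_of_int ?k + \<eta>"
      using assms by (auto simp: algebra_simps)
    have "0 \<le> \<eta> * real_of_int ?k" using k0 assms by simp
    with * that show "\<bar>\<eta> * real_of_int ?k\<bar> \<le> \<bar>x\<bar>" "\<bar>x - \<eta> * real_of_int ?k\<bar> \<le> \<eta>" by auto
  qed
  show ?thesis
  proof (cases "0 \<le> x")
    case False
    then obtain k where "\<bar>\<eta> * real_of_int k\<bar> \<le> \<bar>- x\<bar>" "\<bar>- x - \<eta> * real_of_int k\<bar> \<le> \<eta>"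
      using pos[of "- x"] by auto
    then show ?thesis by (intro exI[of _ "- k"]) auto
  qed (rule pos)
qed

lemma grid_approx:
  assumes "0 < \<eta>" and u: "u \<in> fvecs re d" "vnorm d u \<le> 1"
  obtains v where "v \<in> grid re d \<eta>" "vnorm d (\<lambda>j. u j - v j) \<le> \<eta> * sqrt (2 * real d)"
proof -
  obtain k :: "real \<Rightarrow> int" where k: "\<bar>\<eta> * real_of_int (k x)\<bar> \<le> \<bar>x\<bar>" "\<bar>x - \<eta> * real_of_int (k x)\<bar> \<le> \<eta>" for x
    using truncate_to_multiple[OF assms(1)] by metis
  \<comment> \<open>Zero rounds to zero, so the support and, in the real case, the reality of
    \<open>u\<close> survive the rounding.\<close>
  have k0: "k 0 = 0" using k(1)[of 0] assms(1) by simp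
  define v where "v = (\<lambda>j. Complex (\<eta> * real_of_int (k (Re (u j)))) (\<eta> * real_of_int (k (Im (u j)))))"
  have sq: "(\<eta> * real_of_int (k x))\<^sup>2 \<le> x\<^sup>2" "(x - \<eta> * real_of_int (k x))\<^sup>2 \<le> \<eta>\<^sup>2" for x
    using power_mono[OF k(1)[of x], of 2] power_mono[OF k(2)[of x], of 2] by auto
  have "(vnorm d v)\<^sup>2 \<le> (vnorm d u)\<^sup>2"
    unfolding vnorm_sq cmod_power2 v_def complex.sel by (intro sum_mono add_mono sq)
  then have "vnorm d v \<le> vnorm d u" by (rule power2_le_imp_le) simp
  then have "vnorm d v \<le> 1" using u by simp
  moreover have "v \<in> fvecs re d"
    using u(1) k0 by (auto simp: fvecs_def v_def complex_eq_iff)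
  ultimately have "v \<in> grid re d \<eta>" by (auto simp: grid_def v_def)
  moreover have "vnorm d (\<lambda>j. u j - v j) \<le> \<eta> * sqrt (2 * real d)"
  proof (rule power2_le_imp_le)
    have "(vnorm d (\<lambda>j. u j - v j))\<^sup>2 \<le> (\<Sum>j<d. \<eta>\<^sup>2 + \<eta>\<^sup>2)"
      unfolding vnorm_sq cmod_power2 v_def minus_complex.sel complex.sel by (intro sum_mono add_mono sq)
    then show "(vnorm d (\<lambda>j. u j - v j))\<^sup>2 \<le> (\<eta> * sqrt (2 * real d))\<^sup>2"
      by (simp add: power_mult_distrib algebra_simps)
  qed (use assms(1) in simp)
  ultimately show ?thesis by (rule that)
qed

definition gridvec :: "nat \<Rightarrow> real \<Rightarrow> (nat \<times> bool \<Rightarrow> int) \<Rightarrow> nat \<Rightarrow> complex" where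
  "gridvec d \<eta> k = (\<lambda>j. if j < d then Complex (\<eta> * real_of_int (k (j, False))) (\<eta> * real_of_int (k (j, True))) else 0)"

text \<open>Both constraints are kept: the box gives finiteness and the fine count, the sum of
  squares gives the coarse count.\<close>

lemma grid_subset_image:
  assumes \<eta>: "0 < \<eta>"
  shows "grid re d \<eta> \<subseteq> gridvec d \<eta> `
    {k \<in> PiE ({..<d} \<times> UNIV) (\<lambda>_. {- \<lfloor>1 / \<eta>\<rfloor>..\<lfloor>1 / \<eta>\<rfloor>}). (\<Sum>p\<in>{..<d} \<times> UNIV. (real_of_int (k p))\<^sup>2) \<le> 1 / \<eta>\<^sup>2}"
proof
  fix v assume v: "v \<in> grid re d \<eta>"
  then obtain a b :: "nat \<Rightarrow> int" where ab: "v j = Complex (\<eta> * real_of_int (a j)) (\<eta> * real_of_int (b j))" for j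
    unfolding grid_def by (auto, metis)
  have v1: "vnorm d v \<le> 1" and v0: "\<And>j. j \<ge> d \<Longrightarrow> v j = 0" using v by (auto simp: grid_def fvecs_def)
  define k where "k = restrict (\<lambda>(j, c). if c then b j else a j) ({..<d} \<times> UNIV)"
  have "v = gridvec d \<eta> k"
    using ab v0 by (auto simp: gridvec_def k_def fun_eq_iff)
  moreover have "k \<in> PiE ({..<d} \<times> UNIV) (\<lambda>_. {- \<lfloor>1 / \<eta>\<rfloor>..\<lfloor>1 / \<eta>\<rfloor>})"
  proof (rule PiE_I)
    fix p assume p: "p \<in> {..<d} \<times> (UNIV :: bool set)"
    then obtain j c where jc: "p = (j, c)" "j < d" by auto
    have le1: "cmod (v j) \<le> 1"
      using member_le_L2_set[of "{..<d}" j "\<lambda>j. cmod (v j)"] jc v1 by (simp add: vnorm_L2)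
    have "\<bar>\<eta> * real_of_int (k p)\<bar> \<le> 1"
      using abs_Re_le_cmod[of "v j"] abs_Im_le_cmod[of "v j"] le1 jc by (auto simp: k_def ab)
    then have "\<bar>real_of_int (k p)\<bar> \<le> 1 / \<eta>" using \<eta> by (simp add: abs_mult field_simps)
    then have "real_of_int (k p) \<le> 1 / \<eta>" "real_of_int (- k p) \<le> 1 / \<eta>" by auto
    then have "k p \<le> \<lfloor>1 / \<eta>\<rfloor>" "- k p \<le> \<lfloor>1 / \<eta>\<rfloor>" by (simp_all only: le_floor_iff)
    then show "k p \<in> {- \<lfloor>1 / \<eta>\<rfloor>..\<lfloor>1 / \<eta>\<rfloor>}" by auto
  qed (auto simp: k_def)
  moreover have "(\<Sum>p\<in>{..<d} \<times> UNIV. (real_of_int (k p))\<^sup>2) \<le> 1 / \<eta>\<^sup>2"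
  proof -
    have "(\<Sum>p\<in>{..<d} \<times> UNIV. (real_of_int (k p))\<^sup>2) = (\<Sum>j<d. \<Sum>c\<in>UNIV. (real_of_int (k (j, c)))\<^sup>2)"
      by (simp add: sum.cartesian_product)
    also have "\<dots> = (\<Sum>j<d. (real_of_int (a j))\<^sup>2 + (real_of_int (b j))\<^sup>2)"
      by (intro sum.cong) (auto simp: UNIV_bool k_def)
    finally have "\<eta>\<^sup>2 * (\<Sum>p\<in>{..<d} \<times> UNIV. (real_of_int (k p))\<^sup>2) = (vnorm d v)\<^sup>2"
      by (simp add: vnorm_sq ab cmod_power2 sum_distrib_left power_mult_distrib algebra_simps)
    also have "\<dots> \<le> 1" using v1 by (simp add: power_le_one)
    finally show ?thesis using \<eta> by (simp add: field_simps)
  qed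
  ultimately show "v \<in> gridvec d \<eta> ` {k \<in> PiE ({..<d} \<times> UNIV) (\<lambda>_. {- \<lfloor>1 / \<eta>\<rfloor>..\<lfloor>1 / \<eta>\<rfloor>}). (\<Sum>p\<in>{..<d} \<times> UNIV. (real_of_int (k p))\<^sup>2) \<le> 1 / \<eta>\<^sup>2}"
    by auto
qed

lemma finite_grid:
  assumes "0 < \<eta>"
  shows "finite (grid re d \<eta>)"
proof (rule finite_subset)
  show "grid re d \<eta> \<subseteq> gridvec d \<eta> ` PiE ({..<d} \<times> UNIV) (\<lambda>_. {- \<lfloor>1 / \<eta>\<rfloor>..\<lfloor>1 / \<eta>\<rfloor>})"
    using grid_subset_image[OF assms, of re d] by auto
qed (auto intro!: finite_imageI finite_PiE)

text \<open>Counts the whole box. A factor of order 1/\<eta> per real coordinate is affordable where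
  an exponent d ln n is; at mesh of order 1 / sqrt d it would cost d ln d, too much for the operator
  norm.\<close>

lemma card_grid_le_fine:
  assumes \<eta>: "0 < \<eta>"
  shows "real (card (grid re d \<eta>)) \<le> (2 / \<eta> + 1) ^ (2 * d)"
proof -
  let ?I = "{..<d} \<times> (UNIV :: bool set)"
  let ?N = "\<lfloor>1 / \<eta>\<rfloor>"
  let ?S = "PiE ?I (\<lambda>_. {- ?N..?N})"
  have "card (grid re d \<eta>) \<le> card (gridvec d \<eta> ` ?S)"
    using grid_subset_image[OF \<eta>, of re d] by (intro card_mono finite_imageI finite_PiE) auto
  also have "\<dots> \<le> card ?S" by (intro card_image_le finite_PiE) auto
  also have "\<dots> = nat (2 * ?N + 1) ^ (2 * d)"
    by (simp add: card_PiE card_cartesian_product mult.commute)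
  finally have "real (card (grid re d \<eta>)) \<le> real (nat (2 * ?N + 1)) ^ (2 * d)"
    by (metis of_nat_le_iff of_nat_power)
  also have "\<dots> \<le> (2 / \<eta> + 1) ^ (2 * d)"
  proof (rule power_mono)
    have "0 \<le> ?N" using \<eta> by simp
    then have "real (nat (2 * ?N + 1)) = 2 * real_of_int ?N + 1" by simp
    also have "\<dots> \<le> 2 * (1 / \<eta>) + 1" using of_int_floor_le[of "1 / \<eta>"] by linarith
    finally show "real (nat (2 * ?N + 1)) \<le> 2 / \<eta> + 1" by simp
  qed simp
  finally show ?thesis .
qed

lemma sum_half_powers_le: "(\<Sum>z\<in>{- int m..int m}. (1/2::real) ^ nat \<bar>z\<bar>) \<le> 3"
proof -
  have "(\<Sum>z\<in>{- int m..int m}. (1/2::real) ^ nat \<bar>z\<bar>) = 3 - 2 * (1/2) ^ m"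
  proof (induction m)
    case (Suc m)
    have "{- int (Suc m)..int (Suc m)} = insert (- int (Suc m)) (insert (int (Suc m)) {- int m..int m})" by auto
    then have "(\<Sum>z\<in>{- int (Suc m)..int (Suc m)}. (1/2::real) ^ nat \<bar>z\<bar>)
        = (1/2) ^ Suc m + ((1/2) ^ Suc m + (\<Sum>z\<in>{- int m..int m}. (1/2::real) ^ nat \<bar>z\<bar>))"
      by (simp add: nat_add_distrib)
    with Suc.IH show ?case by simp
  qed simp
  then show ?thesis by simp
qed

text \<open>A grid point has integer coordinates \<open>k\<close> with \<open>\<Sum> \<bar>k\<bar> \<le> \<Sum> k\<^sup>2 \<le> R\<close>, so it has weight
  \<open>2 ^ R * \<Prod> (1/2) ^ \<bar>k\<bar> \<ge> 1\<close>, and the total weight of the whole lattice factorises.\<close>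

lemma card_grid_le_coarse:
  assumes \<eta>: "0 < \<eta>" and R: "1 / \<eta>\<^sup>2 \<le> real R"
  shows "real (card (grid re d \<eta>)) \<le> 2 ^ R * 3 ^ (2 * d)"
proof -
  let ?I = "{..<d} \<times> (UNIV :: bool set)"
  define m where "m = nat \<lfloor>1 / \<eta>\<rfloor>"
  have N: "\<lfloor>1 / \<eta>\<rfloor> = int m" using \<eta> by (simp add: m_def)
  let ?P = "PiE ?I (\<lambda>_. {- int m..int m})"
  let ?S = "{k \<in> ?P. (\<Sum>p\<in>?I. (real_of_int (k p))\<^sup>2) \<le> 1 / \<eta>\<^sup>2}"
  have fin: "finite ?P" by (intro finite_PiE) auto
  have "card (grid re d \<eta>) \<le> card (gridvec d \<eta> ` ?S)"
    using grid_subset_image[OF \<eta>, of re d] fin unfolding N by (intro card_mono finite_imageI) auto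
  also have "\<dots> \<le> card ?S" using fin by (intro card_image_le) auto
  finally have "real (card (grid re d \<eta>)) \<le> (\<Sum>k\<in>?S. 1)" by simp
  also have "\<dots> \<le> (\<Sum>k\<in>?S. 2 ^ R * (\<Prod>p\<in>?I. (1/2) ^ nat \<bar>k p\<bar>))"
  proof (rule sum_mono)
    fix k assume k: "k \<in> ?S"
    have "real (\<Sum>p\<in>?I. nat \<bar>k p\<bar>) \<le> (\<Sum>p\<in>?I. (real_of_int (k p))\<^sup>2)"
      unfolding of_nat_sum
    proof (rule sum_mono)
      fix p
      have "\<bar>k p\<bar> * 1 \<le> \<bar>k p\<bar> * \<bar>k p\<bar>" by (cases "k p = 0", simp, rule mult_left_mono, linarith, simp)
      then have "\<bar>k p\<bar> \<le> (k p)\<^sup>2" by (simp add: power2_eq_square)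
      then have "real_of_int \<bar>k p\<bar> \<le> real_of_int ((k p)\<^sup>2)" by (simp only: of_int_le_iff)
      then show "real (nat \<bar>k p\<bar>) \<le> (real_of_int (k p))\<^sup>2" by simp
    qed
    also have "\<dots> \<le> real R" using k R by auto
    finally have "(\<Sum>p\<in>?I. nat \<bar>k p\<bar>) \<le> R" by (simp only: of_nat_le_iff)
    then have "(1/2::real) ^ R \<le> (1/2) ^ (\<Sum>p\<in>?I. nat \<bar>k p\<bar>)" by (intro power_decreasing) auto
    also have "\<dots> = (\<Prod>p\<in>?I. (1/2) ^ nat \<bar>k p\<bar>)" by (simp add: power_sum)
    finally show "1 \<le> 2 ^ R * (\<Prod>p\<in>?I. (1/2::real) ^ nat \<bar>k p\<bar>)"
      by (simp add: power_divide field_simps)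
  qed
  also have "\<dots> \<le> (\<Sum>k\<in>?P. 2 ^ R * (\<Prod>p\<in>?I. (1/2) ^ nat \<bar>k p\<bar>))"
    using fin by (intro sum_mono2) (auto intro!: mult_nonneg_nonneg prod_nonneg)
  also have "\<dots> = 2 ^ R * (\<Prod>p\<in>?I. \<Sum>z\<in>{- int m..int m}. (1/2) ^ nat \<bar>z\<bar>)"
    by (subst prod_sum_PiE) (auto simp: sum_distrib_left)
  also have "\<dots> \<le> 2 ^ R * (\<Prod>p\<in>?I. 3)"
    by (intro mult_left_mono prod_mono conjI sum_half_powers_le sum_nonneg) auto
  also have "\<dots> = 2 ^ R * 3 ^ (2 * d)" by (simp add: card_cartesian_product mult.commute)
  finally show ?thesis .
qed

section \<open>From grids to the unit ball\<close>

text \<open>For real vectors, taking the real part of a a^* does not change the form. Complex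
  samples with F = R thus need no separate treatment.\<close>

lemma bform_gmeas:
  assumes "x \<in> fvecs re d" "h \<in> fvecs re d"
  shows "bform d (gmeas re gre w i) x h = Re (gdot gre d w i x * cnj (gdot gre d w i h))"
proof -
  let ?a = "gvec gre w i"
  have "bform d (gmeas re gre w i) x h = (\<Sum>j<d. \<Sum>k<d. Re (cnj (gmeas re gre w i j k) * (x j * cnj (h k))))"
    by (simp only: bform_def hs_inner_def Re_sum)
  also have "\<dots> = (\<Sum>j<d. \<Sum>k<d. Re ((cnj (?a j) * x j) * cnj (cnj (?a k) * h k)))"
    using assms by (intro sum.cong refl) (auto simp: gmeas_def fvecs_def algebra_simps)
  also have "\<dots> = Re (\<Sum>j<d. \<Sum>k<d. (cnj (?a j) * x j) * cnj (cnj (?a k) * h k))"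
    by (simp only: Re_sum)
  also have "(\<Sum>j<d. \<Sum>k<d. (cnj (?a j) * x j) * cnj (cnj (?a k) * h k)) = gdot gre d w i x * cnj (gdot gre d w i h)"
    unfolding cinner_def cnj_sum sum_product ..
  finally show ?thesis .
qed

lemma mat_vec_adj_gmeas_fvecs:
  assumes "v \<in> fvecs re d"
  shows "mat_vec d (adj d n (gmeas re gre w) z) v \<in> fvecs re d"
  using assms by (auto simp: fvecs_def mat_vec_def adj_def gmeas_def intro!: sum.neutral)

text \<open>Replaces the spectral theorem: with h = M v and y = |h|, y^2 is the mixed form at h and
  v. Cauchy-Schwarz over the measurements, with the weights split as square roots, bounds it by B
  y.\<close>

lemma op_norm_gmeas_le:
  assumes d: "1 \<le> d" and z: "\<And>i. i < n \<Longrightarrow> 0 \<le> z i" and B: "0 \<le> B"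
    and form: "\<And>v. v \<in> fvecs re d \<Longrightarrow> (\<Sum>i<n. z i * (cmod (gdot gre d w i v))\<^sup>2) \<le> B * (vnorm d v)\<^sup>2"
  shows "op_norm re d (adj d n (gmeas re gre w) z) \<le> B"
  unfolding op_norm_def
proof (rule cSup_least)
  \<comment> \<open>A unit vector showing that the supremum is over a nonempty set; this requires
    \<open>1 \<le> d\<close>.\<close>
  define e where "e = (\<lambda>j::nat. if j = 0 then 1 else 0 :: complex)"
  have "e \<in> fvecs re d" using d by (auto simp: e_def fvecs_def)
  moreover have "vnorm d e = 1"
  proof -
    have "(\<Sum>j<d. (cmod (e j))\<^sup>2) = (\<Sum>j<d. if j = 0 then 1 else 0)" by (intro sum.cong) (auto simp: e_def)
    then show ?thesis using d by (simp add: vnorm_def)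
  qed
  ultimately show "{vnorm d (mat_vec d (adj d n (gmeas re gre w) z) v) |v. v \<in> fvecs re d \<and> vnorm d v = 1} \<noteq> {}"
    by blast
next
  fix y assume "y \<in> {vnorm d (mat_vec d (adj d n (gmeas re gre w) z) v) |v. v \<in> fvecs re d \<and> vnorm d v = 1}"
  then obtain v where v: "v \<in> fvecs re d" "vnorm d v = 1"
    and y: "y = vnorm d (mat_vec d (adj d n (gmeas re gre w) z) v)" by auto
  define h where "h = mat_vec d (adj d n (gmeas re gre w) z) v"
  have h: "h \<in> fvecs re d" unfolding h_def by (rule mat_vec_adj_gmeas_fvecs[OF v(1)])
  let ?f = "\<lambda>i. sqrt (z i) * cmod (gdot gre d w i h)" and ?g = "\<lambda>i. sqrt (z i) * cmod (gdot gre d w i v)"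
  have sq: "(\<Sum>i<n. (sqrt (z i) * cmod (gdot gre d w i u))\<^sup>2) = (\<Sum>i<n. z i * (cmod (gdot gre d w i u))\<^sup>2)" for u
    by (intro sum.cong) (auto simp: power_mult_distrib z)
  have "y\<^sup>2 = Re (cinner d h h)" by (simp add: cinner_self y h_def del: of_real_power)
  also have "\<dots> = (\<Sum>i<n. z i * bform d (gmeas re gre w i) h v)"
    unfolding sum_bform_adj h_def[symmetric] ..
  also have "\<dots> \<le> (\<Sum>i<n. ?f i * ?g i)"
  proof (rule sum_mono)
    fix i assume i: "i \<in> {..<n}"
    have "bform d (gmeas re gre w i) h v \<le> cmod (gdot gre d w i h) * cmod (gdot gre d w i v)"
      unfolding bform_gmeas[OF h v(1)]
      using complex_Re_le_cmod[of "gdot gre d w i h * cnj (gdot gre d w i v)"] by (simp add: norm_mult)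
    then have "z i * bform d (gmeas re gre w i) h v \<le> z i * (cmod (gdot gre d w i h) * cmod (gdot gre d w i v))"
      using z i by (intro mult_left_mono) auto
    also have "\<dots> = (sqrt (z i))\<^sup>2 * (cmod (gdot gre d w i h) * cmod (gdot gre d w i v))" using z i by simp
    finally show "z i * bform d (gmeas re gre w i) h v \<le> ?f i * ?g i" by (simp only: power2_eq_square mult_ac)
  qed
  finally have "(y\<^sup>2)\<^sup>2 \<le> (\<Sum>i<n. ?f i * ?g i)\<^sup>2" by (rule power_mono) simp
  also have "\<dots> \<le> (\<Sum>i<n. (?f i)\<^sup>2) * (\<Sum>i<n. (?g i)\<^sup>2)" by (rule Cauchy_Schwarz_ineq_sum)
  also have "\<dots> \<le> (B * (vnorm d h)\<^sup>2) * (B * (vnorm d v)\<^sup>2)"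
    unfolding sq using B z by (intro mult_mono form h v sum_nonneg) auto
  also have "\<dots> = (B * y)\<^sup>2" using v(2) by (simp add: y h_def power2_eq_square)
  finally have sq_le: "(y\<^sup>2)\<^sup>2 \<le> (B * y)\<^sup>2" .
  have y0: "0 \<le> y" by (simp add: y)
  have "y\<^sup>2 \<le> B * y" by (rule power2_le_imp_le[OF sq_le]) (use B y0 in simp)
  then have "y * y \<le> B * y" by (simp only: power2_eq_square)
  then show "y \<le> B" using y0 B by (cases "y = 0") (auto simp: mult_le_cancel_right)
qed

lemma cinner_add_right: "cinner d x (\<lambda>j. y j + z j) = cinner d x y + cinner d x z"
  by (simp add: cinner_def algebra_simps sum.distrib)

lemma cinner_diff_right: "cinner d x (\<lambda>j. y j - z j) = cinner d x y - cinner d x z"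
  by (simp add: cinner_def algebra_simps sum_subtractf)

lemma cinner_diff_left: "cinner d (\<lambda>j. y j - z j) x = cinner d y x - cinner d z x"
  by (simp add: cinner_def algebra_simps sum_subtractf)

text \<open>The square root \<open>P\<close> of the form is a seminorm. Its supremum s over the ball
  satisfies s <= b + \<epsilon> s, hence s <= b / (1 - \<epsilon>).\<close>

lemma net_seminorm_bound:
  assumes z: "\<And>i. i < n \<Longrightarrow> 0 \<le> z i" and b: "0 \<le> b" and \<epsilon>: "0 < \<epsilon>" "\<epsilon> < 1"
    and net: "\<And>v. v \<in> N \<Longrightarrow> (\<Sum>i<n. z i * (cmod (gdot gre d w i v))\<^sup>2) \<le> b\<^sup>2"
    and cover: "\<And>v. v \<in> fvecs re d \<Longrightarrow> vnorm d v \<le> 1 \<Longrightarrow> \<exists>v'\<in>N. v' \<in> fvecs re d \<and> vnorm d (\<lambda>j. v j - v' j) \<le> \<epsilon>"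
    and v: "v \<in> fvecs re d"
  shows "(\<Sum>i<n. z i * (cmod (gdot gre d w i v))\<^sup>2) \<le> (b / (1 - \<epsilon>))\<^sup>2 * (vnorm d v)\<^sup>2"
proof -
  define P where "P v = L2_set (\<lambda>i. sqrt (z i) * cmod (gdot gre d w i v)) {..<n}" for v
  have P_sq: "(P v)\<^sup>2 = (\<Sum>i<n. z i * (cmod (gdot gre d w i v))\<^sup>2)" for v
  proof -
    have "(P v)\<^sup>2 = (\<Sum>i<n. (sqrt (z i) * cmod (gdot gre d w i v))\<^sup>2)"
      unfolding P_def L2_set_def by (rule real_sqrt_pow2) (simp add: sum_nonneg)
    also have "\<dots> = (\<Sum>i<n. z i * (cmod (gdot gre d w i v))\<^sup>2)"
      by (intro sum.cong) (auto simp: power_mult_distrib z)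
    finally show ?thesis .
  qed
  have P0: "0 \<le> P v" for v by (simp add: P_def L2_set_nonneg)
  have P_scale: "P (\<lambda>j. complex_of_real t * v j) = \<bar>t\<bar> * P v" for t v
    unfolding P_def cinner_scale_right norm_mult by (simp add: L2_set_right_distrib mult_ac)
  have P_tri: "P v \<le> P v' + P (\<lambda>j. v j - v' j)" for v v'
  proof -
    have "P v \<le> L2_set (\<lambda>i. sqrt (z i) * cmod (gdot gre d w i v') + sqrt (z i) * cmod (gdot gre d w i (\<lambda>j. v j - v' j))) {..<n}"
      unfolding P_def
    proof (rule L2_set_mono)
      fix i assume i: "i \<in> {..<n}"
      have "cmod (gdot gre d w i v) \<le> cmod (gdot gre d w i v') + cmod (gdot gre d w i (\<lambda>j. v j - v' j))"
        unfolding cinner_diff_right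
        using norm_triangle_ineq[of "gdot gre d w i v'" "gdot gre d w i v - gdot gre d w i v'"] by simp
      from mult_left_mono[OF this, of "sqrt (z i)"] z i
      show "sqrt (z i) * cmod (gdot gre d w i v) \<le> sqrt (z i) * cmod (gdot gre d w i v') + sqrt (z i) * cmod (gdot gre d w i (\<lambda>j. v j - v' j))"
        by (simp add: distrib_left)
    qed (use z in auto)
    also have "\<dots> \<le> P v' + P (\<lambda>j. v j - v' j)" unfolding P_def by (rule L2_set_triangle_ineq)
    finally show ?thesis .
  qed
  define U where "U = {v \<in> fvecs re d. vnorm d v \<le> 1}"
  define s where "s = (SUP v\<in>U. P v)"
  have "(\<lambda>j. 0) \<in> U" by (auto simp: U_def fvecs_def vnorm_def)
  then have ne: "U \<noteq> {}" by auto
  \<comment> \<open>Without this crude bound the supremum would have no meaning, and the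
    self-bounding inequality could not be solved for \<open>s\<close>.\<close>
  have bdd: "bdd_above (P ` U)"
  proof (rule bdd_aboveI2)
    fix v assume "v \<in> U"
    then have v1: "vnorm d v \<le> 1" by (simp add: U_def)
    show "P v \<le> L2_set (\<lambda>i. sqrt (z i) * vnorm d (gvec gre w i)) {..<n}"
      unfolding P_def
    proof (rule L2_set_mono)
      fix i assume "i \<in> {..<n}"
      have "cmod (gdot gre d w i v) \<le> vnorm d (gvec gre w i) * 1"
        by (rule order_trans[OF cmod_cinner_le]) (use v1 in \<open>intro mult_left_mono, auto\<close>)
      then show "sqrt (z i) * cmod (gdot gre d w i v) \<le> sqrt (z i) * vnorm d (gvec gre w i)"
        using z \<open>i \<in> {..<n}\<close> by (intro mult_left_mono) auto
    qed (use z in auto)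
  qed
  have P_hom: "P v \<le> s * vnorm d v" if v: "v \<in> fvecs re d" for v
  proof (cases "vnorm d v = 0")
    case True
    then have "gdot gre d w i v = 0" for i by (simp add: vnorm_eq_0_iff cinner_def)
    then show ?thesis using True by (simp add: P_def L2_set_def)
  next
    case False
    then have pos: "0 < vnorm d v" using vnorm_nonneg[of d v] by linarith
    define t where "t = 1 / vnorm d v"
    have "vnorm d (\<lambda>j. complex_of_real t * v j) = 1"
      unfolding vnorm_scale norm_of_real using pos by (simp add: t_def)
    then have "(\<lambda>j. complex_of_real t * v j) \<in> U"
      unfolding U_def using fvecs_scale[OF v, of "complex_of_real t"] by simp
    then have "P (\<lambda>j. complex_of_real t * v j) \<le> s" unfolding s_def by (rule cSUP_upper[OF _ bdd])
    then show ?thesis unfolding P_scale using pos by (simp add: t_def field_simps)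
  qed
  have s0: "0 \<le> s" using cSUP_upper[OF \<open>(\<lambda>j. 0) \<in> U\<close> bdd] P0[of "\<lambda>j. 0"] by (simp add: s_def)
  have "s \<le> b + s * \<epsilon>"
    unfolding s_def
  proof (rule cSUP_least[OF ne])
    fix v assume "v \<in> U"
    then have v: "v \<in> fvecs re d" "vnorm d v \<le> 1" by (auto simp: U_def)
    from cover[OF this] obtain v' where v': "v' \<in> N" "v' \<in> fvecs re d" "vnorm d (\<lambda>j. v j - v' j) \<le> \<epsilon>" by blast
    have "P v' \<le> b" using net[OF v'(1)] b unfolding P_sq[symmetric] by (rule power2_le_imp_le)
    moreover have "P (\<lambda>j. v j - v' j) \<le> s * \<epsilon>"
      by (rule order_trans[OF P_hom[OF fvecs_diff[OF v(1) v'(2)]]]) (use v' s0 in \<open>auto intro: mult_left_mono\<close>)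
    ultimately show "P v \<le> b + (SUP v\<in>U. P v) * \<epsilon>" using P_tri[of v v'] by (simp add: s_def)
  qed
  then have "s \<le> b / (1 - \<epsilon>)" using \<epsilon> by (simp add: field_simps)
  then have "P v \<le> b / (1 - \<epsilon>) * vnorm d v"
    using P_hom[OF v] by (meson mult_right_mono order_trans vnorm_nonneg)
  from power_mono[OF this P0, of 2] show ?thesis by (simp only: P_sq power_mult_distrib)
qed

section \<open>Transfer of the lower bound from grid points to the ball\<close>

lemma abs_square_diff_le:
  fixes x y :: real assumes "\<bar>x\<bar> \<le> A" "\<bar>y\<bar> \<le> A" "\<bar>x - y\<bar> \<le> e"
  shows "\<bar>x\<^sup>2 - y\<^sup>2\<bar> \<le> 2 * A * e"
proof -
  have "\<bar>x\<^sup>2 - y\<^sup>2\<bar> = \<bar>x + y\<bar> * \<bar>x - y\<bar>" by (simp add: power2_eq_square abs_mult[symmetric] algebra_simps)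
  also have "\<dots> \<le> (2 * A) * e" using assms by (intro mult_mono) auto
  finally show ?thesis .
qed

lemma cinner_perturb:
  assumes "vnorm d u \<le> 1" "vnorm d v' \<le> 1" "vnorm d (\<lambda>j. u j - u' j) \<le> \<epsilon>" "vnorm d (\<lambda>j. v j - v' j) \<le> \<epsilon>"
  shows "cmod (cinner d u v - cinner d u' v') \<le> 2 * \<epsilon>"
proof -
  have e0: "0 \<le> \<epsilon>" using vnorm_nonneg[of d "\<lambda>j. u j - u' j"] assms(3) by linarith
  have "cinner d u v - cinner d u' v' = cinner d u (\<lambda>j. v j - v' j) + cinner d (\<lambda>j. u j - u' j) v'"
    by (simp add: cinner_diff_right cinner_diff_left)
  also have "cmod \<dots> \<le> vnorm d u * vnorm d (\<lambda>j. v j - v' j) + vnorm d (\<lambda>j. u j - u' j) * vnorm d v'"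
    by (rule order_trans[OF norm_triangle_ineq add_mono[OF cmod_cinner_le cmod_cinner_le]])
  also have "\<dots> \<le> 1 * \<epsilon> + \<epsilon> * 1" using assms e0 by (intro add_mono mult_mono) auto
  finally show ?thesis by simp
qed

text \<open>Three contributions of 4 \<epsilon>: the product of squared norms, Re of the squared
  inner product, and the squared real part. The first two carry the factor
  \<open>m4 gre / 2\<close>, which is at most 1.\<close>

lemma qform_perturb:
  assumes "vnorm d u \<le> 1" "vnorm d v \<le> 1" "vnorm d u' \<le> 1" "vnorm d v' \<le> 1"
    "vnorm d (\<lambda>j. u j - u' j) \<le> \<epsilon>" "vnorm d (\<lambda>j. v j - v' j) \<le> \<epsilon>"
  shows "qform gre d u v \<le> qform gre d u' v' + 12 * \<epsilon>"
proof -
  have e0: "0 \<le> \<epsilon>" using vnorm_nonneg[of d "\<lambda>j. u j - u' j"] assms(5) by linarith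
  have sq: "\<bar>(vnorm d x)\<^sup>2 - (vnorm d x')\<^sup>2\<bar> \<le> 2 * \<epsilon>"
    if "vnorm d x \<le> 1" "vnorm d x' \<le> 1" "vnorm d (\<lambda>j. x j - x' j) \<le> \<epsilon>" for x x'
    using cinner_perturb[of d x x' x' \<epsilon> x] that
    by (simp add: cinner_self flip: of_real_diff of_real_power)
  have le1: "(vnorm d x)\<^sup>2 \<le> 1" if "vnorm d x \<le> 1" for x using that by (simp add: power_le_one)
  have cc: "cmod (cinner d x y) \<le> 1" if "vnorm d x \<le> 1" "vnorm d y \<le> 1" for x y
    using cmod_cinner_le[of d x y] mult_le_one[OF that(1) vnorm_nonneg that(2)] by linarith
  define c c' where "c = cinner d u v" and "c' = cinner d u' v'"
  have c1: "cmod c \<le> 1" "cmod c' \<le> 1" unfolding c_def c'_def using assms by (auto intro: cc)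
  have cd: "cmod (c - c') \<le> 2 * \<epsilon>" unfolding c_def c'_def using assms by (intro cinner_perturb)
  have "(vnorm d u)\<^sup>2 * (vnorm d v)\<^sup>2 - (vnorm d u')\<^sup>2 * (vnorm d v')\<^sup>2
      = ((vnorm d u)\<^sup>2 - (vnorm d u')\<^sup>2) * (vnorm d v)\<^sup>2 + (vnorm d u')\<^sup>2 * ((vnorm d v)\<^sup>2 - (vnorm d v')\<^sup>2)"
    by (simp add: algebra_simps)
  also have "\<dots> \<le> \<bar>(vnorm d u)\<^sup>2 - (vnorm d u')\<^sup>2\<bar> * (vnorm d v)\<^sup>2 + (vnorm d u')\<^sup>2 * \<bar>(vnorm d v)\<^sup>2 - (vnorm d v')\<^sup>2\<bar>"
    by (intro add_mono mult_left_mono mult_right_mono) auto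
  also have "\<dots> \<le> (2 * \<epsilon>) * 1 + 1 * (2 * \<epsilon>)"
    using assms e0 by (intro add_mono mult_mono sq le1) auto
  finally have 1: "(vnorm d u)\<^sup>2 * (vnorm d v)\<^sup>2 \<le> (vnorm d u')\<^sup>2 * (vnorm d v')\<^sup>2 + 4 * \<epsilon>" by simp
  have "Re (c\<^sup>2) - Re (c'\<^sup>2) \<le> cmod (c\<^sup>2 - c'\<^sup>2)" using complex_Re_le_cmod[of "c\<^sup>2 - c'\<^sup>2"] by simp
  also have "\<dots> = cmod (c + c') * cmod (c - c')" by (simp add: norm_mult[symmetric] power2_eq_square algebra_simps)
  also have "\<dots> \<le> 2 * (2 * \<epsilon>)" using c1 cd norm_triangle_ineq[of c c'] by (intro mult_mono) auto
  finally have 2: "Re (c\<^sup>2) \<le> Re (c'\<^sup>2) + 4 * \<epsilon>" by simp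
  have "\<bar>(Re c)\<^sup>2 - (Re c')\<^sup>2\<bar> \<le> 2 * 1 * (2 * \<epsilon>)"
    using c1 cd abs_Re_le_cmod[of c] abs_Re_le_cmod[of c'] abs_Re_le_cmod[of "c - c'"]
    by (intro abs_square_diff_le) auto
  then have 3: "(Re c)\<^sup>2 \<le> (Re c')\<^sup>2 + 4 * \<epsilon>" by linarith
  have m: "0 \<le> m4 gre / 2" "m4 gre / 2 \<le> 1" by (auto simp: m4_def)
  have "m4 gre / 2 * ((vnorm d u)\<^sup>2 * (vnorm d v)\<^sup>2 + Re (c\<^sup>2))
     \<le> m4 gre / 2 * (((vnorm d u')\<^sup>2 * (vnorm d v')\<^sup>2 + Re (c'\<^sup>2)) + 8 * \<epsilon>)"
    using 1 2 m(1) by (intro mult_left_mono) linarith+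
  also have "\<dots> \<le> m4 gre / 2 * ((vnorm d u')\<^sup>2 * (vnorm d v')\<^sup>2 + Re (c'\<^sup>2)) + 8 * \<epsilon>"
    using mult_right_mono[OF m(2), of "8 * \<epsilon>"] e0 unfolding distrib_left by linarith
  finally show ?thesis using 3 unfolding qform_def c_def[symmetric] c'_def[symmetric] by linarith
qed

text \<open>In each summand the real part is at most A and moves by at most 2 A \<epsilon>, so its
  square moves by at most 4 A^2 \<epsilon>; \<open>qform\<close> accounts for the remaining 12
  \<epsilon>.\<close>

lemma net_lower_bound:
  assumes A: "\<And>i. i < n \<Longrightarrow> (vnorm d (gvec gre w i))\<^sup>2 \<le> A" and n: "0 < n"
    and uv: "vnorm d u \<le> 1" "vnorm d v \<le> 1" "vnorm d u' \<le> 1" "vnorm d v' \<le> 1"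
      "vnorm d (\<lambda>j. u j - u' j) \<le> \<epsilon>" "vnorm d (\<lambda>j. v j - v' j) \<le> \<epsilon>"
    and net: "real n * (qform gre d u' v' - \<delta>) \<le> (\<Sum>i<n. (Re (gdot gre d w i u' * cnj (gdot gre d w i v')))\<^sup>2)"
  shows "real n * (qform gre d u v - \<delta> - (12 + 4 * A\<^sup>2) * \<epsilon>) \<le> (\<Sum>i<n. (Re (gdot gre d w i u * cnj (gdot gre d w i v)))\<^sup>2)"
proof -
  have e0: "0 \<le> \<epsilon>" using vnorm_nonneg[of d "\<lambda>j. u j - u' j"] uv(5) by linarith
  have pt: "(Re (gdot gre d w i u' * cnj (gdot gre d w i v')))\<^sup>2 - 4 * A\<^sup>2 * \<epsilon> \<le> (Re (gdot gre d w i u * cnj (gdot gre d w i v)))\<^sup>2"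
    if i: "i < n" for i
  proof -
    let ?a = "vnorm d (gvec gre w i)"
    let ?g = "gdot gre d w i"
    have aa: "?a * ?a \<le> A" using A[OF i] by (simp add: power2_eq_square)
    have g: "cmod (?g x) \<le> ?a" if "vnorm d x \<le> 1" for x
      using cmod_cinner_le[of d "gvec gre w i" x] mult_left_mono[OF that, of ?a] by simp
    have gd: "cmod (?g x - ?g x') \<le> ?a * \<epsilon>" if "vnorm d (\<lambda>j. x j - x' j) \<le> \<epsilon>" for x x'
      using cmod_cinner_le[of d "gvec gre w i" "\<lambda>j. x j - x' j"] mult_left_mono[OF that, of ?a] by (simp add: cinner_diff_right)
    have b: "\<bar>Re (?g x * cnj (?g y))\<bar> \<le> A" if "vnorm d x \<le> 1" "vnorm d y \<le> 1" for x y
    proof -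
      have "\<bar>Re (?g x * cnj (?g y))\<bar> \<le> cmod (?g x) * cmod (?g y)"
        using abs_Re_le_cmod[of "?g x * cnj (?g y)"] by (simp add: norm_mult)
      also have "\<dots> \<le> ?a * ?a" by (intro mult_mono g that) auto
      finally show ?thesis using aa by linarith
    qed
    have eq: "Re (?g u' * cnj (?g v')) - Re (?g u * cnj (?g v)) = Re (?g u' * cnj (?g v' - ?g v) + (?g u' - ?g u) * cnj (?g v))"
      by (simp add: algebra_simps)
    have "\<bar>Re (?g u' * cnj (?g v')) - Re (?g u * cnj (?g v))\<bar> \<le> cmod (?g u' * cnj (?g v' - ?g v) + (?g u' - ?g u) * cnj (?g v))"
      unfolding eq by (rule abs_Re_le_cmod)
    also have "\<dots> \<le> cmod (?g u') * cmod (?g v' - ?g v) + cmod (?g u' - ?g u) * cmod (?g v)"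
      using norm_triangle_ineq[of "?g u' * cnj (?g v' - ?g v)" "(?g u' - ?g u) * cnj (?g v)"]
      by (simp only: norm_mult complex_mod_cnj)
    also have "\<dots> \<le> ?a * (?a * \<epsilon>) + (?a * \<epsilon>) * ?a"
      using uv gd[of u u'] gd[of v v'] e0 by (intro add_mono mult_mono g) (auto simp: norm_minus_commute)
    also have "\<dots> = 2 * (?a * ?a) * \<epsilon>" by simp
    also have "\<dots> \<le> 2 * A * \<epsilon>" using aa e0 by (intro mult_right_mono mult_left_mono) auto
    finally have "\<bar>Re (?g u' * cnj (?g v')) - Re (?g u * cnj (?g v))\<bar> \<le> 2 * A * \<epsilon>" .
    from abs_square_diff_le[OF b[OF uv(3,4)] b[OF uv(1,2)] this]
    show ?thesis by (simp add: power2_eq_square[of A] abs_le_iff)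
  qed
  have "real n * (qform gre d u v - \<delta> - (12 + 4 * A\<^sup>2) * \<epsilon>) \<le> real n * (qform gre d u' v' - \<delta> - 4 * A\<^sup>2 * \<epsilon>)"
    using qform_perturb[OF uv, of gre] by (intro mult_left_mono) (auto simp: algebra_simps)
  also have "\<dots> \<le> (\<Sum>i<n. (Re (gdot gre d w i u' * cnj (gdot gre d w i v')))\<^sup>2 - 4 * A\<^sup>2 * \<epsilon>)"
    using net by (simp add: sum_subtractf algebra_simps)
  also have "\<dots> \<le> (\<Sum>i<n. (Re (gdot gre d w i u * cnj (gdot gre d w i v)))\<^sup>2)"
    by (intro sum_mono pt) auto
  finally show ?thesis .
qed

lemma vnorm_diff_sq:
  "(vnorm d (\<lambda>j. x j - y j))\<^sup>2 = (vnorm d x)\<^sup>2 - 2 * Re (cinner d x y) + (vnorm d y)\<^sup>2"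
  unfolding vnorm_sq cinner_def cmod_power2 Re_sum sum_distrib_left sum.distrib[symmetric] sum_subtractf[symmetric]
  by (intro sum.cong refl) (simp add: power2_eq_square algebra_simps)

lemma qform_scale:
  "qform gre d (\<lambda>j. complex_of_real a * u j) (\<lambda>j. complex_of_real b * v j) = a\<^sup>2 * b\<^sup>2 * qform gre d u v"
proof -
  have "cinner d (\<lambda>j. complex_of_real a * u j) (\<lambda>j. complex_of_real b * v j) = complex_of_real (a * b) * cinner d u v"
    by (simp only: cinner_scale_left cinner_scale_right complex_cnj_complex_of_real of_real_mult mult_ac)
  then show ?thesis
    by (simp add: qform_def vnorm_scale power_mult_distrib algebra_simps power2_eq_square)
qed

lemma gmeas_lower_condition:
  assumes n: "0 < n" and x: "x \<in> fvecs re d" and xs: "xs \<in> fvecs re d"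
    and low: "\<And>u v. u \<in> fvecs re d \<Longrightarrow> v \<in> fvecs re d \<Longrightarrow> vnorm d u \<le> 1 \<Longrightarrow> vnorm d v \<le> 1 \<Longrightarrow>
       real n * (qform gre d u v - 1 / 40) \<le> (\<Sum>i<n. (Re (gdot gre d w i u * cnj (gdot gre d w i v)))\<^sup>2)"
  shows "(1 / real n) * (\<Sum>i<n. (hs_inner d (gmeas re gre w i) (\<lambda>j k. outer x j k - outer xs j k))\<^sup>2)
      \<ge> (1 - 1 / 20) * (m4 gre * (frob d (\<lambda>j k. outer x j k - outer xs j k))\<^sup>2 + ((vnorm d x)\<^sup>2 - (vnorm d xs)\<^sup>2)\<^sup>2)"
proof -
  define c where "c = cinner d x xs"
  \<comment> \<open>The phase makes the inner product of \<open>x\<close> and \<open>y\<close> real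
    and nonnegative, so that of \<open>h\<close> and \<open>k\<close> becomes real. This is
    essential: in the complex model \<open>qform\<close> vanishes at v = i u.\<close>
  define s where "s = (if c = 0 then 1 else cnj c / complex_of_real (cmod c))"
  have s1: "cmod s = 1" by (simp add: s_def norm_divide)
  have sc: "s * c = complex_of_real (cmod c)"
    using complex_norm_square[of c] by (auto simp: s_def field_simps power2_eq_square)
  have Ims: "Im s = 0" if re
    using that x xs Im_cinner_real[of x d xs] by (simp add: s_def c_def)
  define y where "y = (\<lambda>j. s * xs j)"
  define h where "h = (\<lambda>j. x j - y j)"
  define k where "k = (\<lambda>j. x j + y j)"
  have y: "y \<in> fvecs re d" unfolding y_def by (intro fvecs_scale xs Ims)
  have h: "h \<in> fvecs re d" and k: "k \<in> fvecs re d" unfolding h_def k_def by (intro fvecs_diff fvecs_add x y)+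
  have ynorm: "vnorm d y = vnorm d xs" by (simp add: y_def vnorm_scale s1)
  have xy: "cinner d x y = complex_of_real (cmod c)" unfolding y_def cinner_scale_right c_def[symmetric] sc ..
  have yx: "cinner d y x = complex_of_real (cmod c)" using xy by (metis cnj_cinner complex_cnj_complex_of_real)
  have hk: "cinner d h k = complex_of_real ((vnorm d x)\<^sup>2 - (vnorm d y)\<^sup>2)"
    unfolding h_def k_def cinner_add_right cinner_diff_left xy yx by (simp add: cinner_self)
  have r: "hs_inner d (gmeas re gre w i) (\<lambda>j k. outer x j k - outer xs j k) = Re (gdot gre d w i h * cnj (gdot gre d w i k))" for i
  proof -
    have "hs_inner d (gmeas re gre w i) (\<lambda>j k. outer x j k - outer xs j k) = (cmod (gdot gre d w i x))\<^sup>2 - (cmod (gdot gre d w i xs))\<^sup>2"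
      unfolding hs_inner_diff_right hs_inner_outer bform_gmeas[OF x x] bform_gmeas[OF xs xs]
      by (simp only: complex_norm_square[symmetric] Re_complex_of_real)
    also have "cmod (gdot gre d w i xs) = cmod (gdot gre d w i y)"
      by (simp add: y_def cinner_scale_right norm_mult s1)
    also have "(cmod (gdot gre d w i x))\<^sup>2 - (cmod (gdot gre d w i y))\<^sup>2 = Re (gdot gre d w i h * cnj (gdot gre d w i k))"
      unfolding h_def k_def cinner_add_right cinner_diff_right cmod_power2 by (simp add: power2_eq_square algebra_simps)
    finally show ?thesis .
  qed
  have G: "m4 gre * (frob d (\<lambda>j k. outer x j k - outer xs j k))\<^sup>2 + ((vnorm d x)\<^sup>2 - (vnorm d xs)\<^sup>2)\<^sup>2 = qform gre d h k"
  proof -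
    define a e where "a = (vnorm d x)\<^sup>2" and "e = (vnorm d xs)\<^sup>2"
    have hk_norms: "(vnorm d h)\<^sup>2 = a - 2 * cmod c + e" "(vnorm d k)\<^sup>2 = a + 2 * cmod c + e"
      unfolding h_def k_def vnorm_diff_sq vnorm_add_sq xy ynorm by (simp_all add: a_def e_def)
    have hk': "cinner d h k = complex_of_real (a - e)" unfolding hk ynorm a_def e_def ..
    show ?thesis
      unfolding qform_def hk_norms hk' frob_diff_outer_sq c_def[symmetric] a_def[symmetric] e_def[symmetric]
      by (simp only: of_real_power[symmetric] Re_complex_of_real) (simp add: power2_eq_square field_simps)
  qed
  have m: "1 \<le> m4 gre" by (simp add: m4_def)
  have "real n * ((1 - 1 / 20) * qform gre d h k) \<le> (\<Sum>i<n. (Re (gdot gre d w i h * cnj (gdot gre d w i k)))\<^sup>2)"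
  proof (cases "vnorm d h = 0 \<or> vnorm d k = 0")
    case True
    then have "cinner d h k = 0" using cmod_cinner_le[of d h k] by auto
    then have "qform gre d h k = 0" using True by (auto simp: qform_def)
    then show ?thesis by (simp add: sum_nonneg)
  next
    case False
    define H K where "H = vnorm d h" and "K = vnorm d k"
    have HK: "0 < H" "0 < K" using False by (auto simp: H_def K_def less_le)
    define u where "u = (\<lambda>j. complex_of_real (1 / H) * h j)"
    define v where "v = (\<lambda>j. complex_of_real (1 / K) * k j)"
    have uf: "u \<in> fvecs re d" "v \<in> fvecs re d" unfolding u_def v_def by (intro fvecs_scale h k; simp)+
    have un: "vnorm d u = 1" "vnorm d v = 1"
      unfolding u_def v_def vnorm_scale norm_of_real using HK by (simp_all add: H_def K_def)
    have hu: "h = (\<lambda>j. complex_of_real H * u j)" "k = (\<lambda>j. complex_of_real K * v j)"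
      using HK by (auto simp: u_def v_def)
    have q: "qform gre d h k = H\<^sup>2 * K\<^sup>2 * qform gre d u v" unfolding hu by (rule qform_scale)
    have g: "(Re (gdot gre d w i h * cnj (gdot gre d w i k)))\<^sup>2 = H\<^sup>2 * K\<^sup>2 * (Re (gdot gre d w i u * cnj (gdot gre d w i v)))\<^sup>2" for i
      unfolding hu cinner_scale_right by (simp add: power2_eq_square algebra_simps)
    have e: "cinner d h k = complex_of_real (H * K) * cinner d u v"
      unfolding hu by (simp only: cinner_scale_left cinner_scale_right complex_cnj_complex_of_real of_real_mult mult_ac)
    have "Im (complex_of_real (H * K) * cinner d u v) = 0"
      unfolding e[symmetric] hk by (rule Im_complex_of_real)
    then have "Im (cinner d u v) = 0" using HK by simp
    \<comment> \<open>Reality of the inner product gives \<open>qform\<close> at least 1/2 on the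
      normalised pair, so the additive error 1/40 is at most 1/20 of it.\<close>
    then have "0 \<le> Re ((cinner d u v)\<^sup>2)" by (simp add: power2_eq_square)
    then have "m4 gre / 2 * 1 \<le> m4 gre / 2 * (1 + Re ((cinner d u v)\<^sup>2))" using m by (intro mult_left_mono) auto
    then have "1 / 2 \<le> qform gre d u v" unfolding qform_def un power_one mult_1_left
      using m zero_le_power2[of "Re (cinner d u v)"] by linarith
    then have "real n * ((1 - 1 / 20) * qform gre d u v) \<le> real n * (qform gre d u v - 1 / 40)"
      by (intro mult_left_mono) auto
    also have "\<dots> \<le> (\<Sum>i<n. (Re (gdot gre d w i u * cnj (gdot gre d w i v)))\<^sup>2)"
      using un by (intro low uf) auto
    finally have "H\<^sup>2 * K\<^sup>2 * (real n * ((1 - 1 / 20) * qform gre d u v)) \<le> H\<^sup>2 * K\<^sup>2 * (\<Sum>i<n. (Re (gdot gre d w i u * cnj (gdot gre d w i v)))\<^sup>2)"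
      by (rule mult_left_mono) simp
    then show ?thesis unfolding g q by (simp add: sum_distrib_left[symmetric] mult_ac)
  qed
  then show ?thesis unfolding G r using n by (simp add: field_simps)
qed

section \<open>Arithmetic for large n\<close>

lemma exists_large_threshold:
  "\<exists>N0::nat. \<forall>n\<ge>N0. 1 \<le> ln (real n) \<and> 2^48 * (ln (real n))\<^sup>2 \<le> real n \<and> 2^62 * ln (real n) \<le> real n"
\<comment> \<open>With q the fourth root of n, ln n <= 4q. The square condition then asks for 2^52
  q^2 <= q^4, that is q >= 2^26, and 2^104 is the fourth power of 2^26.\<close>
proof (intro exI[of _ "2^104"] allI impI)
  fix n :: nat assume "2^104 \<le> n"
  then have "real (2^104) \<le> real n" by (simp only: of_nat_le_iff)
  then have n: "2^104 \<le> real n" by simp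
  define q where "q = sqrt (sqrt (real n))"
  have q4: "q ^ 4 = real n"
  proof -
    have "q ^ 4 = (q\<^sup>2)\<^sup>2" by simp
    then show ?thesis by (simp add: q_def)
  qed
  have q26: "2^26 \<le> q"
  proof (rule power_le_imp_le_base)
    show "(2^26) ^ Suc 3 \<le> q ^ Suc 3" using q4 n by (simp add: numeral_eq_Suc[symmetric] flip: power_mult)
  qed (simp add: q_def)
  then have q0: "0 < q" by (smt (verit) zero_less_power)
  have ln: "ln (real n) \<le> 4 * q"
  proof -
    have "ln (real n) = 4 * ln q" using q0 by (simp flip: q4 add: ln_realpow)
    also have "\<dots> \<le> 4 * q" using ln_le_minus_one[OF q0] by simp
    finally show ?thesis .
  qed
  have "exp (1::real) \<le> 2^104" using exp_le by simp
  then have "exp 1 \<le> real n" using n by linarith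
  then have one: "1 \<le> ln (real n)" using n by (subst ln_ge_iff) auto
  have "2^48 * (ln (real n))\<^sup>2 \<le> 2^48 * (4 * q)\<^sup>2"
    using ln one by (intro mult_left_mono power_mono) auto
  also have "\<dots> = 2^52 * q\<^sup>2" by (simp add: power_mult_distrib)
  also have "\<dots> = (2^26)\<^sup>2 * q\<^sup>2" by simp
  also have "\<dots> \<le> q\<^sup>2 * q\<^sup>2" using q26 by (intro mult_right_mono power_mono) auto
  also have "\<dots> = real n" by (simp flip: q4 power_add)
  finally have sq: "2^48 * (ln (real n))\<^sup>2 \<le> real n" .
  have "2^62 * ln (real n) \<le> 2^62 * (4 * q)" using ln by (intro mult_left_mono) auto
  also have "\<dots> \<le> (2^26)^3 * q" using q0 by simp
  also have "\<dots> \<le> q ^ 3 * q" using q26 q0 by (intro mult_right_mono power_mono) auto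
  also have "\<dots> = real n" by (simp flip: q4 add: power4_eq_xxxx power3_eq_cube)
  finally show "1 \<le> ln (real n) \<and> 2^48 * (ln (real n))\<^sup>2 \<le> real n \<and> 2^62 * ln (real n) \<le> real n"
    using one sq by blast
qed

text \<open>If the claim failed, ln n <= 2 sqrt n would give sqrt n < 2 C d, so ln n is at most 2 ln
  (2C) + 2 ln d. For d >= 2 the constant is absorbed by 2 ln d >= 1. For d = 1 the hypothesis
  \<open>le\<close> is void and the assumption on \<open>n\<close> alone takes over.\<close>

lemma d_ln_d_imp_d_ln_n:
  fixes C :: real
  assumes C: "1 \<le> C" and n: "0 < n" "C * ln (real n) \<le> real n"
    and d: "1 \<le> d" and le: "C * (2 + 4 * ln (2 * C)) * real d * ln (real d) \<le> real n"
  shows "C * real d * ln (real n) \<le> real n"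
proof (cases "d = 1")
  case True then show ?thesis using n by simp
next
  case False
  then have d2: "2 \<le> real d" using d by simp
  show ?thesis
  proof (rule ccontr)
    assume "\<not> C * real d * ln (real n) \<le> real n"
    then have lt: "real n < C * real d * ln (real n)" by simp
    have n0: "0 < real n" using n by simp
    define q where "q = sqrt (real n)"
    have q: "0 < q" "q\<^sup>2 = real n" using n0 by (auto simp: q_def)
    have "ln (real n) = 2 * ln q" using q(1) by (simp flip: q(2) add: ln_realpow)
    also have "\<dots> \<le> 2 * q" using ln_le_minus_one[OF q(1)] by simp
    finally have "ln (real n) \<le> 2 * q" .
    then have "C * real d * ln (real n) \<le> C * real d * (2 * q)"
      using C by (intro mult_left_mono) auto
    with lt q have "q * q < (C * real d * 2) * q" by (simp add: power2_eq_square)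
    then have "q < C * real d * 2" using q(1) by (simp only: mult_less_cancel_right_pos)
    then have "ln q < ln (2 * C * real d)" using q(1) by (subst ln_less_cancel_iff) (auto simp: mult_ac)
    also have "ln (2 * C * real d) = ln (2 * C) + ln (real d)" using C d by (subst ln_mult) auto
    finally have lnn: "ln (real n) \<le> 2 * ln (2 * C) + 2 * ln (real d)"
      using \<open>ln (real n) = 2 * ln q\<close> by simp
    have "1 / 2 \<le> ln (real d)"
    proof -
      have "1 - 1 / 2 \<le> ln (2::real)" using ln_ge_iff[of 2] ln_one_minus_pos_upper_bound[of "1/2"]
        by (simp add: ln_div)
      also have "\<dots> \<le> ln (real d)" using d2 by simp
      finally show ?thesis by simp
    qed
    moreover have "0 \<le> ln (2 * C)" using C by simp
    ultimately have "2 * ln (2 * C) * 1 \<le> 2 * ln (2 * C) * (2 * ln (real d))" by (intro mult_left_mono) auto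
    with lnn have "ln (real n) \<le> (2 + 4 * ln (2 * C)) * ln (real d)" by (simp add: algebra_simps)
    then have "C * real d * ln (real n) \<le> C * real d * ((2 + 4 * ln (2 * C)) * ln (real d))"
      using C by (intro mult_left_mono) auto
    also have "\<dots> = C * (2 + 4 * ln (2 * C)) * real d * ln (real d)" by (simp only: mult_ac)
    finally show False using lt le by linarith
  qed
qed

section \<open>The Gaussian measurement ensemble\<close>

text \<open>For \<open>xs = 0\<close> the normalised vector \<open>x1\<close> is \<open>0\<close>, since \<open>1 / 0 = 0\<close>; no case distinction is needed.\<close>

lemma good_sample_imp_part1_conditions:
  fixes xs :: "nat \<Rightarrow> complex" and d :: nat
  defines "x1 \<equiv> \<lambda>j. complex_of_real (1 / vnorm d xs) * xs j"
  assumes d: "1 \<le> d" "d \<le> n" and n: "1 \<le> n" and xs: "xs \<in> fvecs re d"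
    and T: "T \<le> 32 * real n"
    and upper: "\<And>v. v \<in> grid re d (1 / (100 * sqrt (2 * real d))) \<Longrightarrow>
      (\<Sum>i<n. if (cmod (gdot gre d w i x1))\<^sup>2 \<le> T then (cmod (gdot gre d w i x1))\<^sup>2 * (cmod (gdot gre d w i v))\<^sup>2 else 0)
        \<le> real n * (1 + m4 gre + 1 / 30)"
    and lower: "\<And>u v. u \<in> grid re d (1 / (10^6 * real n ^ 5)) \<Longrightarrow> v \<in> grid re d (1 / (10^6 * real n ^ 5)) \<Longrightarrow>
      real n * (qform gre d u v - 1 / 80) \<le> (\<Sum>i<n. (Re (gdot gre d w i u * cnj (gdot gre d w i v)))\<^sup>2)"
    and trunc: "\<And>i. i < n \<Longrightarrow> (cmod (gdot gre d w i x1))\<^sup>2 \<le> T"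
    and entries: "\<And>i j. i < n \<Longrightarrow> j < d \<Longrightarrow> (cmod (gvec gre w i j))\<^sup>2 \<le> T"
  shows "part1_conditions re d n (gmeas re gre w) xs (m4 gre) (1 / 20) (1 / 10)"
proof -
  have m: "1 \<le> m4 gre" "m4 gre \<le> 2" by (auto simp: m4_def)
  have n1: "1 \<le> real n" using n by simp
  have xs_eq: "xs = (\<lambda>j. complex_of_real (vnorm d xs) * x1 j)"
  proof (cases "vnorm d xs = 0")
    case True
    then have "xs j = 0" for j using xs by (cases "j < d") (auto simp: vnorm_eq_0_iff fvecs_def)
    then show ?thesis by (auto simp: x1_def)
  qed (auto simp: x1_def)
  have z: "meas d (gmeas re gre w) (outer xs) = (\<lambda>i. (vnorm d xs)\<^sup>2 * (cmod (gdot gre d w i x1))\<^sup>2)"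
  proof
    fix i
    have "meas d (gmeas re gre w) (outer xs) i = (cmod (gdot gre d w i xs))\<^sup>2"
      unfolding meas_def hs_inner_outer bform_gmeas[OF xs xs]
      by (simp only: complex_norm_square[symmetric] Re_complex_of_real)
    also have "cmod (gdot gre d w i xs) = vnorm d xs * cmod (gdot gre d w i x1)"
      by (subst xs_eq) (simp add: cinner_scale_right norm_mult)
    finally show "meas d (gmeas re gre w) (outer xs) i = (vnorm d xs)\<^sup>2 * (cmod (gdot gre d w i x1))\<^sup>2"
      by (simp add: power_mult_distrib)
  qed
  define b where "b = sqrt (real n * (1 + m4 gre + 1 / 30))"
  have b0: "0 \<le> b" and b2: "b\<^sup>2 = real n * (1 + m4 gre + 1 / 30)" using m by (auto simp: b_def)
  define \<eta>0 where "\<eta>0 = 1 / (100 * sqrt (2 * real d))"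
  have sd: "0 < sqrt (2 * real d)" using d by simp
  then have \<eta>0: "0 < \<eta>0" "\<eta>0 * sqrt (2 * real d) = 1 / 100" by (simp_all add: \<eta>0_def field_simps)
  have form: "(\<Sum>i<n. (cmod (gdot gre d w i x1))\<^sup>2 * (cmod (gdot gre d w i v))\<^sup>2) \<le> (b / (1 - 1 / 100))\<^sup>2 * (vnorm d v)\<^sup>2"
    if v: "v \<in> fvecs re d" for v
  proof (rule net_seminorm_bound[where N = "grid re d \<eta>0" and re = re, OF _ b0 _ _ _ _ v])
    fix v assume "v \<in> grid re d \<eta>0"
    have "(\<Sum>i<n. (cmod (gdot gre d w i x1))\<^sup>2 * (cmod (gdot gre d w i v))\<^sup>2)
       = (\<Sum>i<n. if (cmod (gdot gre d w i x1))\<^sup>2 \<le> T then (cmod (gdot gre d w i x1))\<^sup>2 * (cmod (gdot gre d w i v))\<^sup>2 else 0)"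
      by (intro sum.cong) (auto simp: trunc)
    also have "\<dots> \<le> b\<^sup>2" unfolding b2 using \<open>v \<in> grid re d \<eta>0\<close> by (intro upper) (simp add: \<eta>0_def)
    finally show "(\<Sum>i<n. (cmod (gdot gre d w i x1))\<^sup>2 * (cmod (gdot gre d w i v))\<^sup>2) \<le> b\<^sup>2" .
  next
    fix v assume "v \<in> fvecs re d" "vnorm d v \<le> 1"
    from grid_approx[OF \<eta>0(1) this] obtain v' where "v' \<in> grid re d \<eta>0" "vnorm d (\<lambda>j. v j - v' j) \<le> 1 / 100"
      unfolding \<eta>0(2) .
    then show "\<exists>v'\<in>grid re d \<eta>0. v' \<in> fvecs re d \<and> vnorm d (\<lambda>j. v j - v' j) \<le> 1 / 100"
      by (auto simp: grid_def)
  qed auto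
  \<comment> \<open>The net distance 1/100 costs the factor 10000/9801; the slack between 1/30 and
    1/10 pays for it, since \<open>m4 gre\<close> is at most 2.\<close>
  have bb: "(b / (1 - 1 / 100))\<^sup>2 \<le> real n * (1 + m4 gre + 1 / 10)"
  proof -
    have "(b / (1 - 1 / 100))\<^sup>2 = real n * ((1 + m4 gre + 1 / 30) * (10000 / 9801))"
      unfolding power_divide b2 by (simp add: power2_eq_square)
    also have "\<dots> \<le> real n * (1 + m4 gre + 1 / 10)" using m by (intro mult_left_mono) auto
    finally show ?thesis .
  qed
  let ?B = "real n * ((1 + m4 gre + 1 / 10) * (vnorm d xs)\<^sup>2)"
  have "op_norm re d (adj d n (gmeas re gre w) (meas d (gmeas re gre w) (outer xs))) \<le> ?B"
  proof (rule op_norm_gmeas_le[OF d(1)])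
    fix v assume v: "v \<in> fvecs re d"
    have "(\<Sum>i<n. meas d (gmeas re gre w) (outer xs) i * (cmod (gdot gre d w i v))\<^sup>2)
       = (vnorm d xs)\<^sup>2 * (\<Sum>i<n. (cmod (gdot gre d w i x1))\<^sup>2 * (cmod (gdot gre d w i v))\<^sup>2)"
      unfolding z by (simp add: sum_distrib_left mult.assoc)
    also have "\<dots> \<le> (vnorm d xs)\<^sup>2 * ((real n * (1 + m4 gre + 1 / 10)) * (vnorm d v)\<^sup>2)"
      using order_trans[OF form[OF v] mult_right_mono[OF bb]] by (intro mult_left_mono) auto
    finally show "(\<Sum>i<n. meas d (gmeas re gre w) (outer xs) i * (cmod (gdot gre d w i v))\<^sup>2) \<le> ?B * (vnorm d v)\<^sup>2"
      by (simp only: mult_ac)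
  qed (use m in \<open>auto simp: z\<close>)
  then have c1: "(1 / real n) * op_norm re d (adj d n (gmeas re gre w) (meas d (gmeas re gre w) (outer xs))) \<le> (1 + m4 gre + 1 / 10) * (vnorm d xs)\<^sup>2"
    using n1 by (simp add: field_simps)
  \<comment> \<open>Each of the d <= n squared entries of a sample vector is at most T <= 32
    n.\<close>
  define A where "A = 32 * (real n)\<^sup>2"
  have A: "(vnorm d (gvec gre w i))\<^sup>2 \<le> A" if i: "i < n" for i
  proof -
    have "(vnorm d (gvec gre w i))\<^sup>2 \<le> (\<Sum>j<d. T)" unfolding vnorm_sq by (intro sum_mono entries i) auto
    also have "\<dots> = real d * T" by simp
    also have "\<dots> \<le> real d * (32 * real n)" using T by (intro mult_left_mono) auto
    also have "\<dots> \<le> real n * (32 * real n)" using d by (intro mult_right_mono) auto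
    finally show ?thesis by (simp add: A_def power2_eq_square)
  qed
  \<comment> \<open>One power of n pays for sqrt (2d) <= 2n; the other four cancel 4 A^2 = 4096 n^4,
    leaving an error of at most 8216/10^6 < 1/80.\<close>
  define \<eta> where "\<eta> = 1 / (10^6 * real n ^ 5)"
  define \<epsilon> where "\<epsilon> = 2 / (10^6 * real n ^ 4)"
  have \<eta>: "0 < \<eta>" using n1 by (simp add: \<eta>_def)
  have \<epsilon>: "\<eta> * sqrt (2 * real d) \<le> \<epsilon>"
  proof -
    have "2 * real d \<le> 4 * real n" using d by simp
    also have "\<dots> \<le> 4 * (real n * real n)" using mult_left_mono[OF n1, of "real n"] by simp
    finally have "2 * real d \<le> (2 * real n)\<^sup>2" by (simp add: power2_eq_square)
    then have "sqrt (2 * real d) \<le> 2 * real n" by (intro real_le_lsqrt) auto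
    then have "\<eta> * sqrt (2 * real d) \<le> \<eta> * (2 * real n)" using \<eta> by (intro mult_left_mono) auto
    also have "\<dots> = \<epsilon>" using n1 by (simp add: \<eta>_def \<epsilon>_def field_simps power_numeral_reduce)
    finally show ?thesis .
  qed
  have small: "(12 + 4 * A\<^sup>2) * \<epsilon> \<le> 1 / 80"
  proof -
    have n4: "1 \<le> real n ^ 4" using n1 by simp
    have "12 + 4 * A\<^sup>2 = 12 + 4096 * real n ^ 4" by (simp add: A_def power_mult_distrib flip: power_mult)
    also have "\<dots> \<le> 4108 * real n ^ 4" using n4 by simp
    finally have "(12 + 4 * A\<^sup>2) * \<epsilon> \<le> 4108 * real n ^ 4 * \<epsilon>" by (rule mult_right_mono) (simp add: \<epsilon>_def)
    also have "\<dots> = 8216 / 10^6" using n1 by (simp add: \<epsilon>_def)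
    finally show ?thesis by simp
  qed
  have low: "real n * (qform gre d u v - 1 / 40) \<le> (\<Sum>i<n. (Re (gdot gre d w i u * cnj (gdot gre d w i v)))\<^sup>2)"
    if uv: "u \<in> fvecs re d" "v \<in> fvecs re d" "vnorm d u \<le> 1" "vnorm d v \<le> 1" for u v
  proof -
    from grid_approx[OF \<eta> uv(1,3)] obtain u' where u': "u' \<in> grid re d \<eta>" "vnorm d (\<lambda>j. u j - u' j) \<le> \<eta> * sqrt (2 * real d)" .
    from grid_approx[OF \<eta> uv(2,4)] obtain v' where v': "v' \<in> grid re d \<eta>" "vnorm d (\<lambda>j. v j - v' j) \<le> \<eta> * sqrt (2 * real d)" .
    have "real n * (qform gre d u v - 1 / 80 - (12 + 4 * A\<^sup>2) * \<epsilon>) \<le> (\<Sum>i<n. (Re (gdot gre d w i u * cnj (gdot gre d w i v)))\<^sup>2)"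
    proof (rule net_lower_bound[OF A _ uv(3,4)])
      show "vnorm d u' \<le> 1" "vnorm d v' \<le> 1" using u' v' by (auto simp: grid_def)
      show "vnorm d (\<lambda>j. u j - u' j) \<le> \<epsilon>" "vnorm d (\<lambda>j. v j - v' j) \<le> \<epsilon>" using u' v' \<epsilon> by auto
      show "real n * (qform gre d u' v' - 1 / 80) \<le> (\<Sum>i<n. (Re (gdot gre d w i u' * cnj (gdot gre d w i v')))\<^sup>2)"
        using lower u'(1) v'(1) unfolding \<eta>_def by blast
    qed (use n in auto)
    moreover have "real n * (qform gre d u v - 1 / 40) \<le> real n * (qform gre d u v - 1 / 80 - (12 + 4 * A\<^sup>2) * \<epsilon>)"
      using small by (intro mult_left_mono) auto
    ultimately show ?thesis by linarith
  qed
  have c2: "(1 / real n) * (\<Sum>i<n. (hs_inner d (gmeas re gre w i) (\<lambda>j k. outer x j k - outer xs j k))\<^sup>2)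
      \<ge> (1 - 1 / 20) * (m4 gre * (frob d (\<lambda>j k. outer x j k - outer xs j k))\<^sup>2 + ((vnorm d x)\<^sup>2 - (vnorm d xs)\<^sup>2)\<^sup>2)"
    if "x \<in> fvecs re d" for x
    using n by (intro gmeas_lower_condition[OF _ that xs low]) auto
  \<comment> \<open>Tightest for m = 1, where it reads 1 > 9/20 + 4/10.\<close>
  have c3: "(m4 gre)\<^sup>2 + 2 * m4 gre - 2 > 3 * ((m4 gre)\<^sup>2 + 2 * m4 gre) * (1 / 20) + 2 * (m4 gre + 1) * (1 / 10)"
    by (simp add: m4_def)
  show ?thesis
    unfolding part1_conditions_def using c1 c2 c3 m by auto
qed

lemma (in prob_space) prob_UN_le:
  assumes "finite I" "\<And>i. i \<in> I \<Longrightarrow> A i \<in> events" "\<And>i. i \<in> I \<Longrightarrow> prob (A i) \<le> p"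
  shows "prob (\<Union>i\<in>I. A i) \<le> real (card I) * p"
proof -
  have "prob (\<Union>i\<in>I. A i) \<le> (\<Sum>i\<in>I. prob (A i))"
    using assms by (intro finite_measure_subadditive_finite) auto
  also have "\<dots> \<le> real (card I) * p" using assms by (intro sum_bounded_above) auto
  finally show ?thesis .
qed

lemma two_power_le_exp: "2 ^ k \<le> exp (real k)"
proof -
  have "(2::real) ^ k \<le> exp 1 ^ k" using exp_ge_add_one_self[of 1] by (intro power_mono) auto
  then show ?thesis by (simp add: exp_of_nat_mult[symmetric])
qed

text \<open>The failure probability splits as 1 + 1 + 2 + 2 in units of 1/n^2: the two nets,
  truncation of the weights, and the size of the entries.\<close>

lemma gauss_part1_conditions_whp:
  assumes gre: "gre \<Longrightarrow> re" and d: "1 \<le> d" and xs: "xs \<in> fvecs re d"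
    and ln1: "1 \<le> ln (real n)" and H1: "2^62 * real d * ln (real n) \<le> real n"
    and H2: "2^48 * (ln (real n))\<^sup>2 \<le> real n"
  shows "\<exists>E \<in> sets (gauss_space gre d n).
     E \<subseteq> {w \<in> space (gauss_space gre d n). \<exists>dL dU. part1_conditions re d n (gmeas re gre w) xs (m4 gre) dL dU} \<and>
     measure (gauss_space gre d n) E \<ge> 1 - 6 / (real n)\<^sup>2"
proof -
  let ?M = "gauss_space gre d n"
  interpret prob_space ?M by (rule prob_space_gauss)
  define l where "l = ln (real n)"
  have l1: "1 \<le> l" using ln1 by (simp add: l_def)
  have n0: "0 < real n" using ln1 by (cases "n = 0") auto
  have expl: "exp l = real n" using n0 by (simp add: l_def)
  have d1: "1 \<le> real d" using d by simp
  have big: "2^62 \<le> real n"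
  proof -
    have "2^62 * 1 * 1 \<le> 2^62 * real d * l" using d1 l1 by (intro mult_mono) auto
    with H1 show ?thesis by (simp add: l_def)
  qed
  have ln_le: "l \<le> real n" using ln_le_minus_one[OF n0] by (simp add: l_def)
  have dn: "d \<le> n"
  proof -
    have "1 * real d * 1 \<le> 2^62 * real d * l" using d1 l1 by (intro mult_mono) auto
    with H1 have "real d \<le> real n" by (simp add: l_def)
    then show ?thesis by simp
  qed
  \<comment> \<open>Makes each tail at most 2/n^4, so even a union over n d <= n^2 entries costs
    only 2/n^2.\<close>
  define T where "T = 32 * l"
  have expT: "exp (- T / 8) = 1 / real n ^ 4"
  proof -
    have "exp (- T / 8) = exp (- (4 * l))" by (simp add: T_def)
    also have "\<dots> = 1 / exp l ^ 4" using exp_of_nat_mult[of 4 l] by (simp add: exp_minus field_simps)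
    finally show ?thesis by (simp add: expl)
  qed
  have exp2: "exp (- 2 * l) = 1 / (real n)\<^sup>2"
    using exp_of_nat_mult[of 2 l] by (simp add: exp_minus expl field_simps)
  \<comment> \<open>Real samples occur only with F = R, so all test vectors are real whenever the
    moment formulas demand it.\<close>
  have real: "u \<in> fvecs True d" if "u \<in> fvecs re d" gre for u using that gre by simp
  have [measurable]: "(\<lambda>w. gdot gre d w i u) \<in> borel_measurable ?M" if "i < n" for i u
    unfolding gauss_space_eq by (rule measurable_gdot[OF row_subset[OF that]])

  define x1 where "x1 = (\<lambda>j. complex_of_real (1 / vnorm d xs) * xs j)"
  have x1: "x1 \<in> fvecs re d" unfolding x1_def by (rule fvecs_scale[OF xs]) simp
  have x1n: "vnorm d x1 \<le> 1"
    unfolding x1_def vnorm_scale norm_of_real by (cases "vnorm d xs = 0") auto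
  \<comment> \<open>Basis vectors turn the entries of the samples into linear forms, to which
    \<open>gdot_tail\<close> applies.\<close>
  define e where "e = (\<lambda>(j::nat) (l::nat). if l = j then 1 else (0::complex))"
  have e: "e j \<in> fvecs re d" "vnorm d (e j) \<le> 1" "cmod (gdot gre d w i (e j)) = cmod (gvec gre w i j)" if "j < d" for j w i
  proof -
    show "e j \<in> fvecs re d" using that by (auto simp: e_def fvecs_def)
    have "(\<Sum>l<d. (cmod (e j l))\<^sup>2) = (\<Sum>l<d. if l = j then 1 else 0)" by (intro sum.cong) (auto simp: e_def)
    then show "vnorm d (e j) \<le> 1" using that by (simp add: vnorm_def)
    have "gdot gre d w i (e j) = (\<Sum>l<d. if l = j then cnj (gvec gre w i l) else 0)"
      unfolding cinner_def by (intro sum.cong) (auto simp: e_def)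
    then show "cmod (gdot gre d w i (e j)) = cmod (gvec gre w i j)" using that by simp
  qed

  define N0 where "N0 = grid re d (1 / (100 * sqrt (2 * real d)))"
  define N1 where "N1 = grid re d (1 / (10^6 * real n ^ 5))"
  have fin: "finite N0" "finite N1" unfolding N0_def N1_def using d1 n0 by (intro finite_grid; simp)+
  define S1 where "S1 v = {w\<in>space ?M. real n * (1 + m4 gre + 1 / 30) < (\<Sum>i<n. if (cmod (gdot gre d w i x1))\<^sup>2 \<le> T
      then (cmod (gdot gre d w i x1))\<^sup>2 * (cmod (gdot gre d w i v))\<^sup>2 else 0)}" for v
  define S2 where "S2 = (\<lambda>(u, v). {w\<in>space ?M. (\<Sum>i<n. (Re (gdot gre d w i u * cnj (gdot gre d w i v)))\<^sup>2) \<le> real n * (qform gre d u v - 1 / 80)})"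
  define S3 where "S3 u i = {w\<in>space ?M. T < (cmod (gdot gre d w i u))\<^sup>2}" for u i
  have S1m: "S1 v \<in> events" for v
    unfolding S1_def by measurable
  have S2m: "S2 p \<in> events" for p
    unfolding S2_def case_prod_beta times_complex.sel cnj.sel by measurable
  have S3m: "S3 u i \<in> events" if "i < n" for u i
    unfolding S3_def using that by measurable

  have P1: "prob (\<Union>v\<in>N0. S1 v) \<le> 1 / (real n)\<^sup>2"
  proof -
    \<comment> \<open>Scaled by 1 / ln n so that \<open>?l * T\<close> = 2^-35 stays below 1/32,
      while \<open>?l * 2^25\<close> is at most 2^-15, below half of the deviation 1/30.\<close>
    let ?l = "1 / (2^40 * l)"
    have "prob (S1 v) \<le> exp (- real n * ?l * (1 / 30) / 2)" if v: "v \<in> N0" for v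
      unfolding S1_def
    proof (rule gdot_product_upper_tail[OF _ _ x1n _ d])
      show "gre \<Longrightarrow> x1 \<in> fvecs True d" using real[OF x1] .
      show "gre \<Longrightarrow> v \<in> fvecs True d" using real v by (auto simp: N0_def grid_def)
      show "vnorm d v \<le> 1" using v by (simp add: N0_def grid_def)
    qed (use l1 in \<open>auto simp: T_def field_simps\<close>)
    then have "prob (\<Union>v\<in>N0. S1 v) \<le> real (card N0) * exp (- real n * ?l * (1 / 30) / 2)"
      by (intro prob_UN_le fin S1m)
    also have "real (card N0) \<le> exp (20004 * real d)"
    proof -
      \<comment> \<open>For this mesh, 1/\<eta>^2 is exactly 20000 d.\<close>
      have "real (card N0) \<le> 2 ^ (20000 * d) * 3 ^ (2 * d)"
        unfolding N0_def using d1 by (intro card_grid_le_coarse) (auto simp: power_divide power_mult_distrib)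
      also have "(3::real) ^ (2 * d) \<le> 2 ^ (4 * d)" unfolding power_mult by (intro power_mono) auto
      also have "(2::real) ^ (20000 * d) * 2 ^ (4 * d) = 2 ^ (20004 * d)" by (simp flip: power_add)
      also have "\<dots> \<le> exp (real (20004 * d))" by (rule two_power_le_exp)
      finally show ?thesis by simp
    qed
    also have "exp (20004 * real d) * exp (- real n * ?l * (1 / 30) / 2) \<le> exp (- 2 * l)"
    proof -
      \<comment> \<open>\<open>H1\<close> makes \<open>X\<close> at least 2^15 d, which exceeds
        20004 d; \<open>H2\<close> makes it at least 2 ln n. The available exponent is at least 2
        \<open>X\<close>.\<close>
      define X where "X = real n / (2^47 * l)"
      have "2^15 * real d \<le> X" using H1 l1 by (simp add: X_def l_def field_simps)
      moreover have "2 * l \<le> X" using H2 l1 by (simp add: X_def l_def field_simps power2_eq_square)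
      ultimately have "20004 * real d + 2 * l \<le> X * 2" using d1 by simp
      also have "\<dots> = real n / (2^40 * l) / 64" by (simp add: X_def)
      also have "\<dots> \<le> real n / (2^40 * l) / 60" using n0 l1 by (intro divide_left_mono) auto
      also have "\<dots> = real n * ?l * (1 / 30) / 2" by simp
      finally have "20004 * real d + 2 * l \<le> real n * ?l * (1 / 30) / 2" .
      then show ?thesis by (simp add: exp_add[symmetric])
    qed
    finally show ?thesis unfolding exp2 by simp
  qed

  have P2: "prob (\<Union>p\<in>N1 \<times> N1. S2 p) \<le> 1 / (real n)\<^sup>2"
  proof -
    have "prob (S2 p) \<le> exp (- real n * (1 / 80)\<^sup>2 / 2^26)" if "p \<in> N1 \<times> N1" for p
    proof -
      obtain u v where p: "p = (u, v)" "u \<in> N1" "v \<in> N1" using \<open>p \<in> N1 \<times> N1\<close> by auto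
      show ?thesis unfolding p S2_def prod.case
        by (rule gdot_product_lower_tail[OF _ _ _ _ d]) (use p real in \<open>auto simp: N1_def grid_def\<close>)
    qed
    then have "prob (\<Union>p\<in>N1 \<times> N1. S2 p) \<le> real (card (N1 \<times> N1)) * exp (- real n * (1 / 80)\<^sup>2 / 2^26)"
      using fin by (intro prob_UN_le S2m) auto
    also have "real (card (N1 \<times> N1)) \<le> exp (36 * real d * l)"
    proof -
      have "real (card N1) \<le> (2 / (1 / (10^6 * real n ^ 5)) + 1) ^ (2 * d)"
        unfolding N1_def using n0 by (intro card_grid_le_fine) simp
      \<comment> \<open>The base is at most 3 * 10^6 n^5, and n^4 exceeds the constant. With 2d real
        coordinates this yields exponent 18 d ln n per grid, hence 36 d ln n for pairs.\<close>
      also have "\<dots> \<le> (real n ^ 9) ^ (2 * d)"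
      proof (rule power_mono)
        have n5: "1 \<le> real n ^ 5" using big by simp
        have "(2^62) ^ 4 \<le> real n ^ 4" using big by (intro power_mono) auto
        then have "3 * 10^6 \<le> real n ^ 4" by simp
        then have "3 * 10^6 * real n ^ 5 \<le> real n ^ 4 * real n ^ 5" using n5 by (intro mult_right_mono) auto
        then show "2 / (1 / (10^6 * real n ^ 5)) + 1 \<le> real n ^ 9" using n5 by (simp flip: power_add)
      qed simp
      also have "\<dots> = exp (18 * real d * l)"
      proof -
        have "(real n ^ 9) ^ (2 * d) = exp l ^ (18 * d)" unfolding expl by (simp flip: power_mult)
        also have "\<dots> = exp (real (18 * d) * l)" by (simp only: exp_of_nat_mult)
        finally show ?thesis by simp
      qed
      finally have "real (card N1) * real (card N1) \<le> exp (18 * real d * l) * exp (18 * real d * l)"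
        by (intro mult_mono) auto
      then show ?thesis by (simp add: card_cartesian_product exp_add[symmetric] mult_ac)
    qed
    also have "exp (36 * real d * l) * exp (- real n * (1 / 80)\<^sup>2 / 2^26) \<le> exp (- 2 * l)"
    proof -
      have "36 * real d * l + 2 * l \<le> 64 * (real d * l)"
        using mult_right_mono[OF d1, of l] l1 by simp
      also have "\<dots> \<le> real n * (1 / 80)\<^sup>2 / 2^26" using H1 n0 l1 d1 by (simp add: l_def power2_eq_square)
      finally show ?thesis by (simp add: exp_add[symmetric])
    qed
    finally show ?thesis unfolding exp2 by simp
  qed

  have P3: "prob (\<Union>i<n. S3 u i) \<le> 2 / real n ^ 3" if u: "u \<in> fvecs re d" "vnorm d u \<le> 1" for u
  proof -
    have "prob (\<Union>i<n. S3 u i) \<le> real (card {..<n}) * (2 * exp (- T / 8))"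
      unfolding S3_def using real[OF u(1)] u(2) by (intro prob_UN_le gdot_tail S3m[unfolded S3_def]) auto
    also have "\<dots> = 2 / real n ^ 3" unfolding expT using n0 by (simp add: power4_eq_xxxx power3_eq_cube)
    finally show ?thesis .
  qed
  have "prob (\<Union>j<d. \<Union>i<n. S3 (e j) i) \<le> real (card {..<d}) * (2 / real n ^ 3)"
    using e P3 by (intro prob_UN_le) (auto intro!: sets.finite_UN S3m)
  also have "\<dots> \<le> real n * (2 / real n ^ 3)" using dn by (intro mult_right_mono) auto
  also have "\<dots> = 2 / (real n)\<^sup>2" using n0 by (simp add: power2_eq_square power3_eq_cube)
  finally have P4: "prob (\<Union>j<d. \<Union>i<n. S3 (e j) i) \<le> 2 / (real n)\<^sup>2" .
  have "2 / real n ^ 3 \<le> 2 / (real n)\<^sup>2"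
    using big n0 by (intro divide_left_mono power_increasing) auto
  with P3[OF x1 x1n] have P3': "prob (\<Union>i<n. S3 x1 i) \<le> 2 / (real n)\<^sup>2" by linarith

  define B1 where "B1 = (\<Union>v\<in>N0. S1 v)"
  define B2 where "B2 = (\<Union>p\<in>N1 \<times> N1. S2 p)"
  define B3 where "B3 = (\<Union>i<n. S3 x1 i)"
  define B4 where "B4 = (\<Union>j<d. \<Union>i<n. S3 (e j) i)"
  have Bm: "B1 \<in> events" "B2 \<in> events" "B3 \<in> events" "B4 \<in> events"
    unfolding B1_def B2_def B3_def B4_def using fin by (auto intro!: sets.finite_UN S1m S2m S3m)
  define E where "E = space ?M - (B1 \<union> B2 \<union> (B3 \<union> B4))"
  have "prob (B1 \<union> B2 \<union> (B3 \<union> B4)) \<le> (prob B1 + prob B2) + (prob B3 + prob B4)"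
    using Bm by (intro order_trans[OF measure_Un_le] add_mono measure_Un_le) auto
  also have "\<dots> \<le> (1 / (real n)\<^sup>2 + 1 / (real n)\<^sup>2) + (2 / (real n)\<^sup>2 + 2 / (real n)\<^sup>2)"
    unfolding B1_def B2_def B3_def B4_def by (intro add_mono P1 P2 P3' P4)
  also have "\<dots> = 6 / (real n)\<^sup>2" by (simp add: field_simps)
  finally have "1 - 6 / (real n)\<^sup>2 \<le> prob E"
    unfolding E_def using Bm by (subst prob_compl) auto
  moreover have "E \<in> events" unfolding E_def using Bm by auto
  moreover have "E \<subseteq> {w \<in> space ?M. \<exists>dL dU. part1_conditions re d n (gmeas re gre w) xs (m4 gre) dL dU}"
  proof
    fix w assume w: "w \<in> E"
    then have ws: "w \<in> space ?M" by (simp add: E_def)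
    have "part1_conditions re d n (gmeas re gre w) xs (m4 gre) (1 / 20) (1 / 10)"
    proof (rule good_sample_imp_part1_conditions[OF d dn _ xs, where T = T])
      show "1 \<le> n" using d dn by simp
      show "T \<le> 32 * real n" using ln_le by (simp add: T_def)
      fix v assume "v \<in> grid re d (1 / (100 * sqrt (2 * real d)))"
      then have "w \<notin> S1 v" using w by (auto simp: E_def B1_def N0_def)
      then show "(\<Sum>i<n. if (cmod (gdot gre d w i (\<lambda>j. complex_of_real (1 / vnorm d xs) * xs j)))\<^sup>2 \<le> T
          then (cmod (gdot gre d w i (\<lambda>j. complex_of_real (1 / vnorm d xs) * xs j)))\<^sup>2 * (cmod (gdot gre d w i v))\<^sup>2 else 0)
          \<le> real n * (1 + m4 gre + 1 / 30)"
        using ws unfolding S1_def x1_def[symmetric] by (simp add: not_less)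
    next
      fix u v assume "u \<in> grid re d (1 / (10^6 * real n ^ 5))" "v \<in> grid re d (1 / (10^6 * real n ^ 5))"
      then have "w \<notin> S2 (u, v)" using w by (auto simp: E_def B2_def N1_def)
      then have "\<not> (\<Sum>i<n. (Re (gdot gre d w i u * cnj (gdot gre d w i v)))\<^sup>2) \<le> real n * (qform gre d u v - 1 / 80)"
        using ws unfolding S2_def prod.case mem_Collect_eq by blast
      then show "real n * (qform gre d u v - 1 / 80) \<le> (\<Sum>i<n. (Re (gdot gre d w i u * cnj (gdot gre d w i v)))\<^sup>2)"
        by (rule nle_le[THEN iffD1, THEN conjunct1])
    next
      fix i assume i: "i < n"
      then have "w \<notin> S3 x1 i" using w by (auto simp: E_def B3_def)
      then show "(cmod (gdot gre d w i (\<lambda>j. complex_of_real (1 / vnorm d xs) * xs j)))\<^sup>2 \<le> T"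
        using ws unfolding S3_def x1_def[symmetric] by (simp add: not_less)
      fix j assume j: "j < d"
      then have "w \<notin> S3 (e j) i" using w i by (auto simp: E_def B4_def)
      then show "(cmod (gvec gre w i j))\<^sup>2 \<le> T"
        using ws unfolding S3_def by (simp add: not_less e(3)[OF j])
    qed
    then show "w \<in> {w \<in> space ?M. \<exists>dL dU. part1_conditions re d n (gmeas re gre w) xs (m4 gre) dL dU}"
      using ws by blast
  qed
  ultimately show ?thesis by blast
qed

theorem theorem1:
  shows "(\<forall>(re::bool) (d::nat) (n::nat) (A::nat \<Rightarrow> nat \<Rightarrow> nat \<Rightarrow> complex) (xs::nat \<Rightarrow> complex)
            (m::real) (dL::real) (dU::real) (x::nat \<Rightarrow> complex).
           (\<forall>i<n. hmat re d (A i) \<and> psd re d (A i)) \<and> xs \<in> fvecs re d \<and>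
           part1_conditions re d n A xs m dL dU \<and>
           sosp re d (loss d n A (meas d A (outer xs))) x
           \<longrightarrow> (\<forall>j<d. \<forall>k<d. outer x j k = outer xs j k) \<and>
               (\<exists>s. (re \<longrightarrow> Im s = 0) \<and> cmod s = 1 \<and> (\<forall>j<d. x j = s * xs j)))
       \<and>
       (\<exists>c1::real. \<exists>c2::real. c1 > 0 \<and> c2 > 0 \<and>
          (\<forall>(re::bool) (gre::bool) (d::nat) (n::nat) (xs::nat \<Rightarrow> complex).
             (gre \<longrightarrow> re) \<and> d \<ge> 1 \<and> n \<ge> 1 \<and> xs \<in> fvecs re d \<and>
             real n \<ge> c1 * real d * ln (real d)
             \<longrightarrow> (\<exists>E \<in> sets (gauss_space gre d n).
                   E \<subseteq> {w \<in> space (gauss_space gre d n).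
                          \<exists>dL dU. part1_conditions re d n (gmeas re gre w) xs (m4 gre) dL dU} \<and>
                   measure (gauss_space gre d n) E \<ge> 1 - c2 / (real n)\<^sup>2)))"
proof (rule conjI)
  show "\<forall>(re::bool) (d::nat) (n::nat) (A::nat \<Rightarrow> nat \<Rightarrow> nat \<Rightarrow> complex) (xs::nat \<Rightarrow> complex)
            (m::real) (dL::real) (dU::real) (x::nat \<Rightarrow> complex).
           (\<forall>i<n. hmat re d (A i) \<and> psd re d (A i)) \<and> xs \<in> fvecs re d \<and>
           part1_conditions re d n A xs m dL dU \<and>
           sosp re d (loss d n A (meas d A (outer xs))) x
           \<longrightarrow> (\<forall>j<d. \<forall>k<d. outer x j k = outer xs j k) \<and>
               (\<exists>s. (re \<longrightarrow> Im s = 0) \<and> cmod s = 1 \<and> (\<forall>j<d. x j = s * xs j))"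
  proof (intro allI impI, elim conjE)
    fix re :: bool and d n :: nat and A :: "nat \<Rightarrow> nat \<Rightarrow> nat \<Rightarrow> complex" and xs x :: "nat \<Rightarrow> complex" and m dL dU :: real
    assume A: "\<forall>i<n. hmat re d (A i) \<and> psd re d (A i)" and xs: "xs \<in> fvecs re d"
      and cond: "part1_conditions re d n A xs m dL dU"
      and sosp: "sosp re d (loss d n A (meas d A (outer xs))) x"
    have eq: "outer x j k = outer xs j k" if "j < d" "k < d" for j k
      by (rule second_order_critical_imp_exact[OF _ _ xs cond sosp that]) (use A in auto)
    have "x \<in> fvecs re d" using sosp by (simp add: sosp_def)
    from outer_eq_imp_phase[OF eq this xs] eq
    show "(\<forall>j<d. \<forall>k<d. outer x j k = outer xs j k) \<and>
               (\<exists>s. (re \<longrightarrow> Im s = 0) \<and> cmod s = 1 \<and> (\<forall>j<d. x j = s * xs j))" by blast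
  qed
next
  obtain N0 :: nat where N0: "1 \<le> ln (real n) \<and> 2^48 * (ln (real n))\<^sup>2 \<le> real n \<and> 2^62 * ln (real n) \<le> real n"
    if "N0 \<le> n" for n
    using exists_large_threshold by blast
  define C :: real where "C = 2^62"
  define c1 where "c1 = C * (2 + 4 * ln (2 * C))"
  \<comment> \<open>Below the threshold \<open>N0\<close> the summand (real N0)^2 makes the claimed
    probability nonpositive, and the empty event suffices.\<close>
  define c2 where "c2 = 6 + (real N0)\<^sup>2"
  have C1: "1 \<le> C" by (simp add: C_def)
  have c: "0 < c1" "0 < c2" using C1 by (auto simp: c1_def c2_def intro!: mult_pos_pos add_pos_nonneg)
  have main: "\<exists>E \<in> sets (gauss_space gre d n).
                   E \<subseteq> {w \<in> space (gauss_space gre d n).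
                          \<exists>dL dU. part1_conditions re d n (gmeas re gre w) xs (m4 gre) dL dU} \<and>
                   measure (gauss_space gre d n) E \<ge> 1 - c2 / (real n)\<^sup>2"
    if gre: "gre \<longrightarrow> re" and d: "1 \<le> d" and n: "1 \<le> n" and xs: "xs \<in> fvecs re d"
      and le: "c1 * real d * ln (real d) \<le> real n" for re gre d n xs
  proof (cases "N0 \<le> n")
    case True
    from N0[OF True] have ln: "1 \<le> ln (real n)" "2^48 * (ln (real n))\<^sup>2 \<le> real n" "C * ln (real n) \<le> real n"
      by (auto simp: C_def)
    have "C * real d * ln (real n) \<le> real n"
      using n le by (intro d_ln_d_imp_d_ln_n[OF C1 _ ln(3) d]) (auto simp: c1_def)
    then have "2^62 * real d * ln (real n) \<le> real n" by (simp only: C_def)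
    then obtain E where E: "E \<in> sets (gauss_space gre d n)"
      "E \<subseteq> {w \<in> space (gauss_space gre d n). \<exists>dL dU. part1_conditions re d n (gmeas re gre w) xs (m4 gre) dL dU}"
      "1 - 6 / (real n)\<^sup>2 \<le> measure (gauss_space gre d n) E"
      using gauss_part1_conditions_whp[of gre re d xs n] gre d xs ln by blast
    have "6 / (real n)\<^sup>2 \<le> c2 / (real n)\<^sup>2" by (intro divide_right_mono) (auto simp: c2_def)
    with E(3) have "1 - c2 / (real n)\<^sup>2 \<le> measure (gauss_space gre d n) E" by linarith
    with E show ?thesis by blast
  next
    case False
    then have "(real n)\<^sup>2 \<le> (real N0)\<^sup>2" by (intro power_mono) auto
    then have "(real n)\<^sup>2 \<le> c2" unfolding c2_def by linarith
    then have "1 - c2 / (real n)\<^sup>2 \<le> 0" using n by (simp add: field_simps)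
    then show ?thesis by (intro bexI[of _ "{}"]) auto
  qed
  show "\<exists>c1::real. \<exists>c2::real. c1 > 0 \<and> c2 > 0 \<and>
          (\<forall>(re::bool) (gre::bool) (d::nat) (n::nat) (xs::nat \<Rightarrow> complex).
             (gre \<longrightarrow> re) \<and> d \<ge> 1 \<and> n \<ge> 1 \<and> xs \<in> fvecs re d \<and>
             real n \<ge> c1 * real d * ln (real d)
             \<longrightarrow> (\<exists>E \<in> sets (gauss_space gre d n).
                   E \<subseteq> {w \<in> space (gauss_space gre d n).
                          \<exists>dL dU. part1_conditions re d n (gmeas re gre w) xs (m4 gre) dL dU} \<and>
                   measure (gauss_space gre d n) E \<ge> 1 - c2 / (real n)\<^sup>2))"
    by (intro exI[of _ c1] exI[of _ c2] conjI allI impI c, elim conjE) (rule main; assumption)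
qed

end
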